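(* Assume $\mathrm{OCA}$ and $\mathrm{MA}_{\sigma\text{-linked}}$. Let $(M_n,d_n)$ be finite metric spaces of uniformly bounded diameter, and let $(N_n,\partial_n)$ be separable metric spaces of uniformly bounded diameter. Let $M=\prod_nM_n/\mathrm{Fin}$ and $N=\prod_nN_n/\mathrm{Fin}$. Suppose that $\varphi\colon M\to N$ is coordinate respecting. Then $\varphi$ is trivial.
   Context: $\mathrm{OCA}$: for every separable metrizable $X$ and open $K_0\subseteq[X]^2$, either there is an uncountable $H\subseteq X$ with $[H]^2\subseteq K_0$, or $X=\bigcup_nX_n$ with $[X_n]^2\cap K_0=\emptyset$ for all $n$. $\mathrm{MA}_{\sigma\text{-linked}}$: Martin's Axiom (for $\aleph_1$ dense sets) restricted to $\sigma$-linked posets. Metric reduced product: $\prod_nM_n/\mathrm{Fin}$ is the set of classes $[a]$ of $a\in\prod_nM_n$ under $a\sim b\iff\lim_nd_n(a_n,b_n)=0$, metric $\limsup_nd_n(a_n,b_n)$. For infinite $S\subseteq\mathbb N$, $d^S([a],[b])=\limsup_{n\in S}d_n(a_n,b_n)$, $d^S=0$ for finite $S$; $x=_Sy$ means $d^S(x,y)=0$ (analogously on $N$ with $\partial^S$); this depends only on $S$ modulo finite. $\varphi$ is coordinate respecting if there is an automorphism $\alpha$ of $\mathcal P(\mathbb N)/\mathrm{Fin}$ such that for all $S$ and $a,b\in M$: $a=_Sb\Rightarrow\varphi(a)=_{\alpha(S)}\varphi(b)$. $\varphi$ is trivial if there are an almost permutation $f$ of $\mathbb N$ (bijection between cofinite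 subsets) and maps $h_n\colon M_{f(n)}\to N_n$ such that $\varphi([a])=[(h_n(a_{f(n)}))_n]$ for all $a\in\prod_nM_n$. *)

theory Defs
  imports "HOL-Analysis.Analysis" "HOL-Library.Ramsey"
begin

unbundle cardinal_syntax

text \<open>Here \<open>[A]\<^bsup>2\<^esup>\<close> is the library's set of two-element subsets of \<open>A\<close>; a set of
  unordered pairs is open if the corresponding symmetric subset of the square is open.\<close>

definition OCA_for :: "'a topology \<Rightarrow> bool" where
  "OCA_for X \<longleftrightarrow>
    (\<forall>K0. K0 \<subseteq> [topspace X]\<^bsup>2\<^esup> \<and> openin (prod_topology X X) {(x, y). {x, y} \<in> K0} \<longrightarrow>
      (\<exists>H \<subseteq> topspace X. uncountable H \<and> [H]\<^bsup>2\<^esup> \<subseteq> K0) \<or>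
      (\<exists>Y :: nat \<Rightarrow> 'a set. topspace X = (\<Union>n. Y n) \<and> (\<forall>n. [Y n]\<^bsup>2\<^esup> \<inter> K0 = {})))"

text \<open>HOL cannot quantify over types inside a proposition. Since a separable metrizable space
  has at most continuum many points, it is enough to let \<open>X\<close> range over all topologies (not just
  the Euclidean one) whose points are reals; see \<open>OCA_imp_OCA_for\<close> below.\<close>

definition OCA :: bool where
  "OCA \<longleftrightarrow> (\<forall>X :: real topology. metrizable_space X \<and> separable_space X \<longrightarrow> OCA_for X)"


text \<open>A forcing poset is a carrier \<open>P\<close> with a partial order \<open>r\<close>, where \<open>(p, q) \<in> r\<close> means
  \<open>p \<le> q\<close>.\<close>

definition compatible :: "'a set \<Rightarrow> 'a rel \<Rightarrow> 'a \<Rightarrow> 'a \<Rightarrow> bool" where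
  "compatible P r p q \<longleftrightarrow> (\<exists>s\<in>P. (s, p) \<in> r \<and> (s, q) \<in> r)"

definition sigma_linked :: "'a set \<Rightarrow> 'a rel \<Rightarrow> bool" where
  "sigma_linked P r \<longleftrightarrow>
    (\<exists>L :: nat \<Rightarrow> 'a set. P = (\<Union>n. L n) \<and> (\<forall>n. \<forall>p\<in>L n. \<forall>q\<in>L n. compatible P r p q))"

definition poset_dense :: "'a set \<Rightarrow> 'a rel \<Rightarrow> 'a set \<Rightarrow> bool" where
  "poset_dense P r D \<longleftrightarrow> D \<subseteq> P \<and> (\<forall>p\<in>P. \<exists>d\<in>D. (d, p) \<in> r)"

definition poset_filter :: "'a set \<Rightarrow> 'a rel \<Rightarrow> 'a set \<Rightarrow> bool" where
  "poset_filter P r G \<longleftrightarrow> G \<subseteq> P \<and> G \<noteq> {} \<and>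
    (\<forall>p\<in>G. \<forall>q\<in>P. (p, q) \<in> r \<longrightarrow> q \<in> G) \<and>
    (\<forall>p\<in>G. \<forall>q\<in>G. \<exists>s\<in>G. (s, p) \<in> r \<and> (s, q) \<in> r)"

text \<open>\<open>cardSuc natLeq\<close> is the cardinal aleph one.\<close>

definition MA_aleph1_for :: "'a set \<Rightarrow> 'a rel \<Rightarrow> bool" where
  "MA_aleph1_for P r \<longleftrightarrow>
    (\<forall>\<D>. |\<D>| \<le>o cardSuc natLeq \<and> (\<forall>D\<in>\<D>. poset_dense P r D) \<longrightarrow>
      (\<exists>G. poset_filter P r G \<and> (\<forall>D\<in>\<D>. G \<inter> D \<noteq> {})))"

text \<open>As for \<open>OCA\<close>, carriers are sets of reals. For \<open>\<aleph>\<^sub>1\<close> dense sets this loses no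
  generality: one passes to a subposet of size at most continuum that is closed under witnesses
  for compatibility and density; see \<open>MA_sigma_linked_imp_MA_aleph1_for\<close> below.\<close>

definition MA_sigma_linked :: bool where
  "MA_sigma_linked \<longleftrightarrow>
    (\<forall>(P :: real set) r. P \<noteq> {} \<and> partial_order_on P r \<and> sigma_linked P r \<longrightarrow> MA_aleph1_for P r)"


definition eq_mod_fin :: "nat set \<Rightarrow> nat set \<Rightarrow> bool" where
  "eq_mod_fin S T \<longleftrightarrow> finite ((S - T) \<union> (T - S))"

lemma equivp_eq_mod_fin: "equivp eq_mod_fin"
proof (rule equivpI)
  show "transp eq_mod_fin"
  proof (rule transpI)
    fix S T U assume "eq_mod_fin S T" "eq_mod_fin T U"
    moreover have "(S - U) \<union> (U - S) \<subseteq> ((S - T) \<union> (T - S)) \<union> ((T - U) \<union> (U - T))" by blast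
    ultimately show "eq_mod_fin S U"
      unfolding eq_mod_fin_def by (meson finite_UnI finite_subset)
  qed
qed (auto simp: eq_mod_fin_def reflp_def symp_def Un_commute)

quotient_type pow_fin = "nat set" / eq_mod_fin
  by (rule equivp_eq_mod_fin)

instantiation pow_fin :: boolean_algebra
begin

lift_definition inf_pow_fin :: "pow_fin \<Rightarrow> pow_fin \<Rightarrow> pow_fin" is "(\<inter>)"
proof -
  fix S S' T T' :: "nat set"
  assume "eq_mod_fin S S'" "eq_mod_fin T T'"
  moreover have "((S \<inter> T) - (S' \<inter> T')) \<union> ((S' \<inter> T') - (S \<inter> T))
      \<subseteq> ((S - S') \<union> (S' - S)) \<union> ((T - T') \<union> (T' - T))" by blast
  ultimately show "eq_mod_fin (S \<inter> T) (S' \<inter> T')"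
    unfolding eq_mod_fin_def by (meson finite_UnI finite_subset)
qed

lift_definition sup_pow_fin :: "pow_fin \<Rightarrow> pow_fin \<Rightarrow> pow_fin" is "(\<union>)"
proof -
  fix S S' T T' :: "nat set"
  assume "eq_mod_fin S S'" "eq_mod_fin T T'"
  moreover have "((S \<union> T) - (S' \<union> T')) \<union> ((S' \<union> T') - (S \<union> T))
      \<subseteq> ((S - S') \<union> (S' - S)) \<union> ((T - T') \<union> (T' - T))" by blast
  ultimately show "eq_mod_fin (S \<union> T) (S' \<union> T')"
    unfolding eq_mod_fin_def by (meson finite_UnI finite_subset)
qed

lift_definition uminus_pow_fin :: "pow_fin \<Rightarrow> pow_fin" is "\<lambda>S. - S"
proof -
  fix S T :: "nat set"
  have "(- S - - T) \<union> (- T - - S) = (S - T) \<union> (T - S)" by blast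
  then show "eq_mod_fin S T \<Longrightarrow> eq_mod_fin (- S) (- T)" by (simp add: eq_mod_fin_def)
qed

lift_definition bot_pow_fin :: pow_fin is "{}" .

lift_definition top_pow_fin :: pow_fin is "UNIV" .

definition minus_pow_fin :: "pow_fin \<Rightarrow> pow_fin \<Rightarrow> pow_fin" where
  "minus_pow_fin x y = inf x (- y)"

definition less_eq_pow_fin :: "pow_fin \<Rightarrow> pow_fin \<Rightarrow> bool" where
  "less_eq_pow_fin x y \<longleftrightarrow> inf x y = x"

definition less_pow_fin :: "pow_fin \<Rightarrow> pow_fin \<Rightarrow> bool" where
  "less_pow_fin x y \<longleftrightarrow> x \<le> y \<and> \<not> y \<le> x"

instance
proof
  have comm: "inf x y = inf y x" for x y :: pow_fin
    by transfer (simp add: Int_commute eq_mod_fin_def)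
  have assoc: "inf (inf x y) z = inf x (inf y z)" for x y z :: pow_fin
    by transfer (simp add: Int_assoc eq_mod_fin_def)
  have idem: "inf x x = x" for x :: pow_fin
    by transfer (simp add: eq_mod_fin_def)
  have scomm: "sup x y = sup y x" for x y :: pow_fin
    by transfer (simp add: Un_commute eq_mod_fin_def)
  have absorb: "inf x (sup x y) = x" for x y :: pow_fin
    by transfer (simp add: eq_mod_fin_def Un_Int_distrib Int_absorb1)
  have dist: "inf x (sup y z) = sup (inf x y) (inf x z)" for x y z :: pow_fin
    by transfer (simp add: Int_Un_distrib eq_mod_fin_def)
  fix x y z :: pow_fin
  show "x < y \<longleftrightarrow> x \<le> y \<and> \<not> y \<le> x" by (rule less_pow_fin_def)
  show "x \<le> x" by (simp add: less_eq_pow_fin_def idem)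
  show "x \<le> z" if "x \<le> y" "y \<le> z" using that by (metis less_eq_pow_fin_def assoc)
  show "x = y" if "x \<le> y" "y \<le> x" using that by (metis less_eq_pow_fin_def comm)
  show "inf x y \<le> x" by (metis less_eq_pow_fin_def assoc comm idem)
  show "inf x y \<le> y" by (metis less_eq_pow_fin_def assoc comm idem)
  show "x \<le> inf y z" if "x \<le> y" "x \<le> z" using that by (metis less_eq_pow_fin_def assoc)
  show "x \<le> sup x y" by (simp add: less_eq_pow_fin_def absorb)
  show "y \<le> sup x y" by (metis less_eq_pow_fin_def absorb scomm)
  show "sup y z \<le> x" if "y \<le> x" "z \<le> x" using that by (metis less_eq_pow_fin_def dist comm)
  show "bot \<le> x" unfolding less_eq_pow_fin_def by transfer (simp add: eq_mod_fin_def)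
  show "x \<le> top" unfolding less_eq_pow_fin_def by transfer (simp add: eq_mod_fin_def)
  show "sup x (inf y z) = inf (sup x y) (sup x z)"
    by transfer (simp add: Un_Int_distrib eq_mod_fin_def)
  show "inf x (- x) = bot" by transfer (simp add: eq_mod_fin_def)
  show "sup x (- x) = top" by transfer (simp add: eq_mod_fin_def)
  show "x - y = inf x (- y)" by (rule minus_pow_fin_def)
qed

end

lemma abs_pow_fin_le_iff: "abs_pow_fin S \<le> abs_pow_fin T \<longleftrightarrow> finite (S - T)"
proof -
  have "(S \<inter> T - S) \<union> (S - S \<inter> T) = S - T" by blast
  then show ?thesis
    by (simp add: less_eq_pow_fin_def inf_pow_fin.abs_eq pow_fin.abs_eq_iff eq_mod_fin_def)
qed

definition pow_fin_automorphism :: "(pow_fin \<Rightarrow> pow_fin) \<Rightarrow> bool" where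
  "pow_fin_automorphism \<alpha> \<longleftrightarrow> bij \<alpha> \<and>
    (\<forall>x y. \<alpha> (inf x y) = inf (\<alpha> x) (\<alpha> y)) \<and>
    (\<forall>x y. \<alpha> (sup x y) = sup (\<alpha> x) (\<alpha> y)) \<and>
    (\<forall>x. \<alpha> (- x) = - \<alpha> x)"


definition uniformly_bounded_diameter :: "(nat \<Rightarrow> 'a metric) \<Rightarrow> bool" where
  "uniformly_bounded_diameter M \<longleftrightarrow>
    (\<exists>B. \<forall>n. \<forall>x\<in>mspace (M n). \<forall>y\<in>mspace (M n). mdist (M n) x y \<le> B)"

definition seq_space :: "(nat \<Rightarrow> 'a metric) \<Rightarrow> (nat \<Rightarrow> 'a) set" where
  "seq_space M = (\<Pi> n\<in>UNIV. mspace (M n))"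

definition asymp_eq_rel :: "(nat \<Rightarrow> 'a metric) \<Rightarrow> (nat \<Rightarrow> 'a) rel" where
  "asymp_eq_rel M = {(a, b). a \<in> seq_space M \<and> b \<in> seq_space M \<and>
     (\<lambda>n. mdist (M n) (a n) (b n)) \<longlonglongrightarrow> 0}"

definition red_class :: "(nat \<Rightarrow> 'a metric) \<Rightarrow> (nat \<Rightarrow> 'a) \<Rightarrow> (nat \<Rightarrow> 'a) set" where
  "red_class M a = asymp_eq_rel M `` {a}"

definition reduced_product :: "(nat \<Rightarrow> 'a metric) \<Rightarrow> (nat \<Rightarrow> 'a) set set" where
  "reduced_product M = seq_space M // asymp_eq_rel M"

text \<open>The upper limit of the distances as \<open>n\<close> tends to infinity within \<open>S\<close>. For finite \<open>S\<close> the
  filter is trivial (and the upper limit would be \<open>- \<infinity>\<close>), whence the case distinction.\<close>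

definition limsup_dist_on ::
  "(nat \<Rightarrow> 'a metric) \<Rightarrow> nat set \<Rightarrow> (nat \<Rightarrow> 'a) \<Rightarrow> (nat \<Rightarrow> 'a) \<Rightarrow> ereal" where
  "limsup_dist_on M S a b =
    (if finite S then 0
     else Limsup (inf sequentially (principal S)) (\<lambda>n. ereal (mdist (M n) (a n) (b n))))"

text \<open>The pseudometric \<open>d\<^sup>S\<close> on the reduced product, and for \<open>S = UNIV\<close> its metric. It does
  not depend on the representatives; see \<open>red_dist_red_class\<close> below.\<close>

definition red_dist ::
  "(nat \<Rightarrow> 'a metric) \<Rightarrow> nat set \<Rightarrow> (nat \<Rightarrow> 'a) set \<Rightarrow> (nat \<Rightarrow> 'a) set \<Rightarrow> ereal" where
  "red_dist M S x y = (THE t. \<exists>a\<in>x. \<exists>b\<in>y. t = limsup_dist_on M S a b)"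

definition red_eq_on ::
  "(nat \<Rightarrow> 'a metric) \<Rightarrow> nat set \<Rightarrow> (nat \<Rightarrow> 'a) set \<Rightarrow> (nat \<Rightarrow> 'a) set \<Rightarrow> bool" where
  "red_eq_on M S x y \<longleftrightarrow> red_dist M S x y = 0"

text \<open>In the next definition \<open>T\<close> ranges over the representatives of \<open>\<alpha> [S]\<close>; the choice of
  representative is immaterial by \<open>red_eq_on_cong_mod_fin\<close> below.\<close>

definition coordinate_respecting ::
  "(nat \<Rightarrow> 'a metric) \<Rightarrow> (nat \<Rightarrow> 'b metric) \<Rightarrow> ((nat \<Rightarrow> 'a) set \<Rightarrow> (nat \<Rightarrow> 'b) set) \<Rightarrow> bool" where
  "coordinate_respecting M N \<phi> \<longleftrightarrow>
    (\<exists>\<alpha>. pow_fin_automorphism \<alpha> \<and>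
      (\<forall>S T. abs_pow_fin T = \<alpha> (abs_pow_fin S) \<longrightarrow>
        (\<forall>x\<in>reduced_product M. \<forall>y\<in>reduced_product M.
          red_eq_on M S x y \<longrightarrow> red_eq_on N T (\<phi> x) (\<phi> y))))"

text \<open>An almost permutation is encoded by a total function; its values outside the cofinite
  domain \<open>A\<close> are irrelevant. Accordingly, below only the maps \<open>h n\<close> with \<open>n \<in> A\<close> matter, since
  changing finitely many coordinates of a sequence does not change its class.\<close>

definition almost_permutation :: "(nat \<Rightarrow> nat) \<Rightarrow> bool" where
  "almost_permutation f \<longleftrightarrow> (\<exists>A B. finite (- A) \<and> finite (- B) \<and> bij_betw f A B)"

definition trivial_map ::
  "(nat \<Rightarrow> 'a metric) \<Rightarrow> (nat \<Rightarrow> 'b metric) \<Rightarrow> ((nat \<Rightarrow> 'a) set \<Rightarrow> (nat \<Rightarrow> 'b) set) \<Rightarrow> bool" where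
  "trivial_map M N \<phi> \<longleftrightarrow>
    (\<exists>f h. almost_permutation f \<and>
      (\<forall>n. h n \<in> mspace (M (f n)) \<rightarrow> mspace (N n)) \<and>
      (\<forall>a\<in>seq_space M. \<phi> (red_class M a) = red_class N (\<lambda>n. h n (a (f n)))))"


lemma equiv_asymp_eq_rel: "equiv (seq_space M) (asymp_eq_rel M)"
proof (rule equivI)
  show "asymp_eq_rel M \<subseteq> seq_space M \<times> seq_space M" by (auto simp: asymp_eq_rel_def)
  show "refl_on (seq_space M) (asymp_eq_rel M)"
    unfolding refl_on_def
  proof
    fix a assume a: "a \<in> seq_space M"
    then have "mdist (M n) (a n) (a n) = 0" for n by (auto simp: seq_space_def Pi_iff)
    then show "(a, a) \<in> asymp_eq_rel M" using a by (simp add: asymp_eq_rel_def)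
  qed
  show "sym (asymp_eq_rel M)"
    unfolding sym_def asymp_eq_rel_def by (simp add: mdist_commute)
  show "trans (asymp_eq_rel M)"
  proof (rule transI)
    fix a b c assume ab: "(a, b) \<in> asymp_eq_rel M" and bc: "(b, c) \<in> asymp_eq_rel M"
    then have sp: "a \<in> seq_space M" "b \<in> seq_space M" "c \<in> seq_space M"
      by (auto simp: asymp_eq_rel_def)
    have "(\<lambda>n. mdist (M n) (a n) (b n) + mdist (M n) (b n) (c n)) \<longlonglongrightarrow> 0 + 0"
      using ab bc by (intro tendsto_add) (simp_all add: asymp_eq_rel_def)
    then have lim: "(\<lambda>n. mdist (M n) (a n) (b n) + mdist (M n) (b n) (c n)) \<longlonglongrightarrow> 0"
      by simp
    have "mdist (M n) (a n) (c n) \<le> mdist (M n) (a n) (b n) + mdist (M n) (b n) (c n)" for n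
      using sp by (intro mdist_triangle) (simp_all add: seq_space_def Pi_iff)
    then have "(\<lambda>n. mdist (M n) (a n) (c n)) \<longlonglongrightarrow> 0"
      by (intro tendsto_sandwich[OF _ _ tendsto_const lim]) (simp_all add: always_eventually)
    then show "(a, c) \<in> asymp_eq_rel M" using sp by (simp add: asymp_eq_rel_def)
  qed
qed

lemma limsup_dist_on_cong_aux:
  assumes "(a, a') \<in> asymp_eq_rel M" "(b, b') \<in> asymp_eq_rel M"
  shows "limsup_dist_on M S a b \<le> limsup_dist_on M S a' b'"
proof (cases "finite S")
  case False
  let ?F = "inf sequentially (principal S)"
  let ?e = "\<lambda>n. mdist (M n) (a n) (a' n) + mdist (M n) (b n) (b' n)"
  have nb: "?F \<noteq> bot"
  proof
    assume "?F = bot"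
    then have "\<forall>\<^sub>F n in sequentially. n \<notin> S"
      by (simp add: trivial_limit_def eventually_inf_principal)
    then obtain k where "\<And>n. n \<ge> k \<Longrightarrow> n \<notin> S" unfolding eventually_sequentially by blast
    then have "S \<subseteq> {..<k}" by (meson lessThan_iff not_le subsetI)
    then show False using False finite_subset by blast
  qed
  have "?e \<longlonglongrightarrow> 0 + 0"
    using assms by (intro tendsto_add) (auto simp: asymp_eq_rel_def)
  then have lim: "?e \<longlonglongrightarrow> 0" by simp
  have "Limsup ?F (\<lambda>n. ereal (mdist (M n) (a n) (b n)))
      \<le> Limsup ?F (\<lambda>n. ereal (mdist (M n) (a' n) (b' n))) + ereal e" if "e > 0" for e
  proof -
    have "\<forall>\<^sub>F n in sequentially. ?e n < e" using lim that by (rule order_tendstoD(2))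
    then have "\<forall>\<^sub>F n in ?F. ?e n < e" by (rule filter_leD[rotated]) simp
    then have "\<forall>\<^sub>F n in ?F. ereal (mdist (M n) (a n) (b n))
        \<le> ereal (mdist (M n) (a' n) (b' n)) + ereal e"
    proof (rule eventually_mono)
      fix n assume n: "?e n < e"
      have sp: "a n \<in> mspace (M n)" "a' n \<in> mspace (M n)" "b n \<in> mspace (M n)" "b' n \<in> mspace (M n)"
        using assms by (auto simp: asymp_eq_rel_def seq_space_def Pi_iff)
      have "mdist (M n) (a n) (b n) \<le> mdist (M n) (a n) (a' n) + mdist (M n) (a' n) (b n)"
        "mdist (M n) (a' n) (b n) \<le> mdist (M n) (a' n) (b' n) + mdist (M n) (b' n) (b n)"
        using sp by (auto intro: mdist_triangle)
      then show "ereal (mdist (M n) (a n) (b n)) \<le> ereal (mdist (M n) (a' n) (b' n)) + ereal e"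
        using n by (simp add: mdist_commute)
    qed
    then have "Limsup ?F (\<lambda>n. ereal (mdist (M n) (a n) (b n)))
        \<le> Limsup ?F (\<lambda>n. ereal (mdist (M n) (a' n) (b' n)) + ereal e)"
      by (rule Limsup_mono)
    also have "\<dots> = Limsup ?F (\<lambda>n. ereal (mdist (M n) (a' n) (b' n))) + ereal e"
      by (rule Limsup_add_ereal_right[OF nb]) simp
    finally show ?thesis .
  qed
  then have "Limsup ?F (\<lambda>n. ereal (mdist (M n) (a n) (b n)))
      \<le> Limsup ?F (\<lambda>n. ereal (mdist (M n) (a' n) (b' n)))"
    by (rule ereal_le_epsilon2)
  then show ?thesis using False by (simp add: limsup_dist_on_def)
qed (simp add: limsup_dist_on_def)

lemma limsup_dist_on_cong:
  assumes "(a, a') \<in> asymp_eq_rel M" "(b, b') \<in> asymp_eq_rel M"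
  shows "limsup_dist_on M S a b = limsup_dist_on M S a' b'"
proof -
  have "sym (asymp_eq_rel M)" using equiv_asymp_eq_rel by (rule equivE)
  then show ?thesis using assms by (meson antisym limsup_dist_on_cong_aux symD)
qed

lemma red_dist_red_class:
  assumes "a \<in> seq_space M" "b \<in> seq_space M"
  shows "red_dist M S (red_class M a) (red_class M b) = limsup_dist_on M S a b"
proof -
  have "a \<in> red_class M a" "b \<in> red_class M b"
    using assms equiv_asymp_eq_rel[of M] by (auto simp: red_class_def equiv_def refl_on_def)
  moreover have "limsup_dist_on M S a' b' = limsup_dist_on M S a b"
    if "a' \<in> red_class M a" "b' \<in> red_class M b" for a' b'
    using that limsup_dist_on_cong[of a a' M b b' S] by (simp add: red_class_def)
  ultimately show ?thesis
    unfolding red_dist_def by (intro the_equality) blast+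
qed

lemma red_eq_on_cong_mod_fin:
  assumes "eq_mod_fin S T"
  shows "red_eq_on M S x y \<longleftrightarrow> red_eq_on M T x y"
proof -
  have fin: "finite S \<longleftrightarrow> finite T"
    using assms unfolding eq_mod_fin_def by (metis finite_Diff2 finite_Un)
  obtain n0 where n0: "\<And>n. n \<in> (S - T) \<union> (T - S) \<Longrightarrow> n < n0"
    using assms unfolding eq_mod_fin_def finite_nat_set_iff_bounded by blast
  have "inf sequentially (principal S) = inf sequentially (principal T)"
  proof (rule filter_eqI)
    fix Q
    have ev: "\<forall>\<^sub>F n in sequentially. n \<in> S \<longleftrightarrow> n \<in> T"
      using n0 unfolding eventually_sequentially
      by (intro exI[of _ n0]) (metis DiffI UnI1 UnI2 not_le)
    show "eventually Q (inf sequentially (principal S)) \<longleftrightarrow>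
        eventually Q (inf sequentially (principal T))"
      unfolding eventually_inf_principal
      by (rule eventually_cong[OF ev]) auto
  qed
  then have "limsup_dist_on M S = limsup_dist_on M T"
    by (simp add: limsup_dist_on_def fin fun_eq_iff)
  then show ?thesis by (simp add: red_eq_on_def red_dist_def)
qed


lemma separable_metrizable_lepoll_real:
  fixes X :: "'a topology"
  assumes "metrizable_space X" "separable_space X"
  shows "topspace X \<lesssim> (UNIV :: real set)"
proof -
  obtain C where C: "countable C" "C \<subseteq> topspace X" "X closure_of C = topspace X"
    using assms(2) unfolding separable_space_def by blast
  obtain M d where Md: "Metric_space M d" "X = Metric_space.mtopology M d"
    using assms(1) unfolding metrizable_space_def by blast
  interpret Metric_space M d by (rule Md)
  have top: "topspace X = M" using Md by simp
  show ?thesis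
  proof (cases "C = {}")
    case True
    then show ?thesis using C by (simp add: lepoll_def)
  next
    case False
    define c where "c = from_nat_into C"
    have cM: "c i \<in> M" for i using False C(2) top by (metis c_def from_nat_into subsetD)
    define g where "g x = {n. d (c (fst (prod_decode n))) x < 1 / Suc (snd (prod_decode n))}" for x
    have "inj_on g M"
    proof (rule inj_onI, rule ccontr)
      fix x y assume xy: "x \<in> M" "y \<in> M" "g x = g y" "x \<noteq> y"
      define e where "e = d x y"
      have "e > 0" using xy by (simp add: e_def)
      then obtain k where k: "1 / real (Suc k) < e / 2"
        using nat_approx_posE[of "e/2"] by (metis half_gt_zero)
      have "x \<in> X closure_of C" using C(3) top xy by simp
      then have "\<forall>t>0. \<exists>z\<in>C. z \<in> mball x t"
        unfolding Md(2) metric_closure_of by blast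
      moreover have "1 / real (Suc k) > 0" by simp
      ultimately obtain z where z: "z \<in> C" "z \<in> mball x (1 / Suc k)" by blast
      obtain i where i: "c i = z" using z C(1) by (metis c_def from_nat_into_surj)
      have "d z x < 1 / Suc k" using z(2) by (simp add: commute)
      then have "prod_encode (i, k) \<in> g x" by (simp add: g_def i)
      then have "prod_encode (i, k) \<in> g y" using xy by simp
      then have "d z y < 1 / Suc k" by (simp add: g_def i)
      moreover have "d x y \<le> d x z + d z y" using xy z cM i triangle by blast
      ultimately show False using \<open>d z x < _\<close> k by (simp add: e_def commute)
    qed
    then have "M \<lesssim> (UNIV :: nat set set)" unfolding lepoll_def by blast
    then show ?thesis
      using top nat_sets_eqpoll_reals lepoll_trans eqpoll_imp_lepoll by metis
  qed
qed

lemma nsets_image_inj_on: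
  assumes "inj_on f A"
  shows "[f ` A]\<^bsup>2\<^esup> = (`) f ` [A]\<^bsup>2\<^esup>"
proof
  show "(`) f ` [A]\<^bsup>2\<^esup> \<subseteq> [f ` A]\<^bsup>2\<^esup>"
    using assms by (auto simp: nsets_def card_image inj_on_subset)
  show "[f ` A]\<^bsup>2\<^esup> \<subseteq> (`) f ` [A]\<^bsup>2\<^esup>"
  proof
    fix N assume N: "N \<in> [f ` A]\<^bsup>2\<^esup>"
    then obtain B where B: "B \<subseteq> A" "N = f ` B" by (auto simp: nsets_def subset_image_iff)
    then have "inj_on f B" using assms inj_on_subset by blast
    then have "B \<in> [A]\<^bsup>2\<^esup>" using N B by (simp add: nsets_def card_image finite_image_iff)
    then show "N \<in> (`) f ` [A]\<^bsup>2\<^esup>" using B by blast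
  qed
qed

lemma OCA_for_homeomorphic:
  assumes h: "homeomorphic_maps X Y f g" and Y: "OCA_for Y"
  shows "OCA_for X"
  unfolding OCA_for_def
proof (intro allI impI, elim conjE)
  fix K0 assume K0: "K0 \<subseteq> [topspace X]\<^bsup>2\<^esup>" "openin (prod_topology X X) {(x, y). {x, y} \<in> K0}"
  have cg: "continuous_map Y X g" and gf: "\<And>x. x \<in> topspace X \<Longrightarrow> g (f x) = x"
    and fg: "\<And>y. y \<in> topspace Y \<Longrightarrow> f (g y) = y"
    and fX: "\<And>x. x \<in> topspace X \<Longrightarrow> f x \<in> topspace Y"
    and gY: "\<And>y. y \<in> topspace Y \<Longrightarrow> g y \<in> topspace X"
    using h by (auto simp: homeomorphic_maps_def continuous_map_def)
  have injf: "inj_on f (topspace X)" by (metis gf inj_onI)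
  have injg: "inj_on g (topspace Y)" by (metis fg inj_onI)
  have imf: "f ` topspace X = topspace Y" using fX gY fg by (metis imageI subsetI subset_antisym image_subsetI)
  define K1 where "K1 = {p \<in> [topspace Y]\<^bsup>2\<^esup>. g ` p \<in> K0}"
  have "{(x, y). {x, y} \<in> K1} = {p \<in> topspace (prod_topology Y Y). (\<lambda>(x, y). (g x, g y)) p \<in> {(x, y). {x, y} \<in> K0}}"
  proof -
    have "{x, y} \<in> [topspace Y]\<^bsup>2\<^esup>" if "x \<in> topspace Y" "y \<in> topspace Y" "{g x, g y} \<in> K0" for x y
    proof -
      have "{g x, g y} \<in> [topspace X]\<^bsup>2\<^esup>" using K0 that by blast
      then have "g x \<noteq> g y" by (auto simp: nsets_def)
      then have "x \<noteq> y" by blast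
      then show ?thesis using that by (simp add: nsets_def)
    qed
    then show ?thesis by (auto simp: K1_def nsets_def)
  qed
  moreover have "continuous_map (prod_topology Y Y) (prod_topology X X) (\<lambda>(x, y). (g x, g y))"
    using cg continuous_map_prod_top by blast
  ultimately have "openin (prod_topology Y Y) {(x, y). {x, y} \<in> K1}"
    using K0(2) openin_continuous_map_preimage by fastforce
  moreover have "K1 \<subseteq> [topspace Y]\<^bsup>2\<^esup>" by (auto simp: K1_def)
  ultimately consider
      (1) H where "H \<subseteq> topspace Y" "uncountable H" "[H]\<^bsup>2\<^esup> \<subseteq> K1"
    | (2) Z where "topspace Y = (\<Union>n::nat. Z n)" "\<And>n. [Z n]\<^bsup>2\<^esup> \<inter> K1 = {}"
    using Y unfolding OCA_for_def by metis
  then show "(\<exists>H\<subseteq>topspace X. uncountable H \<and> [H]\<^bsup>2\<^esup> \<subseteq> K0) \<or>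
      (\<exists>Y. topspace X = (\<Union>n::nat. Y n) \<and> (\<forall>n. [Y n]\<^bsup>2\<^esup> \<inter> K0 = {}))"
  proof cases
    case 1
    have i: "inj_on g H" using injg 1(1) inj_on_subset by blast
    have "g ` H \<subseteq> topspace X" using 1(1) gY by blast
    moreover have "uncountable (g ` H)" using 1(2) i countable_image_inj_on by blast
    moreover have "[g ` H]\<^bsup>2\<^esup> \<subseteq> K0"
      unfolding nsets_image_inj_on[OF i] using 1(3) by (auto simp: K1_def)
    ultimately show ?thesis by blast
  next
    case 2
    define W where "W n = g ` Z n" for n
    have Z: "Z n \<subseteq> topspace Y" for n using 2(1) by blast
    have "g ` topspace Y = topspace X" using fX gY gf by (metis imageI subsetI subset_antisym image_subsetI)
    then have "topspace X = (\<Union>n. W n)" unfolding W_def 2(1) by blast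
    moreover have "[W n]\<^bsup>2\<^esup> \<inter> K0 = {}" for n
    proof -
      have i: "inj_on g (Z n)" using injg Z inj_on_subset by blast
      have "g ` p \<notin> K0" if "p \<in> [Z n]\<^bsup>2\<^esup>" for p
        using 2(2)[of n] that nsets_mono[OF Z[of n], of 2] by (auto simp: K1_def)
      then show ?thesis unfolding W_def nsets_image_inj_on[OF i] by blast
    qed
    ultimately show ?thesis by blast
  qed
qed

theorem OCA_imp_OCA_for:
  fixes X :: "'a topology"
  assumes "OCA" "metrizable_space X" "separable_space X"
  shows "OCA_for X"
proof -
  obtain f :: "'a \<Rightarrow> real" where f: "inj_on f (topspace X)"
    using separable_metrizable_lepoll_real[OF assms(2,3)] unfolding lepoll_def by blast
  define g where "g = the_inv_into (topspace X) f"
  have gf: "g (f x) = x" if "x \<in> topspace X" for x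
    using f that by (simp add: g_def the_inv_into_f_f)
  define Y where "Y = pullback_topology (f ` topspace X) g X"
  have im: "g ` f ` topspace X = topspace X" using gf by force
  have topY: "topspace Y = f ` topspace X"
    using im by (auto simp: Y_def topspace_pullback_topology)
  have "continuous_map Y X g"
    unfolding Y_def by (metis continuous_map_id continuous_map_pullback comp_id fun.map_id id_comp)
  moreover have "continuous_map X Y f"
    unfolding Y_def
  proof (rule continuous_map_pullback')
    show "continuous_map X X (g \<circ> f)" by (rule continuous_map_eq[OF continuous_map_id]) (simp add: gf)
    show "topspace X \<subseteq> f -` f ` topspace X" by blast
  qed
  ultimately have h: "homeomorphic_maps X Y f g"
    using gf topY by (auto simp: homeomorphic_maps_def)
  then have "X homeomorphic_space Y" unfolding homeomorphic_space_def by blast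
  then have "metrizable_space Y" "separable_space Y"
    using assms(2,3) homeomorphic_metrizable_space homeomorphic_separable_space by blast+
  then have "OCA_for Y" using assms(1) unfolding OCA_def by blast
  then show ?thesis using h OCA_for_homeomorphic by blast
qed

lemma aleph1_ordLeq_real: "cardSuc natLeq \<le>o |UNIV :: real set|"
proof (rule cardSuc_least[OF natLeq_Card_order card_of_Card_order])
  have "|UNIV :: nat set| <o |UNIV :: nat set set|" using card_of_Pow[of "UNIV :: nat set"] by simp
  also have "|UNIV :: nat set set| =o |UNIV :: real set|"
    using nat_sets_eqpoll_reals by (simp add: eqpoll_iff_card_of_ordIso)
  finally show "natLeq <o |UNIV :: real set|"
    using card_of_nat ordIso_ordLess_trans ordIso_symmetric by blast
qed

theorem MA_sigma_linked_imp_MA_aleph1_for: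
  fixes P :: "'a set"
  assumes MA: "MA_sigma_linked" and "P \<noteq> {}" and po: "partial_order_on P r" and sl: "sigma_linked P r"
  shows "MA_aleph1_for P r"
  unfolding MA_aleph1_for_def
proof (intro allI impI, elim conjE)
  fix \<D> assume card: "|\<D>| \<le>o cardSuc natLeq" and dense: "\<forall>D\<in>\<D>. poset_dense P r D"
  let ?R = "|UNIV :: real set|"
  have refl: "\<And>p. p \<in> P \<Longrightarrow> (p, p) \<in> r" and tr: "\<And>p q t. (p, q) \<in> r \<Longrightarrow> (q, t) \<in> r \<Longrightarrow> (p, t) \<in> r"
    and anti: "\<And>p q. (p, q) \<in> r \<Longrightarrow> (q, p) \<in> r \<Longrightarrow> p = q"
    using po by (auto simp: partial_order_on_def preorder_on_def refl_on_def antisym_def elim: transE)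
  have \<D>R: "|\<D>| \<le>o ?R" using card aleph1_ordLeq_real ordLeq_transitive by blast
  have "cinfinite ?R" by (simp add: cinfinite_def Field_card_of infinite_UNIV_char_0)
  then have R: "Cinfinite ?R" using card_of_Card_order by blast
  obtain p0 where p0: "p0 \<in> P" using assms(2) by blast
  define m where "m p q = (if compatible P r p q then SOME s. s \<in> P \<and> (s, p) \<in> r \<and> (s, q) \<in> r else p0)" for p q
  have m: "m p q \<in> P \<and> (m p q, p) \<in> r \<and> (m p q, q) \<in> r" if "compatible P r p q" for p q
    using that someI_ex[of "\<lambda>s. s \<in> P \<and> (s, p) \<in> r \<and> (s, q) \<in> r"] by (auto simp: m_def compatible_def)
  have mP: "m p q \<in> P" for p q by (cases "compatible P r p q") (use m p0 in \<open>auto simp: m_def\<close>)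
  obtain e where e: "\<And>D p. D \<in> \<D> \<Longrightarrow> p \<in> P \<Longrightarrow> e D p \<in> D \<and> (e D p, p) \<in> r"
    using dense unfolding poset_dense_def by metis
  have DP: "D \<subseteq> P" if "D \<in> \<D>" for D using dense that by (auto simp: poset_dense_def)
  define C where "C = rec_nat {p0} (\<lambda>_ A. A \<union> (\<lambda>(p, q). m p q) ` (A \<times> A) \<union> (\<lambda>(D, p). e D p) ` (\<D> \<times> A))"
  have C0: "C 0 = {p0}"
    and CS: "C (Suc n) = C n \<union> (\<lambda>(p, q). m p q) ` (C n \<times> C n) \<union> (\<lambda>(D, p). e D p) ` (\<D> \<times> C n)" for n
    by (simp_all add: C_def)
  have CP: "C n \<subseteq> P" for n
  proof (induction n)
    case (Suc n)
    have "e D p \<in> P" if "D \<in> \<D>" "p \<in> C n" for D p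
      using e[OF that(1), of p] DP[OF that(1)] that(2) Suc by blast
    then show ?case unfolding CS using Suc mP by auto
  qed (use p0 C0 in auto)
  have Ccard: "|C n| \<le>o ?R" for n
  proof (induction n)
    case 0
    show ?case by (simp add: C0 card_of_singl_ordLeq)
  next
    case (Suc n)
    have "|C n \<times> C n| \<le>o ?R" "|\<D> \<times> C n| \<le>o ?R"
      using Suc R \<D>R by (auto simp: cinfinite_def intro!: card_of_Times_ordLeq_infinite_Field)
    then have "|(\<lambda>(p, q). m p q) ` (C n \<times> C n)| \<le>o ?R" "|(\<lambda>(D, p). e D p) ` (\<D> \<times> C n)| \<le>o ?R"
      by (meson card_of_image ordLeq_transitive)+
    then show ?case unfolding CS using Suc R by (meson Un_Cinfinite_bound)
  qed
  have mono: "C n \<subseteq> C k" if "n \<le> k" for n k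
    using lift_Suc_mono_le[of C, OF _ that] CS by blast
  define P0 where "P0 = (\<Union>n. C n)"
  have P0P: "P0 \<subseteq> P" using CP by (auto simp: P0_def)
  have p00: "p0 \<in> P0" using C0 by (auto simp: P0_def)
  have P0m: "m p q \<in> P0" if pq: "p \<in> P0" "q \<in> P0" for p q
  proof -
    obtain i j where "p \<in> C i" "q \<in> C j" using pq unfolding P0_def by blast
    then have "p \<in> C (max i j)" "q \<in> C (max i j)" using mono[of i "max i j"] mono[of j "max i j"] by (meson max.cobounded1 max.cobounded2 subsetD)+
    then have "m p q \<in> C (Suc (max i j))" unfolding CS by force
    then show ?thesis unfolding P0_def by blast
  qed
  have P0e: "e D p \<in> P0" if Dp: "D \<in> \<D>" "p \<in> P0" for D p
  proof -
    obtain i where "p \<in> C i" using Dp unfolding P0_def by blast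
    then have "e D p \<in> C (Suc i)" unfolding CS using that by force
    then show ?thesis unfolding P0_def by blast
  qed
  have "|UNIV :: nat set| \<le>o ?R" using infinite_iff_card_of_nat infinite_UNIV_char_0 by blast
  then have "|P0| \<le>o ?R" unfolding P0_def using Ccard R by (intro UNION_Cinfinite_bound) auto
  then obtain f :: "'a \<Rightarrow> real" where f: "inj_on f P0" using card_of_ordLeq[of P0 "UNIV :: real set"] by auto
  define k where "k = the_inv_into P0 f"
  have kf: "k (f x) = x" if "x \<in> P0" for x using f that by (simp add: k_def the_inv_into_f_f)
  define s where "s = {(x, y). x \<in> f ` P0 \<and> y \<in> f ` P0 \<and> (k x, k y) \<in> r}"
  have s: "(f x, f y) \<in> s \<longleftrightarrow> (x, y) \<in> r" if "x \<in> P0" "y \<in> P0" for x y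
    using that kf by (simp add: s_def)
  have "s \<subseteq> f ` P0 \<times> f ` P0" by (auto simp: s_def)
  moreover have "refl_on (f ` P0) s" using refl P0P s by (auto simp: refl_on_def)
  moreover have "trans s" unfolding trans_def s_def using tr by blast
  moreover have "antisym s"
  proof (rule antisymI)
    fix x y assume "(x, y) \<in> s" "(y, x) \<in> s"
    then have xy: "x \<in> f ` P0" "y \<in> f ` P0" "k x = k y" using anti by (auto simp: s_def)
    then show "x = y" using kf by fastforce
  qed
  ultimately have po': "partial_order_on (f ` P0) s"
    by (simp add: partial_order_on_def preorder_on_def)
  have "sigma_linked (f ` P0) s"
  proof -
    obtain L where L: "P = (\<Union>n::nat. L n)" "\<And>n p q. p \<in> L n \<Longrightarrow> q \<in> L n \<Longrightarrow> compatible P r p q"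
      using sl unfolding sigma_linked_def by metis
    define L' where "L' n = f ` (L n \<inter> P0)" for n
    have "f ` P0 = (\<Union>n. L' n)" using L(1) P0P unfolding L'_def by blast
    moreover have "compatible (f ` P0) s x y" if "x \<in> L' n" "y \<in> L' n" for n x y
    proof -
      obtain p q where pq: "x = f p" "y = f q" "p \<in> L n" "q \<in> L n" "p \<in> P0" "q \<in> P0"
        using \<open>x \<in> L' n\<close> \<open>y \<in> L' n\<close> by (auto simp: L'_def)
      then have "(f (m p q), x) \<in> s \<and> (f (m p q), y) \<in> s" using m[of p q] L(2)[of p n q] P0m[of p q] s by simp
      then show ?thesis using P0m pq unfolding compatible_def by blast
    qed
    ultimately show ?thesis unfolding sigma_linked_def by blast
  qed
  then have MA': "MA_aleph1_for (f ` P0) s"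
    using MA[unfolded MA_sigma_linked_def, rule_format, of "f ` P0" s] po' p00 by auto
  have "|(\<lambda>D. f ` (D \<inter> P0)) ` \<D>| \<le>o cardSuc natLeq"
    using card card_of_image by (rule ordLeq_transitive[rotated])
  moreover have "poset_dense (f ` P0) s (f ` (D \<inter> P0))" if "D \<in> \<D>" for D
    unfolding poset_dense_def
  proof (intro conjI ballI)
    fix x assume "x \<in> f ` P0"
    then obtain p where p: "x = f p" "p \<in> P0" by blast
    then have "e D p \<in> D \<inter> P0" "(e D p, p) \<in> r" using e[of D p] that P0e[of D p] P0P by blast+
    then show "\<exists>d\<in>f ` (D \<inter> P0). (d, x) \<in> s" using p s by (intro bexI[of _ "f (e D p)"]) auto
  qed auto
  ultimately have "\<exists>F. poset_filter (f ` P0) s F \<and>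
      (\<forall>E\<in>(\<lambda>D. f ` (D \<inter> P0)) ` \<D>. F \<inter> E \<noteq> {})"
    by (intro MA'[unfolded MA_aleph1_for_def, rule_format]) simp
  then obtain F where "poset_filter (f ` P0) s F"
      "\<forall>E\<in>(\<lambda>D. f ` (D \<inter> P0)) ` \<D>. F \<inter> E \<noteq> {}"
    by (elim exE conjE)
  then have F: "poset_filter (f ` P0) s F" "\<And>D. D \<in> \<D> \<Longrightarrow> F \<inter> f ` (D \<inter> P0) \<noteq> {}"
    by auto
  define G where "G = {p \<in> P. \<exists>x\<in>P0. f x \<in> F \<and> (x, p) \<in> r}"
  have FP: "F \<subseteq> f ` P0" "F \<noteq> {}" using F(1) by (auto simp: poset_filter_def)
  have dir: "\<forall>x\<in>F. \<forall>y\<in>F. \<exists>w\<in>F. (w, x) \<in> s \<and> (w, y) \<in> s"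
    using F(1) by (simp add: poset_filter_def)
  have GF: "x \<in> G" if "x \<in> P0" "f x \<in> F" for x using that refl P0P unfolding G_def by blast
  have "poset_filter P r G"
    unfolding poset_filter_def
  proof (intro conjI ballI impI)
    show "G \<subseteq> P" by (auto simp: G_def)
    show "G \<noteq> {}" using FP GF by blast
    show "q \<in> G" if "p \<in> G" "q \<in> P" "(p, q) \<in> r" for p q using that tr unfolding G_def by blast
    show "\<exists>t\<in>G. (t, p) \<in> r \<and> (t, q) \<in> r" if pq: "p \<in> G" "q \<in> G" for p q
    proof -
      obtain x y where xy: "x \<in> P0" "y \<in> P0" "f x \<in> F" "f y \<in> F" "(x, p) \<in> r" "(y, q) \<in> r"
        using pq unfolding G_def by blast
      then obtain w where w: "w \<in> F" "(w, f x) \<in> s" "(w, f y) \<in> s"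
        using dir by meson
      obtain z where z: "z \<in> P0" "w = f z" using w(1) FP by blast
      then have "(z, x) \<in> r" "(z, y) \<in> r" using w s[of z x] s[of z y] xy by simp_all
      then show ?thesis using GF[of z] z w(1) tr[of z x p] tr[of z y q] xy(5,6) by blast
    qed
  qed
  moreover have "G \<inter> D \<noteq> {}" if "D \<in> \<D>" for D using F(2)[OF that] GF by blast
  ultimately show "\<exists>G. poset_filter P r G \<and> (\<forall>D\<in>\<D>. G \<inter> D \<noteq> {})" by blast
qed

end

theory Submission
  imports Defs
begin

text \<open>Both the triviality of the automorphism and that of the map reduce to one uniformization
  principle for coherent families of partial functions. Colour a pair from the family if it has at
  least \<open>\<Delta>\<close> incoherences, where \<open>\<Delta>\<close> is the first difference of the two members. For an uncountable
  clique, a \<open>\<sigma>\<close>-linked forcing adds many almost disjoint branches on each of which an uncountable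
  subset of the clique is still incoherent; as soon as one such branch belongs to the family,
  coherence with it and a pigeonhole argument give a contradiction. Otherwise, by OCA, some piece of
  a countable cover is large, and a pair of points of it with a maximal finite set of incoherences
  yields a neighbourhood on which the family glues.

  That some branch carries a pointwise induced lifting of the automorphism follows from a second
  application of OCA, which makes the lifting \<open>\<sigma>\<close>-continuous on a branch. As the branch is split into
  infinitely many blocks, a fusion argument finds a block where a single continuous function works
  for comeagerly many sets. Additivity modulo finite and the Baire category theorem turn it into a
  family of characters \<open>d \<mapsto> \<bar>d \<inter> F i\<bar> mod 2\<close>, and multiplicativity forces almost all \<open>F i\<close> to be
  singletons.\<close>

section \<open>Combinatorial consequences of OCA and MA\<close>

text \<open>The threshold \<Delta> suits both alternatives. Amalgamating two conditions of length
  \<open>n\<close> with equal traces leaves at most \<open>n\<close> pairs in need of a fresh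
  witness; such pairs agree below \<open>n\<close>, so each owns at least \<open>n\<close> witnesses
  and distinct ones can be chosen. In a cover, the same threshold bounds the number of incoherences
  near a fixed pair, so that a maximum exists. The main obstacle is to have a branch in the family.
  For sequences in a product this is automatic, as coordinates are chosen independently. For the
  automorphism no pointwise lifting is known beforehand on any infinite set. Therefore uncountably
  many branches are used, of which only countably many can be bad, and each branch is cut into
  blocks, one for every piece of the cover. The automorphism has to come first: only an almost
  permutation inducing it allows agreement of two sequences at a coordinate to be compared with
  closeness of their images at a coordinate.\<close>

lemma injective_choice:
  fixes S :: "nat \<Rightarrow> 'a set"
  assumes "\<And>q. infinite (S q)"
  shows "\<exists>f. inj f \<and> (\<forall>q. f q \<in> S q)"
proof -
  \<comment> \<open>The recursion carries a whole function, of which stage \<open>q\<close> sets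
    only the value at \<open>q\<close>; the earlier choices are thus at hand and can be
    avoided.\<close>
  define f where "f = rec_nat (\<lambda>_. undefined) (\<lambda>q g. g(q := SOME x. x \<in> S q - g ` {..<q}))"
  have fS: "f (Suc q) = (f q)(q := SOME x. x \<in> S q - f q ` {..<q})" for q
    by (simp add: f_def)
  define h where "h q = f (Suc q) q" for q
  have stab: "f m i = h i" if "i < m" for i m
    using that by (induction m) (auto simp: fS h_def less_Suc_eq)
  have h: "h q \<in> S q - h ` {..<q}" for q
  proof -
    have "f q ` {..<q} = h ` {..<q}" using stab by (intro image_cong) auto
    moreover have "\<exists>x. x \<in> S q - f q ` {..<q}"
      using assms[of q] by (metis Diff_infinite_finite finite_imageI finite_lessThan infinite_imp_nonempty ex_in_conv)
    ultimately show ?thesis unfolding h_def fS using someI_ex[of "\<lambda>x. x \<in> S q - f q ` {..<q}"] by simp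
  qed
  have "inj h"
  proof (rule linorder_injI)
    fix x y :: nat assume "x < y" then show "h x \<noteq> h y" using h[of y] by (metis DiffD2 imageI lessThan_iff)
  qed
  then show ?thesis using h by blast
qed

text \<open>By Ramsey's theorem for pairs: a set homogeneous for the related colour would give each
  of its points infinitely many related ones. It serves to make values or supports attached to
  infinitely many coordinates disjoint.\<close>

lemma infinite_independent_subset:
  fixes L :: "'a set"
  assumes "infinite L" and fin: "\<And>x. x \<in> L \<Longrightarrow> finite {y \<in> L. R x y \<or> R y x}"
  obtains L' where "L' \<subseteq> L" "infinite L'" "\<And>x y. x \<in> L' \<Longrightarrow> y \<in> L' \<Longrightarrow> x \<noteq> y \<Longrightarrow> \<not> R x y"
proof -
  define c where "c e = (if \<exists>x y. x \<noteq> y \<and> e = {x, y} \<and> R x y then 1 else (0 :: nat))" for e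
  have "\<forall>X. X \<subseteq> L \<and> finite X \<and> card X = 2 \<longrightarrow> c X < 2" by (simp add: c_def)
  from Ramsey[OF assms(1) this] obtain Y t where Y: "Y \<subseteq> L" "infinite Y" "t < 2"
    "\<forall>X. X \<subseteq> Y \<and> finite X \<and> card X = 2 \<longrightarrow> c X = t" by metis
  have ct: "c {x, y} = t" if "x \<in> Y" "y \<in> Y" "x \<noteq> y" for x y
    using Y(4) that by simp
  show thesis
  proof (cases "t = 0")
    case True
    have "\<not> R x y" if "x \<in> Y" "y \<in> Y" "x \<noteq> y" for x y
      using ct[OF that] True that unfolding c_def by (metis zero_neq_one)
    then show thesis using that[of Y] Y by blast
  next
    case False
    obtain x where x: "x \<in> Y" using Y(2) by fastforce
    have "R x y \<or> R y x" if "y \<in> Y - {x}" for y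
      using ct[of x y] x that False unfolding c_def by (auto simp: doubleton_eq_iff split: if_splits)
    then have "Y - {x} \<subseteq> {y \<in> L. R x y \<or> R y x}" using Y(1) by blast
    then have "finite Y" using fin[of x] x Y(1) by (meson finite_Diff2 finite.emptyI finite_insert finite_subset subsetD)
    then show thesis using Y(2) by blast
  qed
qed

text \<open>The code \<open>e\<close> embeds \<open>S\<close> into the Baire space, and
  \<open>K\<close> has to be open only for the topology induced by this code. A colouring is made
  open by writing the information on which it depends into \<open>e\<close>, one natural number per
  coordinate.\<close>

lemma OCA_dichotomy:
  fixes S :: "'s set" and e :: "'s \<Rightarrow> nat \<Rightarrow> nat" and K :: "'s \<Rightarrow> 's \<Rightarrow> bool"
  assumes "OCA" and inj: "inj_on e S"
    and sym: "\<And>x y. x \<in> S \<Longrightarrow> y \<in> S \<Longrightarrow> K x y \<Longrightarrow> K y x"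
    and irr: "\<And>x. x \<in> S \<Longrightarrow> \<not> K x x"
    and opn: "\<And>x y. x \<in> S \<Longrightarrow> y \<in> S \<Longrightarrow> K x y \<Longrightarrow>
      \<exists>n. \<forall>x'\<in>S. \<forall>y'\<in>S. (\<forall>i<n. e x' i = e x i) \<and> (\<forall>i<n. e y' i = e y i) \<longrightarrow> K x' y'"
  obtains (clique) H where "H \<subseteq> S" "uncountable H" "\<And>x y. x \<in> H \<Longrightarrow> y \<in> H \<Longrightarrow> x \<noteq> y \<Longrightarrow> K x y"
  | (cover) Y :: "nat \<Rightarrow> 's set" where "S = (\<Union>n. Y n)" "\<And>n x y. x \<in> Y n \<Longrightarrow> y \<in> Y n \<Longrightarrow> \<not> K x y"
proof -
  define X where "X = subtopology (euclidean :: (nat \<Rightarrow> nat) topology) (e ` S)"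
  have top: "topspace X = e ` S" by (simp add: X_def)
  have "metrizable_space (euclidean :: (nat \<Rightarrow> nat) topology)"
  proof -
    have dis: "(euclidean :: nat topology) = discrete_topology UNIV"
      by (simp add: topology_eq open_openin[symmetric] open_discrete)
    have "metrizable_space (product_topology (\<lambda>i. euclidean :: nat topology) (UNIV :: nat set))"
      by (subst metrizable_space_product_topology) (simp add: dis)
    then show ?thesis by (simp add: euclidean_product_topology)
  qed
  then have m: "metrizable_space X" unfolding X_def by (rule metrizable_space_subtopology)
  have "second_countable (euclidean :: (nat \<Rightarrow> nat) topology)"
  proof -
    obtain B :: "(nat \<Rightarrow> nat) set set" where B: "countable B" "topological_basis B"
      using ex_countable_basis by blast
    have "\<forall>V\<in>B. openin euclidean V" using B(2) topological_basis_open by auto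
    moreover have "\<forall>U x. openin euclidean U \<and> x \<in> U \<longrightarrow> (\<exists>V\<in>B. x \<in> V \<and> V \<subseteq> U)"
      using topological_basisE[OF B(2)] by (metis open_openin)
    ultimately show ?thesis unfolding second_countable_def using B(1) by blast
  qed
  then have "separable_space X"
    unfolding X_def by (intro second_countable_imp_separable_space second_countable_subtopology)
  then have O: "OCA_for X" using OCA_imp_OCA_for assms(1) m by blast
  define K0 where "K0 = {p. \<exists>x\<in>S. \<exists>y\<in>S. p = {e x, e y} \<and> K x y}"
  have K0e: "{e x, e y} \<in> K0 \<longleftrightarrow> K x y" if "x \<in> S" "y \<in> S" for x y
    using that inj sym unfolding K0_def by (auto simp: doubleton_eq_iff inj_on_eq_iff)
  have "K0 \<subseteq> [topspace X]\<^bsup>2\<^esup>"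
  proof
    fix p assume "p \<in> K0"
    then obtain x y where xy: "x \<in> S" "y \<in> S" "p = {e x, e y}" "K x y" unfolding K0_def by blast
    then have "e x \<noteq> e y" using irr inj by (metis inj_onD)
    then show "p \<in> [topspace X]\<^bsup>2\<^esup>" using xy by (simp add: nsets_def top)
  qed
  moreover have "openin (prod_topology X X) {(p, q). {p, q} \<in> K0}"
    unfolding openin_prod_topology_alt
  proof (intro allI impI)
    fix p q assume "(p, q) \<in> {(p, q). {p, q} \<in> K0}"
    then obtain x y where xy: "x \<in> S" "y \<in> S" "p = e x" "q = e y" "K x y"
      unfolding K0_def using sym by (auto simp: doubleton_eq_iff)
    obtain n where n: "\<And>x' y'. x' \<in> S \<Longrightarrow> y' \<in> S \<Longrightarrow> (\<forall>i<n. e x' i = e x i) \<Longrightarrow> (\<forall>i<n. e y' i = e y i) \<Longrightarrow> K x' y'"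
      using opn[OF xy(1,2,5)] by blast
    define C where "C g = e ` S \<inter> {f. \<forall>i<n. f i = g i}" for g :: "nat \<Rightarrow> nat"
    have "open {f :: nat \<Rightarrow> nat. \<forall>i<n. f i = g i}" for g
    proof -
      have "{f :: nat \<Rightarrow> nat. \<forall>i<n. f i = g i} = (\<Inter>i\<in>{..<n}. (\<lambda>f. f i) -` {g i})" by auto
      moreover have "open ((\<lambda>f :: nat \<Rightarrow> nat. f i) -` {g i})" for i
        by (intro open_vimage continuous_on_product_coordinates) (simp add: open_discrete)
      ultimately show ?thesis by (metis (no_types, lifting) finite_lessThan open_INT)
    qed
    then have C: "openin X (C g)" for g
      unfolding C_def X_def openin_subtopology by (auto simp: Int_commute)
    have "C p \<times> C q \<subseteq> {(p, q). {p, q} \<in> K0}"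
      unfolding C_def using n xy K0e by auto
    moreover have "p \<in> C p" "q \<in> C q" using xy by (auto simp: C_def)
    ultimately show "\<exists>U V. openin X U \<and> openin X V \<and> p \<in> U \<and> q \<in> V \<and> U \<times> V \<subseteq> {(p, q). {p, q} \<in> K0}"
      using C by blast
  qed
  ultimately consider H where "H \<subseteq> e ` S" "uncountable H" "[H]\<^bsup>2\<^esup> \<subseteq> K0"
    | Z where "e ` S = (\<Union>n::nat. Z n)" "\<And>n. [Z n]\<^bsup>2\<^esup> \<inter> K0 = {}"
    using O unfolding OCA_for_def top by metis
  then show thesis
  proof cases
    case 1
    define H' where "H' = {x \<in> S. e x \<in> H}"
    have "e ` H' = H" using 1 by (auto simp: H'_def)
    then have "uncountable H'" using 1 by (metis countable_image)
    moreover have "K x y" if "x \<in> H'" "y \<in> H'" "x \<noteq> y" for x y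
    proof -
      have "e x \<noteq> e y" using that inj by (auto simp: H'_def inj_on_def)
      then have "{e x, e y} \<in> [H]\<^bsup>2\<^esup>" using that by (simp add: nsets_def H'_def)
      then have "{e x, e y} \<in> K0" using 1(3) by blast
      then show ?thesis using K0e[of x y] that by (simp add: H'_def)
    qed
    ultimately show thesis using clique[of H'] by (auto simp: H'_def)
  next
    case 2
    define Y where "Y n = {x \<in> S. e x \<in> Z n}" for n
    have "S = (\<Union>n. Y n)" using 2(1) by (auto simp: Y_def)
    moreover have "\<not> K x y" if "x \<in> Y n" "y \<in> Y n" for x y n
    proof
      assume k: "K x y"
      then have "x \<noteq> y" using irr that by (auto simp: Y_def)
      then have "e x \<noteq> e y" using that inj by (auto simp: Y_def inj_on_def)
      then have "{e x, e y} \<in> [Z n]\<^bsup>2\<^esup>" using that by (simp add: nsets_def Y_def)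
      moreover have "{e x, e y} \<in> K0" using k K0e[of x y] that by (simp add: Y_def)
      ultimately show False using 2(2)[of n] by blast
    qed
    ultimately show thesis using cover by blast
  qed
qed

section \<open>Subsets of size aleph one, condensation points and distinct representatives\<close>

lemma countable_iff_ordLeq_natLeq: "countable A \<longleftrightarrow> |A| \<le>o natLeq"
proof -
  have "|A| \<le>o natLeq \<longleftrightarrow> |A| \<le>o |UNIV :: nat set|"
    using card_of_nat ordIso_symmetric ordLeq_ordIso_trans by blast
  also have "\<dots> \<longleftrightarrow> countable A"
    unfolding countable_def card_of_ordLeq[symmetric] by auto
  finally show ?thesis ..
qed

text \<open>\<open>R\<close> is the well-order of type aleph one carried over to \<open>H0\<close>.
  A subset that is cofinal for \<open>R\<close> is uncountable, and cofinality can be forced by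
  aleph one dense sets.\<close>

lemma uncountable_aleph1_subset:
  assumes "uncountable H"
  obtains H0 and R :: "'a \<Rightarrow> 'a \<Rightarrow> bool" where "H0 \<subseteq> H" "uncountable H0" "|H0| \<le>o cardSuc natLeq"
    "\<And>a. a \<in> H0 \<Longrightarrow> countable {b \<in> H0. \<not> R a b}" "\<And>a. a \<in> H0 \<Longrightarrow> countable {b \<in> H0. R b a}"
proof -
  let ?r = "cardSuc natLeq"
  have co: "Card_order ?r" by (simp add: cardSuc_Card_order natLeq_Card_order)
  have "natLeq <o |H|"
    using assms countable_iff_ordLeq_natLeq[of H] not_ordLeq_iff_ordLess[OF natLeq_Well_order card_of_Well_order, of H] 
    by (metis card_of_Well_order natLeq_Well_order not_ordLess_iff_ordLeq)
  then have "?r \<le>o |H|" by (rule cardSuc_least[OF natLeq_Card_order card_of_Card_order])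
  then have "|Field ?r| \<le>o |H|" using card_of_Field_ordIso[OF co] ordIso_ordLeq_trans by blast
  then obtain f where f: "inj_on f (Field ?r)" "f ` Field ?r \<subseteq> H" using card_of_ordLeq[of "Field ?r" H] by blast
  define H0 where "H0 = f ` Field ?r"
  define g where "g = the_inv_into (Field ?r) f"
  have gf: "g (f x) = x" if "x \<in> Field ?r" for x using f that by (simp add: g_def the_inv_into_f_f)
  define R where "R a b \<longleftrightarrow> (g a, g b) \<in> ?r" for a b
  have "|Field ?r| =o |H0|" unfolding H0_def using f(1) card_of_ordIso bij_betw_def by blast
  then have iso: "|H0| =o ?r" using card_of_Field_ordIso[OF co] ordIso_symmetric ordIso_transitive by blast
  have "\<not> |H0| \<le>o natLeq"
    using iso cardSuc_greater[OF natLeq_Card_order]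
    by (metis not_ordLess_ordLeq ordIso_symmetric ordLess_ordIso_trans)
  then have "uncountable H0" using countable_iff_ordLeq_natLeq by blast
  have us: "countable (underS ?r x)" if "x \<in> Field ?r" for x
    using card_of_underS[OF co that] cardSuc_ordLeq_ordLess[OF natLeq_Card_order card_of_Card_order]
      countable_iff_ordLeq_natLeq by metis
  have lin: "linear_order_on (Field ?r) ?r"
    using co card_order_on_well_order_on well_order_on_def by blast
  have tot: "(x, y) \<in> ?r \<or> ((y, x) \<in> ?r \<and> y \<noteq> x)" if "x \<in> Field ?r" "y \<in> Field ?r" for x y
  proof (cases "x = y")
    case True
    have "refl_on (Field ?r) ?r" using lin unfolding linear_order_on_def partial_order_on_def preorder_on_def by blast
    then show ?thesis using True that(1) by (simp add: refl_on_def)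
  next
    case False
    have "total_on (Field ?r) ?r" using lin unfolding linear_order_on_def by blast
    then show ?thesis using False that unfolding total_on_def by metis
  qed
  have c1: "countable {b \<in> H0. \<not> R a b}" if aH: "a \<in> H0" for a
  proof -
    obtain x where x: "x \<in> Field ?r" "a = f x" using aH unfolding H0_def by blast
    have "{b \<in> H0. \<not> R a b} \<subseteq> f ` underS ?r x"
    proof
      fix b assume b: "b \<in> {b \<in> H0. \<not> R a b}"
      then obtain y where y: "y \<in> Field ?r" "b = f y" unfolding H0_def by blast
      then have "(x, y) \<notin> ?r" using b x gf by (simp add: R_def)
      then have "(y, x) \<in> ?r \<and> y \<noteq> x" using tot x(1) y(1) by blast
      then show "b \<in> f ` underS ?r x" using y by (auto simp: underS_def)
    qed
    then show ?thesis using countable_subset[OF _ countable_image[OF us[OF x(1)]]] by blast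
  qed
  have c2: "countable {b \<in> H0. R b a}" if aH: "a \<in> H0" for a
  proof -
    obtain x where x: "x \<in> Field ?r" "a = f x" using aH unfolding H0_def by blast
    have "{b \<in> H0. R b a} \<subseteq> f ` insert x (underS ?r x)"
    proof
      fix b assume b: "b \<in> {b \<in> H0. R b a}"
      then obtain y where y: "y \<in> Field ?r" "b = f y" unfolding H0_def by blast
      then have "(y, x) \<in> ?r" using b x gf by (simp add: R_def)
      then show "b \<in> f ` insert x (underS ?r x)" using y by (auto simp: underS_def)
    qed
    then show ?thesis using countable_subset[OF _ countable_image[OF countable_insert[OF us[OF x(1)]]]] by blast
  qed
  have "H0 \<subseteq> H" using f(2) by (simp add: H0_def)
  then show thesis
    using that[of H0 R] \<open>uncountable H0\<close> ordIso_imp_ordLeq[OF iso] c1 c2 by simp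
qed

lemma uncountable_UNIV_nat_bool: "uncountable (UNIV :: (nat \<Rightarrow> bool) set)"
proof
  assume "countable (UNIV :: (nat \<Rightarrow> bool) set)"
  then have r: "range (from_nat_into (UNIV :: (nat \<Rightarrow> bool) set)) = UNIV" by (simp add: range_from_nat_into)
  define f where "f = from_nat_into (UNIV :: (nat \<Rightarrow> bool) set)"
  have "(\<lambda>n. \<not> f n n) \<in> range f" using r by (simp add: f_def)
  then obtain n where "(\<lambda>n. \<not> f n n) = f n" by (rule rangeE)
  then have "(\<not> f n n) = f n n" by (rule fun_cong)
  then show False by simp
qed

text \<open>Each set has at least as many elements as there are sets, so a greedy choice never runs
  out.\<close>

lemma greedy_system_of_distinct_representatives:
  assumes "finite N" "\<And>x. x \<in> N \<Longrightarrow> finite (S x) \<and> card (S x) \<ge> card N"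
  shows "\<exists>f. inj_on f N \<and> (\<forall>x\<in>N. f x \<in> S x)"
  using assms
proof (induction N rule: finite_induct)
  case (insert x N)
  have "finite (S y) \<and> card (S y) \<ge> card N" if "y \<in> N" for y
    using insert.prems[of y] insert.hyps that by simp
  then obtain f where f: "inj_on f N" "\<forall>y\<in>N. f y \<in> S y" using insert.IH by blast
  have "card (f ` N) < card (S x)"
    using insert.prems[of x] insert.hyps card_image_le[of N f] by simp
  then obtain s where s: "s \<in> S x" "s \<notin> f ` N"
    using insert.hyps(1) by (meson card_mono finite_imageI not_le subsetI)
  have "inj_on (f(x := s)) (insert x N)"
    using f(1) s(2) insert.hyps(2) by (auto simp: inj_on_def)
  moreover have "\<forall>y\<in>insert x N. (f(x := s)) y \<in> S y"
    using f(2) s(1) insert.hyps(2) by auto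
  ultimately show ?case by blast
qed simp

lemma map_upt_eq_iff: "map f [0..<n] = map g [0..<n] \<longleftrightarrow> (\<forall>i<n. f i = g i)"
  by auto

text \<open>As in the Cantor-Bendixson theorem: there are only countably many pairs of a level and a
  value of \<open>res\<close>, so all pieces that meet \<open>H\<close> in a countable set can be
  thrown away together.\<close>

lemma condensation_points:
  fixes res :: "nat \<Rightarrow> 'a \<Rightarrow> 'c::countable"
  assumes "uncountable H"
  obtains H0 where "H0 \<subseteq> H" "uncountable H0"
    "\<And>n a. a \<in> H0 \<Longrightarrow> uncountable {b \<in> H0. res n b = res n a}"
proof -
  define B where "B = (\<Union>(n, t)\<in>{(n, t). countable {b \<in> H. res n b = t}}. {b \<in> H. res n b = t})"
  have B: "countable B"
    unfolding B_def by (rule countable_UN) (auto intro: countableI_type)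
  have "uncountable (H - B)" using assms B by (simp add: uncountable_minus_countable)
  moreover have "uncountable {b \<in> H - B. res n b = res n a}" if a: "a \<in> H - B" for n a
  proof
    assume "countable {b \<in> H - B. res n b = res n a}"
    moreover have "{b \<in> H. res n b = res n a} \<subseteq> {b \<in> H - B. res n b = res n a} \<union> B" by blast
    ultimately have "countable {b \<in> H. res n b = res n a}" using B countable_subset countable_Un by metis
    then show False using a unfolding B_def by blast
  qed
  ultimately show thesis using that[of "H - B"] by blast
qed

text \<open>In a condition \<open>(\<sigma>, F)\<close> the sequence \<open>\<sigma>\<close>
  attaches to each coordinate \<open>i\<close> below its length a node of level \<open>i\<close>, a
  label and a value, while \<open>(a, z, k)\<close> in \<open>F\<close> promises to put
  \<open>a\<close> into the uncountable set that belongs to branch \<open>z\<close> and label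
  \<open>k\<close>. The labels cut each branch into countably many blocks, each with an uncountable
  set of its own.\<close>

lemma generic_branches:
  fixes H :: "(nat \<Rightarrow> nat) set" and v :: "(nat \<Rightarrow> nat) \<Rightarrow> nat \<Rightarrow> nat"
    and Q :: "nat \<Rightarrow> nat \<Rightarrow> nat \<Rightarrow> bool" and W :: "(nat \<Rightarrow> nat) \<Rightarrow> (nat \<Rightarrow> nat) \<Rightarrow> nat \<Rightarrow> bool"
  assumes W_def: "\<And>a b i. W a b i \<longleftrightarrow> a i = b i \<and> Q i (v a i) (v b i)"
    and MA: "MA_sigma_linked" and unc: "uncountable H"
    and irr: "\<And>i x. \<not> Q i x x" and sym: "\<And>i x y. Q i x y \<Longrightarrow> Q i y x"
    and wit: "\<And>a b. a \<in> H \<Longrightarrow> b \<in> H \<Longrightarrow> a \<noteq> b \<Longrightarrow>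
      \<exists>E. finite E \<and> card E = (LEAST i. a i \<noteq> b i) \<and> (\<forall>i\<in>E. W a b i)"
  obtains \<tau> :: "nat \<Rightarrow> bool list \<times> nat" and c Z where "uncountable Z" "\<And>i. length (fst (\<tau> i)) = i"
    "\<And>z k. z \<in> Z \<Longrightarrow> \<exists>H' \<subseteq> H. uncountable H' \<and> (\<forall>a\<in>H'. \<forall>b\<in>H'. a \<noteq> b \<longrightarrow>
      (\<exists>i. W a b i \<and> \<tau> i = (map z [0..<i], k) \<and> c i = a i))"
proof -
  \<comment> \<open>The restriction also records \<open>v a\<close>, so that \<open>W a b i\<close>
    with \<open>i < n\<close> is determined by the restrictions of \<open>a\<close> and
    \<open>b\<close>.\<close>
  define res where "res n a = map (\<lambda>i. (a i, v a i)) [0..<n]" for n a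
  have res: "res n a = res n b \<longleftrightarrow> (\<forall>i<n. a i = b i \<and> v a i = v b i)" for n a b
    unfolding res_def map_upt_eq_iff by simp
  define nd where "nd n z = map z [0..<n]" for n and z :: "nat \<Rightarrow> bool"
  have nd: "nd n z = nd n w \<longleftrightarrow> (\<forall>i<n. z i = w i)" and nd_len: "length (nd n z) = n" for n z w
    unfolding nd_def map_upt_eq_iff by simp_all
  obtain H1 R where H1: "H1 \<subseteq> H" "uncountable H1" "|H1| \<le>o cardSuc natLeq"
    "\<And>a. a \<in> H1 \<Longrightarrow> countable {b \<in> H1. \<not> R a b}" "\<And>a. a \<in> H1 \<Longrightarrow> countable {b \<in> H1. R b a}"
    using uncountable_aleph1_subset[OF unc] by blast
  obtain H0 where H0: "H0 \<subseteq> H1" "uncountable H0"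
    "\<And>n a. a \<in> H0 \<Longrightarrow> uncountable {b \<in> H0. res n b = res n a}"
    using condensation_points[OF H1(2), of res] by blast
  have H0H: "H0 \<subseteq> H" and H0c: "|H0| \<le>o cardSuc natLeq"
    using H0(1) H1(1,3) card_of_mono1[OF H0(1)] ordLeq_transitive by blast+
  \<comment> \<open>Only aleph one branches are kept, since there will be a dense set for every
    branch.\<close>
  obtain Z :: "(nat \<Rightarrow> bool) set" where Z: "uncountable Z" "|Z| \<le>o cardSuc natLeq"
    by (rule uncountable_aleph1_subset[OF uncountable_UNIV_nat_bool]) blast
  \<comment> \<open>The bound on \<open>card F\<close> limits the number of fresh witnesses in an
    amalgamation. Points with the same label have to differ below \<open>n\<close>, so that they are
    recognized by their restrictions; the last clause is the promise itself.\<close>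
  define good where "good \<sigma> n F \<longleftrightarrow> card F \<le> n \<and> (\<forall>(a, z, k)\<in>F. \<forall>(b, w, l)\<in>F.
      (z \<noteq> w \<longrightarrow> nd n z \<noteq> nd n w) \<and> (z = w \<and> k = l \<and> a \<noteq> b \<longrightarrow> (\<exists>i<n. a i \<noteq> b i) \<and>
        (\<exists>i<n. W a b i \<and> \<sigma> i = (nd i z, k, a i))))"
    for \<sigma> :: "nat \<Rightarrow> bool list \<times> nat \<times> nat" and n and F :: "((nat \<Rightarrow> nat) \<times> (nat \<Rightarrow> bool) \<times> nat) set"
  define P where "P = {(\<sigma>, F). (\<forall>i<length \<sigma>. length (fst (\<sigma> ! i)) = i) \<and> finite F \<and> F \<subseteq> H0 \<times> Z \<times> UNIV
      \<and> good ((!) \<sigma>) (length \<sigma>) F}"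
  define r where "r = {((\<sigma>', F'), (\<sigma>, F)). (\<sigma>', F') \<in> P \<and> (\<sigma>, F) \<in> P \<and> (\<exists>\<rho>. \<sigma>' = \<sigma> @ \<rho>) \<and> F \<subseteq> F'}"
  have po: "partial_order_on P r"
    unfolding partial_order_on_def preorder_on_def
  proof (intro conjI)
    show "r \<subseteq> P \<times> P" by (auto simp: r_def)
    show "refl_on P r" by (auto simp: refl_on_def r_def)
    show "trans r" unfolding r_def by (rule transI) auto
    show "antisym r" unfolding r_def by (rule antisymI) auto
  qed
  have Wsym: "W a b i \<Longrightarrow> W b a i" for a b i using sym by (auto simp: W_def)
  have Wres: "W a b i" if "W a b' i" "res n b = res n b'" "i < n" for a b b' i n
  proof -
    have "b i = b' i" "v b i = v b' i" using that(2,3) by (auto simp: res)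
    then show ?thesis using that(1) by (simp add: W_def)
  qed
  have far: "n \<le> i" if "W a b i" "res n a = res n b" for a b i n
  proof (rule ccontr)
    assume "\<not> n \<le> i"
    then have "v a i = v b i" using that(2) by (auto simp: res)
    then show False using that(1) irr by (simp add: W_def)
  qed
  \<comment> \<open>The first difference of two points with equal restrictions is at least \<open>n\<close>, so that they have
    at least as many witnesses as a condition of length \<open>n\<close> has points.\<close>
  have wit': "\<exists>E. finite E \<and> card E \<ge> n \<and> (\<forall>i\<in>E. i \<ge> n \<and> W a b i)"
    if ab: "a \<in> H0" "b \<in> H0" "a \<noteq> b" "res n a = res n b" for a b n
  proof -
    obtain E where E: "finite E" "card E = (LEAST i. a i \<noteq> b i)" "\<forall>i\<in>E. W a b i"
      using wit[OF subsetD[OF H0H ab(1)] subsetD[OF H0H ab(2)] ab(3)] by blast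
    have "a (LEAST i. a i \<noteq> b i) \<noteq> b (LEAST i. a i \<noteq> b i)"
      using that(3) by (intro LeastI_ex[of "\<lambda>i. a i \<noteq> b i"]) blast
    then have "n \<le> (LEAST i. a i \<noteq> b i)" using that(4) unfolding res using not_le by blast
    then show ?thesis using E far[OF _ that(4)] by (intro exI[of _ E]) auto
  qed
  \<comment> \<open>A finite set of labelled points becomes part of a condition as soon as its promises are kept,
    since the remaining requirements only ask for a long enough sequence.\<close>
  have extend: "\<exists>\<rho>. (\<sigma> @ \<rho>, F) \<in> P"
    if \<sigma>: "\<forall>i<length \<sigma>. length (fst (\<sigma> ! i)) = i" and F: "finite F" "F \<subseteq> H0 \<times> Z \<times> UNIV"
      and g: "\<And>i. length (fst (g i)) = i"
      and pr: "\<And>a b z k. (a, z, k) \<in> F \<Longrightarrow> (b, z, k) \<in> F \<Longrightarrow> a \<noteq> b \<Longrightarrow>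
        \<exists>i. W a b i \<and> (if i < length \<sigma> then \<sigma> ! i else g i) = (nd i z, k, a i)"
    for \<sigma> F and g :: "nat \<Rightarrow> bool list \<times> nat \<times> nat"
  proof -
    define G where "G i = (if i < length \<sigma> then \<sigma> ! i else g i)" for i
    have "\<forall>\<^sub>F n in sequentially. \<forall>x\<in>F. \<forall>y\<in>F. case x of (a, z, k) \<Rightarrow> case y of (b, w, l) \<Rightarrow>
      (z \<noteq> w \<longrightarrow> nd n z \<noteq> nd n w) \<and> (z = w \<and> k = l \<and> a \<noteq> b \<longrightarrow> (\<exists>i<n. a i \<noteq> b i) \<and>
        (\<exists>i<n. W a b i \<and> G i = (nd i z, k, a i)))"
    proof (intro eventually_ball_finite[OF F(1)] ballI)
      fix x y assume xy: "x \<in> F" "y \<in> F"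
      obtain a z k b w l where x: "x = (a, z, k)" and y: "y = (b, w, l)" by (metis prod_cases3)
      have 1: "\<forall>\<^sub>F n in sequentially. z \<noteq> w \<longrightarrow> nd n z \<noteq> nd n w"
      proof (cases "z = w")
        case False
        then obtain i where "z i \<noteq> w i" by blast
        then show ?thesis unfolding nd eventually_sequentially by (intro exI[of _ "Suc i"]) auto
      qed simp
      have 2: "\<forall>\<^sub>F n in sequentially. z = w \<and> k = l \<and> a \<noteq> b \<longrightarrow> (\<exists>i<n. a i \<noteq> b i) \<and>
        (\<exists>i<n. W a b i \<and> G i = (nd i z, k, a i))"
      proof (cases "z = w \<and> k = l \<and> a \<noteq> b")
        case True
        then obtain i j where "a i \<noteq> b i" "W a b j" "G j = (nd j z, k, a j)"
          using pr[of a z k b] xy x y unfolding G_def by blast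
        then show ?thesis unfolding eventually_sequentially
          by (intro exI[of _ "Suc (max i j)"]) (auto intro: exI[of _ i] exI[of _ j])
      next
        case False
        then show ?thesis by (intro always_eventually) blast
      qed
      show "\<forall>\<^sub>F n in sequentially. case x of (a, z, k) \<Rightarrow> case y of (b, w, l) \<Rightarrow>
      (z \<noteq> w \<longrightarrow> nd n z \<noteq> nd n w) \<and> (z = w \<and> k = l \<and> a \<noteq> b \<longrightarrow> (\<exists>i<n. a i \<noteq> b i) \<and>
        (\<exists>i<n. W a b i \<and> G i = (nd i z, k, a i)))"
        unfolding x y prod.case by (rule eventually_conj[OF 1 2])
    qed
    then have "\<forall>\<^sub>F n in sequentially. good G n F"
      unfolding good_def using eventually_ge_at_top[of "card F"]
      by eventually_elim auto
    then obtain n where n: "n \<ge> length \<sigma>" "good G n F"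
      using eventually_ge_at_top[of "length \<sigma>"] by (metis (mono_tags, lifting) eventually_conj eventually_happens' sequentially_bot)
    define \<rho> where "\<rho> = map g [length \<sigma>..<n]"
    have len: "length (\<sigma> @ \<rho>) = n" using n(1) by (simp add: \<rho>_def)
    have nth: "(\<sigma> @ \<rho>) ! i = G i" if "i < n" for i
      using that n(1) by (simp add: G_def \<rho>_def nth_append)
    have "good ((!) (\<sigma> @ \<rho>)) n F = good G n F"
      unfolding good_def by (simp add: nth cong: conj_cong)
    then have "good ((!) (\<sigma> @ \<rho>)) n F" using n(2) by simp
    moreover have "\<forall>i<n. length (fst ((\<sigma> @ \<rho>) ! i)) = i" using nth \<sigma> g by (simp add: G_def)
    ultimately show ?thesis using F len unfolding P_def by auto
  qed
  have goodD: "z \<noteq> w \<Longrightarrow> nd n z \<noteq> nd n w" "z = w \<Longrightarrow> k = l \<Longrightarrow> a \<noteq> b \<Longrightarrow> \<exists>i<n. a i \<noteq> b i"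
    "z = w \<Longrightarrow> k = l \<Longrightarrow> a \<noteq> b \<Longrightarrow> \<exists>i<n. W a b i \<and> \<sigma> i = (nd i z, k, a i)"
    if "good \<sigma> n F" "(a, z, k) \<in> F" "(b, w, l) \<in> F" for \<sigma> n F a b z w k l
    using that unfolding good_def by fast+
  \<comment> \<open>The type consists of the sequence and the traces of the promises below its
    length. There are countably many types, and equal types will imply compatibility.\<close>
  define type where "type = (\<lambda>(\<sigma> :: (bool list \<times> nat \<times> nat) list, F).
      (\<sigma>, (\<lambda>(a, z, k). (res (length \<sigma>) a, nd (length \<sigma>) z, k :: nat)) ` F))"
  have linked: "compatible P r (\<sigma>, F) (\<sigma>, F')" if p: "(\<sigma>, F) \<in> P" "(\<sigma>, F') \<in> P" and ty: "type (\<sigma>, F) = type (\<sigma>, F')" for \<sigma> F F'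
  proof -
    define n where "n = length \<sigma>"
    have im: "(\<lambda>(a, z, k). (res n a, nd n z, k)) ` F = (\<lambda>(a, z, k). (res n a, nd n z, k)) ` F'"
      using ty by (simp add: type_def n_def)
    have FF: "finite F" "F \<subseteq> H0 \<times> Z \<times> UNIV" "good ((!) \<sigma>) n F" "finite F'" "F' \<subseteq> H0 \<times> Z \<times> UNIV" "good ((!) \<sigma>) n F'"
      and \<sigma>: "\<forall>i<length \<sigma>. length (fst (\<sigma> ! i)) = i"
      using p by (auto simp: P_def n_def)
    \<comment> \<open>The pairs that need a fresh witness: equally labelled points of the two sides
      with the same restriction. Since points of \<open>F'\<close> with one label have different
      restrictions, a pair is determined by its member from \<open>F\<close>, so there are at most
      \<open>n\<close> pairs.\<close>
    define N where "N = {(a, b, z, k). (a, z, k) \<in> F \<and> (b, z, k) \<in> F' \<and> res n a = res n b \<and> a \<noteq> b}"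
    have inj: "inj_on (\<lambda>(a, b, z, k). (a, z, k)) N"
    proof (rule inj_onI)
      fix x y assume xy: "x \<in> N" "y \<in> N" "(\<lambda>(a, b, z, k). (a, z, k)) x = (\<lambda>(a, b, z, k). (a, z, k)) y"
      obtain a b z k a' b' z' k' where e: "x = (a, b, z, k)" "y = (a', b', z', k')" by (metis prod_cases4)
      then have e': "a' = a" "z' = z" "k' = k" using xy(3) by auto
      then have "(b, z, k) \<in> F'" "(b', z, k) \<in> F'" "res n b = res n b'" using xy e by (auto simp: N_def)
      then have "b = b'" using goodD(2)[OF FF(6), of b z k b' z k] unfolding res by auto
      then show "x = y" using e e' by simp
    qed
    have imN: "(\<lambda>(a, b, z, k). (a, z, k)) ` N \<subseteq> F" by (auto simp: N_def)
    have finN: "finite N" using finite_imageD[OF finite_subset[OF imN FF(1)] inj] .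
    have cN: "card N \<le> n"
      using card_inj_on_le[OF inj imN FF(1)] FF(3) by (simp add: good_def)
    have "\<exists>E. finite E \<and> card E \<ge> n \<and> (\<forall>i\<in>E. case x of (a, b, z, k) \<Rightarrow> i \<ge> n \<and> W a b i)" if x: "x \<in> N" for x
    proof -
      obtain a b z k where x': "x = (a, b, z, k)" by (metis prod_cases4)
      then have "a \<in> H0" "b \<in> H0" "a \<noteq> b" "res n a = res n b" using x FF(2,5) by (auto simp: N_def)
      from wit'[OF this] show ?thesis unfolding x' by simp
    qed
    then obtain S where S: "\<And>x. x \<in> N \<Longrightarrow> finite (S x) \<and> card (S x) \<ge> n \<and> (\<forall>i\<in>S x. case x of (a, b, z, k) \<Rightarrow> i \<ge> n \<and> W a b i)"
      by metis
    then have "\<And>x. x \<in> N \<Longrightarrow> finite (S x) \<and> card (S x) \<ge> card N" using cN by (meson le_trans)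
    \<comment> \<open>Positions have to be distinct because one position carries a single node,
      label and value.\<close>
    then obtain f where f: "inj_on f N" "\<And>x. x \<in> N \<Longrightarrow> f x \<in> S x"
      using greedy_system_of_distinct_representatives[OF finN] by metis
    have fN: "f (a, b, z, k) \<ge> n \<and> W a b (f (a, b, z, k))" if "(a, b, z, k) \<in> N" for a b z k
      using S[OF that] f(2)[OF that] by auto
    define g where "g i = (if i \<in> f ` N then (case the_inv_into N f i of (a, b, z, k) \<Rightarrow> (nd i z, k, a i)) else (replicate i False, 0, 0))" for i
    have g1: "length (fst (g i)) = i" for i by (simp add: g_def nd_len split: prod.split)
    have gN: "g (f (a, b, z, k)) = (nd (f (a, b, z, k)) z, k, a (f (a, b, z, k)))" if "(a, b, z, k) \<in> N" for a b z k
      using that f(1) by (simp add: g_def the_inv_into_f_f)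
    have cross: "\<exists>i. W a b i \<and> (if i < n then \<sigma> ! i else g i) = (nd i z, k, a i)"
      if ab: "(a, z, k) \<in> F" "(b, z, k) \<in> F'" "a \<noteq> b" for a b z k
    proof (cases "res n a = res n b")
      case True
      then have "(a, b, z, k) \<in> N" using ab by (simp add: N_def)
      note fgN = fN[OF this] gN[OF this]
      then show ?thesis by (intro exI[of _ "f (a, b, z, k)"]) simp
    next
      case False
      \<comment> \<open>The type provides a twin \<open>b'\<close> of \<open>b\<close> in
        \<open>F\<close> with the same restriction; a witness for \<open>a\<close> and
        \<open>b'\<close> below \<open>n\<close> is also one for \<open>a\<close> and
        \<open>b\<close>.\<close>
      have "(res n b, nd n z, k) \<in> (\<lambda>(a, z, k). (res n a, nd n z, k)) ` F'" using ab(2) by force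
      then have "(res n b, nd n z, k) \<in> (\<lambda>(a, z, k). (res n a, nd n z, k)) ` F" using im by simp
      then obtain b' w where b': "(b', w, k) \<in> F" "res n b' = res n b" "nd n w = nd n z" by auto
      then have "w = z" using goodD(1)[OF FF(3) b'(1) ab(1)] by blast
      moreover have "a \<noteq> b'" using False b' by auto
      ultimately obtain i where "i < n" "W a b' i" "\<sigma> ! i = (nd i z, k, a i)"
        using goodD(3)[OF FF(3) ab(1) b'(1)] by blast
      then show ?thesis using Wres[of a b' i n b] b'(2) by metis
    qed
    have pr: "\<exists>i. W a b i \<and> (if i < length \<sigma> then \<sigma> ! i else g i) = (nd i z, k, a i)"
      if ab: "(a, z, k) \<in> F \<union> F'" "(b, z, k) \<in> F \<union> F'" "a \<noteq> b" for a b z k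
    proof -
      consider "(a, z, k) \<in> F" "(b, z, k) \<in> F" | "(a, z, k) \<in> F'" "(b, z, k) \<in> F'"
        | "(a, z, k) \<in> F" "(b, z, k) \<in> F'" | "(b, z, k) \<in> F" "(a, z, k) \<in> F'" using ab by blast
      then show ?thesis
      proof cases
        case 1 then show ?thesis using goodD(3)[OF FF(3) 1] ab(3) n_def by metis
      next
        case 2 then show ?thesis using goodD(3)[OF FF(6) 2] ab(3) n_def by metis
      next
        case 3 then show ?thesis using cross ab(3) n_def by metis
      next
        case 4
        then obtain i where i: "W b a i" "(if i < n then \<sigma> ! i else g i) = (nd i z, k, b i)" using cross ab(3) by metis
        then have "a i = b i" by (simp add: W_def)
        then show ?thesis using i Wsym n_def by metis
      qed
    qed
    have "\<exists>\<rho>. (\<sigma> @ \<rho>, F \<union> F') \<in> P"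
    proof (rule extend[OF \<sigma>])
      show "length (fst (g i)) = i" for i by (rule g1)
      show "\<exists>i. W a b i \<and> (if i < length \<sigma> then \<sigma> ! i else g i) = (nd i z, k, a i)"
        if "(a, z, k) \<in> F \<union> F'" "(b, z, k) \<in> F \<union> F'" "a \<noteq> b" for a b z k
        using that by (rule pr)
    qed (use FF in auto)
    then obtain \<rho> where \<rho>: "(\<sigma> @ \<rho>, F \<union> F') \<in> P" by blast
    then have "((\<sigma> @ \<rho>, F \<union> F'), (\<sigma>, F)) \<in> r" "((\<sigma> @ \<rho>, F \<union> F'), (\<sigma>, F')) \<in> r"
      using p by (auto simp: r_def)
    then show ?thesis unfolding compatible_def using \<rho> by blast
  qed
  have P0: "([], {}) \<in> P" by (simp add: P_def good_def)
  have sl: "sigma_linked P r"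
  proof -
    define T where "T = type ` P"
    have "T \<subseteq> UNIV \<times> Collect finite" by (auto simp: T_def type_def P_def)
    moreover have "countable (UNIV \<times> Collect finite :: ((bool list \<times> nat \<times> nat) list \<times> ((nat \<times> nat) list \<times> bool list \<times> nat) set) set)"
      by (intro countable_SIGMA) (simp_all add: countable_Collect_finite)
    ultimately have T: "countable T" using countable_subset by blast
    define L where "L j = {p \<in> P. type p = from_nat_into T j}" for j
    have "p \<in> (\<Union>n. L n)" if pP: "p \<in> P" for p
    proof -
      obtain n where "from_nat_into T n = type p" using from_nat_into_surj[OF T, of "type p"] pP by (auto simp: T_def)
      then have "p \<in> L n" using pP by (simp add: L_def)
      then show ?thesis by blast
    qed
    then have "P = (\<Union>n. L n)" by (auto simp: L_def)
    moreover have "compatible P r p q" if "p \<in> L j" "q \<in> L j" for p q j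
    proof -
      obtain \<sigma> F \<sigma>' F' where pq: "p = (\<sigma>, F)" "q = (\<sigma>', F')" by fastforce
      have "type p = type q" using that by (simp add: L_def)
      moreover then have "\<sigma> = \<sigma>'" by (simp add: pq type_def)
      ultimately show ?thesis using linked[of \<sigma> F F'] that pq by (simp add: L_def)
    qed
    ultimately show ?thesis unfolding sigma_linked_def by blast
  qed
  \<comment> \<open>Meeting these sets makes the points collected at \<open>(z, k)\<close> cofinal
    in \<open>H0\<close> for \<open>R\<close>, hence uncountably many.\<close>
  define D where "D = (\<lambda>(z, k, a). {(\<sigma>, F) \<in> P. \<exists>b. R a b \<and> (b, z, k) \<in> F})"
  have dense: "poset_dense P r (D (z, k, a))" if z: "z \<in> Z" and a: "a \<in> H0" for z k a
    unfolding poset_dense_def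
  proof (intro conjI ballI)
    show "D (z, k, a) \<subseteq> P" by (auto simp: D_def)
    fix p assume p: "p \<in> P"
    obtain \<sigma> F where pe: "p = (\<sigma>, F)" by fastforce
    define n where "n = length \<sigma>"
    have F: "finite F" "F \<subseteq> H0 \<times> Z \<times> UNIV" "good ((!) \<sigma>) n F" "card F \<le> n"
      and \<sigma>: "\<forall>i<length \<sigma>. length (fst (\<sigma> ! i)) = i"
      using p by (auto simp: P_def n_def pe good_def)
    have cR: "countable {b \<in> H0. \<not> R a b}"
      using H1(4)[of a] a H0(1) by (auto intro: countable_subset[of _ "{b \<in> H1. \<not> R a b}"])
    have fin: "\<exists>d\<in>D (z, k, a). (d, p) \<in> r" if b: "b \<in> H0" "R a b" and \<rho>: "(\<sigma> @ \<rho>, insert (b, z, k) F) \<in> P" for b \<rho>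
      using b \<rho> p pe by (intro bexI[of _ "(\<sigma> @ \<rho>, insert (b, z, k) F)"]) (auto simp: r_def D_def)
    show "\<exists>d\<in>D (z, k, a). (d, p) \<in> r"
    proof (cases "\<exists>b0. (b0, z, k) \<in> F")
      case False
      have "\<not> H0 \<subseteq> {b \<in> H0. \<not> R a b}" using H0(2) cR countable_subset by blast
      then obtain b where b: "b \<in> H0" "R a b" by blast
      define g where "g i = (replicate i False, 0 :: nat, 0 :: nat)" for i
      have "\<exists>\<rho>. (\<sigma> @ \<rho>, insert (b, z, k) F) \<in> P"
      proof (rule extend[OF \<sigma>])
        show "length (fst (g i)) = i" for i by (simp add: g_def)
        show "\<exists>i. W a' b' i \<and> (if i < length \<sigma> then \<sigma> ! i else g i) = (nd i z', k', a' i)"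
          if "(a', z', k') \<in> insert (b, z, k) F" "(b', z', k') \<in> insert (b, z, k) F" "a' \<noteq> b'" for a' b' z' k'
        proof -
          have "(a', z', k') \<in> F" "(b', z', k') \<in> F" using that False by auto
          then show ?thesis using goodD(3)[OF F(3)] that(3) n_def by metis
        qed
      qed (use F b z in auto)
      then show ?thesis using fin b by blast
    next
      case True
      \<comment> \<open>The new point is taken close to a point \<open>b0\<close> that already has
        this label: only this pair needs a fresh witness, the others are inherited from
        \<open>b0\<close>.\<close>
      then obtain b0 where b0: "(b0, z, k) \<in> F" by blast
      then have n0: "n > 0" using F(1,4) by (metis card_gt_0_iff empty_iff gr0I le_zero_eq less_irrefl)
      have b0H: "b0 \<in> H0" using b0 F(2) by auto
      have "countable (fst ` F \<union> {b \<in> H0. \<not> R a b})" using cR F(1) by (simp add: countable_finite)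
      then have "\<not> {b \<in> H0. res n b = res n b0} \<subseteq> fst ` F \<union> {b \<in> H0. \<not> R a b}"
        using H0(3)[OF b0H, of n] countable_subset by blast
      then obtain b where b: "b \<in> H0" "res n b = res n b0" "b \<notin> fst ` F" "R a b" by blast
      have "b \<noteq> b0" using b(3) b0 by force
      then obtain E where E: "finite E" "card E \<ge> n" "\<forall>i\<in>E. i \<ge> n \<and> W b b0 i"
        using wit'[OF b(1) b0H _ b(2)] by blast
      then have "E \<noteq> {}" using n0 by auto
      then obtain j where j: "j \<ge> n" "W b b0 j" using E by blast
      define g where "g i = (if i = j then (nd j z, k, b j) else (replicate i False, 0 :: nat, 0 :: nat))" for i
      have new: "\<exists>i. W b' b i \<and> W b b' i \<and> (if i < length \<sigma> then \<sigma> ! i else g i) = (nd i z, k, b i)" if b': "(b', z, k) \<in> F" for b'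
      proof (cases "b' = b0")
        case True
        then show ?thesis using j Wsym by (intro exI[of _ j]) (auto simp: g_def n_def)
      next
        case False
        then obtain i where i: "i < n" "W b' b0 i" "\<sigma> ! i = (nd i z, k, b' i)"
          using goodD(3)[OF F(3) b' b0] by blast
        then have w: "W b' b i" using Wres b(2) by blast
        then have "b' i = b i" by (simp add: W_def)
        then show ?thesis using i w Wsym n_def by metis
      qed
      have "\<exists>\<rho>. (\<sigma> @ \<rho>, insert (b, z, k) F) \<in> P"
      proof (rule extend[OF \<sigma>])
        show "length (fst (g i)) = i" for i by (simp add: g_def nd_len)
        show "\<exists>i. W a' b' i \<and> (if i < length \<sigma> then \<sigma> ! i else g i) = (nd i z', k', a' i)"
          if ab: "(a', z', k') \<in> insert (b, z, k) F" "(b', z', k') \<in> insert (b, z, k) F" "a' \<noteq> b'" for a' b' z' k'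
        proof -
          consider "(a', z', k') \<in> F" "(b', z', k') \<in> F" | "a' = b" "z' = z" "k' = k" "(b', z, k) \<in> F"
            | "b' = b" "z' = z" "k' = k" "(a', z, k) \<in> F" using ab by auto
          then show ?thesis
          proof cases
            case 1 then show ?thesis using goodD(3)[OF F(3)] ab(3) n_def by metis
          next
            case 2 then show ?thesis using new by metis
          next
            case 3
            then obtain i where "W a' b i" "(if i < length \<sigma> then \<sigma> ! i else g i) = (nd i z, k, b i)" using new by metis
            moreover then have "a' i = b i" by (simp add: W_def)
            ultimately show ?thesis using 3 by metis
          qed
        qed
      qed (use F b z in auto)
      then show ?thesis using fin b by blast
    qed
  qed
  have "|D ` (Z \<times> (UNIV :: nat set) \<times> H0)| \<le>o cardSuc natLeq"
  proof -
    have ci: "Cinfinite (cardSuc natLeq)" using natLeq_Cinfinite Cinfinite_cardSuc by blast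
    have n: "|UNIV :: nat set| \<le>o cardSuc natLeq"
      using cardSuc_ordLeq[OF natLeq_Card_order] card_of_nat ordIso_ordLeq_trans by blast
    have "|(UNIV :: nat set) \<times> H0| \<le>o cardSuc natLeq"
      using n H0c ci by (auto simp: cinfinite_def intro!: card_of_Times_ordLeq_infinite_Field)
    then have "|Z \<times> (UNIV :: nat set) \<times> H0| \<le>o cardSuc natLeq"
      using Z(2) ci by (auto simp: cinfinite_def intro!: card_of_Times_ordLeq_infinite_Field)
    then show ?thesis using card_of_image ordLeq_transitive by blast
  qed
  moreover have "MA_aleph1_for P r"
    using MA_sigma_linked_imp_MA_aleph1_for[OF MA _ po sl] P0 by blast
  moreover have "\<forall>E\<in>D ` (Z \<times> (UNIV :: nat set) \<times> H0). poset_dense P r E" using dense by auto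
  ultimately have "\<exists>G. poset_filter P r G \<and> (\<forall>E\<in>D ` (Z \<times> (UNIV :: nat set) \<times> H0). G \<inter> E \<noteq> {})"
    unfolding MA_aleph1_for_def by blast
  then obtain G where G1: "poset_filter P r G" "\<forall>E\<in>D ` (Z \<times> (UNIV :: nat set) \<times> H0). G \<inter> E \<noteq> {}"
    by (elim exE conjE)
  have G2: "G \<inter> D (z, k, a) \<noteq> {}" if "z \<in> Z" "a \<in> H0" for z k a
    using G1(2) that by (meson SigmaI UNIV_I imageI)
  note G = G1(1) G2
  have GP: "G \<subseteq> P" using G(1) by (simp add: poset_filter_def)
  have dir: "\<exists>\<sigma> F. (\<sigma>, F) \<in> G \<and> (\<exists>\<rho>. \<sigma> = \<sigma>1 @ \<rho>) \<and> (\<exists>\<rho>. \<sigma> = \<sigma>2 @ \<rho>) \<and> F1 \<subseteq> F \<and> F2 \<subseteq> F"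
    if 12: "(\<sigma>1, F1) \<in> G" "(\<sigma>2, F2) \<in> G" for \<sigma>1 \<sigma>2 F1 F2
  proof -
    have "\<forall>p\<in>G. \<forall>q\<in>G. \<exists>s\<in>G. (s, p) \<in> r \<and> (s, q) \<in> r" using G(1) by (simp add: poset_filter_def)
    then obtain s where s: "s \<in> G" "(s, (\<sigma>1, F1)) \<in> r" "(s, (\<sigma>2, F2)) \<in> r" using 12 by blast
    obtain \<sigma> F where "s = (\<sigma>, F)" by fastforce
    then show ?thesis using s unfolding r_def by auto
  qed
  \<comment> \<open>The union of the sequences in the filter. Coordinates not reached get a node of
    the right level, to keep the condition on levels everywhere.\<close>
  define t where "t i = (if \<exists>\<sigma> F. (\<sigma>, F) \<in> G \<and> i < length \<sigma> then (SOME x. \<exists>\<sigma> F. (\<sigma>, F) \<in> G \<and> i < length \<sigma> \<and> x = \<sigma> ! i)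
      else (replicate i False, 0, 0))" for i
  have t: "t i = \<sigma> ! i" if s: "(\<sigma>, F) \<in> G" "i < length \<sigma>" for i \<sigma> F
  proof -
    have "\<exists>x. \<exists>\<sigma> F. (\<sigma>, F) \<in> G \<and> i < length \<sigma> \<and> x = \<sigma> ! i" using s by blast
    note ex = this
    have "\<exists>\<sigma> F. (\<sigma>, F) \<in> G \<and> i < length \<sigma>" using s by blast
    then have ti: "t i = (SOME x. \<exists>\<sigma> F. (\<sigma>, F) \<in> G \<and> i < length \<sigma> \<and> x = \<sigma> ! i)"
      unfolding t_def by (rule if_P)
    from someI_ex[OF ex, folded ti] obtain \<sigma>' F' where s': "(\<sigma>', F') \<in> G" "i < length \<sigma>'" "t i = \<sigma>' ! i"
      by blast
    from dir[OF s(1) s'(1)] obtain \<sigma>'' \<rho> \<rho>' where e: "\<sigma>'' = \<sigma> @ \<rho>" "\<sigma>'' = \<sigma>' @ \<rho>'" by blast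
    have "\<sigma> ! i = \<sigma>'' ! i" "\<sigma>' ! i = \<sigma>'' ! i" using s(2) s'(2) e by (metis nth_append)+
    then show ?thesis using s'(3) by simp
  qed
  have tlen: "length (fst (t i)) = i" for i
  proof (cases "\<exists>\<sigma> F. (\<sigma>, F) \<in> G \<and> i < length \<sigma>")
    case True
    then obtain \<sigma> F where s: "(\<sigma>, F) \<in> G" "i < length \<sigma>" by blast
    then have "(\<sigma>, F) \<in> P" using GP by blast
    then show ?thesis using s t[OF s] by (simp add: P_def)
  next
    case False
    show ?thesis unfolding t_def if_not_P[OF False] by simp
  qed
  define \<tau> where "\<tau> i = (fst (t i), fst (snd (t i)))" for i
  define c where "c i = snd (snd (t i))" for i
  have "\<exists>H' \<subseteq> H. uncountable H' \<and> (\<forall>a\<in>H'. \<forall>b\<in>H'. a \<noteq> b \<longrightarrow>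
      (\<exists>i. W a b i \<and> \<tau> i = (map z [0..<i], k) \<and> c i = a i))" if z: "z \<in> Z" for z k
  proof -
    define H' where "H' = {b. \<exists>\<sigma> F. (\<sigma>, F) \<in> G \<and> (b, z, k) \<in> F}"
    have H': "H' \<subseteq> H0" using GP unfolding H'_def P_def by blast
    have "H0 \<subseteq> (\<Union>b\<in>H'. {a \<in> H1. R a b})"
    proof
      fix a assume a: "a \<in> H0"
      obtain \<sigma> F b where "(\<sigma>, F) \<in> G" "R a b" "(b, z, k) \<in> F"
        using G(2)[OF z a, of k] unfolding D_def by blast
      then show "a \<in> (\<Union>b\<in>H'. {a \<in> H1. R a b})" using a H0(1) unfolding H'_def by blast
    qed
    note cov = this
    have "uncountable H'"
    proof
      assume "countable H'"
      then have "countable (\<Union>b\<in>H'. {a \<in> H1. R a b})"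
        by (rule countable_UN) (use H1(5) H' H0(1) in blast)
      then show False using cov H0(2) countable_subset by metis
    qed
    moreover have "\<exists>i. W a b i \<and> \<tau> i = (map z [0..<i], k) \<and> c i = a i" if ab: "a \<in> H'" "b \<in> H'" "a \<noteq> b" for a b
    proof -
      obtain \<sigma>1 F1 \<sigma>2 F2 where 12: "(\<sigma>1, F1) \<in> G" "(a, z, k) \<in> F1" "(\<sigma>2, F2) \<in> G" "(b, z, k) \<in> F2"
        using ab unfolding H'_def by blast
      then obtain \<sigma> F where s: "(\<sigma>, F) \<in> G" "(a, z, k) \<in> F" "(b, z, k) \<in> F" using dir[OF 12(1,3)] by blast
      then have "good ((!) \<sigma>) (length \<sigma>) F" using GP by (auto simp: P_def)
      from goodD(3)[OF this s(2,3) refl refl ab(3)] obtain i where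
        i: "i < length \<sigma>" "W a b i" "\<sigma> ! i = (nd i z, k, a i)" by blast
      then have "t i = (nd i z, k, a i)" using t[OF s(1) i(1)] by simp
      then show ?thesis using i(2) by (auto simp: \<tau>_def c_def nd_def)
    qed
    ultimately show ?thesis using subset_trans[OF H' H0H] by (intro exI[of _ H'] conjI ballI impI) simp_all
  qed
  note branches = this
  show thesis
  proof (rule that[of Z \<tau> c])
    show "uncountable Z" by (rule Z(1))
    show "length (fst (\<tau> i)) = i" for i using tlen by (simp add: \<tau>_def)
  qed (rule branches)
qed

section \<open>Uniformization of coherent families\<close>

text \<open>The value \<open>v a i\<close> is attached to the coordinate \<open>a i\<close>, and
  \<open>D i\<close> measures incoherence at \<open>i\<close>. Assumption \<open>rich\<close> lets a
  member imitate countably many others on prescribed infinite sets; \<open>catch\<close> puts some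
  branch with prescribed coordinates \<open>c\<close> into the family. In the bound, \<delta> comes
  from coherence with one member and \<open>2 * \<delta>\<close> from a coordinate at which two
  members are not incoherent.\<close>

lemma uniformization:
  fixes X :: "(nat \<Rightarrow> nat) set" and v :: "(nat \<Rightarrow> nat) \<Rightarrow> nat \<Rightarrow> nat"
    and D :: "nat \<Rightarrow> nat \<Rightarrow> nat \<Rightarrow> real" and \<delta> :: real
  assumes OCA and MA: MA_sigma_linked
    and D0: "\<And>i x. D i x x = 0" and Dsym: "\<And>i x y. D i x y = D i y x"
    and Dtri: "\<And>i x y z. D i x z \<le> D i x y + D i y z" and \<delta>: "\<delta> > 0"
    and coh: "\<And>a b. a \<in> X \<Longrightarrow> b \<in> X \<Longrightarrow> finite {i. a i = b i \<and> D i (v a i) (v b i) > \<delta>}"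
    and rich: "\<And>(c :: nat \<Rightarrow> nat \<Rightarrow> nat) B. (\<And>j. c j \<in> X) \<Longrightarrow> (\<And>j :: nat. infinite (B j)) \<Longrightarrow>
      \<exists>a\<in>X. \<forall>j. infinite {i \<in> B j. a i = c j i}"
    and catch: "\<And>(Z :: (nat \<Rightarrow> bool) set) (\<tau> :: nat \<Rightarrow> bool list \<times> nat) c. uncountable Z \<Longrightarrow>
      (\<And>i. length (fst (\<tau> i)) = i) \<Longrightarrow>
      \<exists>z\<in>Z. \<exists>k. \<exists>t\<in>X. \<forall>i. \<tau> i = (map z [0..<i], k) \<and> (\<exists>x\<in>X. x i = c i) \<longrightarrow> t i = c i"
  shows "\<exists>H. \<forall>a\<in>X. finite {i. D i (v a i) (H i (a i)) > 3 * \<delta>}"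
proof (cases "X = {}")
  case False
  then obtain x0 where x0: "x0 \<in> X" by blast
  \<comment> \<open>Twice \<delta>, so that two values within \<delta> of a common third one do not
    count as incoherent.\<close>
  define Q where "Q i x y \<longleftrightarrow> D i x y > 2 * \<delta>" for i x y
  define W where "W a b i \<longleftrightarrow> a i = b i \<and> Q i (v a i) (v b i)" for a b i
  define res where "res n a = map (\<lambda>i. (a i, v a i)) [0..<n]" for n a
  have res: "res n a = res n b \<longleftrightarrow> (\<forall>i<n. a i = b i \<and> v a i = v b i)" for n a b
    unfolding res_def map_upt_eq_iff by simp
  have Qirr: "\<not> Q i x x" for i x using \<delta> by (simp add: Q_def D0)
  have Qsym: "Q i x y \<Longrightarrow> Q i y x" for i x y by (simp add: Q_def Dsym)
  define \<Delta> where "\<Delta> a b = (LEAST i. a i \<noteq> b i)" for a b :: "nat \<Rightarrow> nat"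
  have Dne: "a (\<Delta> a b) \<noteq> b (\<Delta> a b)" if "a \<noteq> b" for a b
  proof -
    have "\<exists>i. a i \<noteq> b i" using that by blast
    then show ?thesis unfolding \<Delta>_def by (rule LeastI_ex)
  qed
  have Dcong: "a' \<noteq> b' \<and> \<Delta> a' b' = \<Delta> a b" if ab: "a \<noteq> b" "\<Delta> a b < n" "\<And>i. i < n \<Longrightarrow> a' i = a i" "\<And>i. i < n \<Longrightarrow> b' i = b i" for a b a' b' n
  proof -
    have ne: "a' (\<Delta> a b) \<noteq> b' (\<Delta> a b)" using Dne[OF ab(1)] ab(2-4) by simp
    have "\<Delta> a' b' = \<Delta> a b" unfolding \<Delta>_def[of a' b']
    proof (rule Least_equality[where P="\<lambda>i. a' i \<noteq> b' i"])
      show "a' (\<Delta> a b) \<noteq> b' (\<Delta> a b)" by (rule ne)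
      fix y assume y: "a' y \<noteq> b' y"
      show "\<Delta> a b \<le> y"
      proof (rule ccontr)
        assume l: "\<not> \<Delta> a b \<le> y"
        then have "a y \<noteq> b y" using y ab(2) ab(3,4)[of y] by simp
        then have "\<Delta> a b \<le> y" unfolding \<Delta>_def by (rule Least_le)
        then show False using l by simp
      qed
    qed
    then show ?thesis using ne by auto
  qed
  define K where "K a b \<longleftrightarrow> a \<noteq> b \<and> (\<exists>E. finite E \<and> card E = \<Delta> a b \<and> (\<forall>i\<in>E. W a b i))" for a b
  \<comment> \<open>With \<open>v a\<close> in the code \<open>K\<close> is open: finitely many
    coordinates determine the first difference and the incoherences in \<open>E\<close>.\<close>
  define e where "e a i = prod_encode (a i, v a i)" for a i
  have e: "e a i = e b i \<longleftrightarrow> a i = b i \<and> v a i = v b i" for a b i by (simp add: e_def)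
  show ?thesis
  proof (rule OCA_dichotomy[OF \<open>OCA\<close>, of e X K])
    show "inj_on e X"
    proof (rule inj_onI)
      fix a b assume "e a = e b"
      then have "e a i = e b i" for i by simp
      then have "a i = b i" for i using e by simp
      then show "a = b" by blast
    qed
    show "K b a" if "K a b" for a b
    proof -
      have "\<Delta> b a = \<Delta> a b" by (simp add: \<Delta>_def eq_commute)
      moreover have "W a b i \<Longrightarrow> W b a i" for i using Qsym by (auto simp: W_def)
      ultimately show ?thesis using that unfolding K_def by metis
    qed
    show "\<not> K a a" for a by (simp add: K_def)
    show "\<exists>n. \<forall>a'\<in>X. \<forall>b'\<in>X. (\<forall>i<n. e a' i = e a i) \<and> (\<forall>i<n. e b' i = e b i) \<longrightarrow> K a' b'" if k: "K a b" for a b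
    proof -
      obtain E where E: "a \<noteq> b" "finite E" "card E = \<Delta> a b" "\<forall>i\<in>E. W a b i" using k unfolding K_def by blast
      obtain n0 where n0: "\<forall>i\<in>E. i < n0" using E(2) finite_nat_set_iff_bounded by blast
      define n where "n = max n0 (Suc (\<Delta> a b))"
      show ?thesis
      proof (intro exI[of _ n] ballI impI)
        fix a' b' assume "(\<forall>i<n. e a' i = e a i) \<and> (\<forall>i<n. e b' i = e b i)"
        then have ab: "a' i = a i" "v a' i = v a i" "b' i = b i" "v b' i = v b i" if "i < n" for i
          using that e by auto
        have "a' \<noteq> b' \<and> \<Delta> a' b' = \<Delta> a b" using Dcong[OF E(1), of n a' b'] ab by (simp add: n_def)
        moreover have "W a' b' i" if iE: "i \<in> E" for i
        proof -
          have "i < n" using n0 iE by (auto simp: n_def less_max_iff_disj)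
          then show ?thesis using E(4) iE ab by (simp add: W_def)
        qed
        ultimately show "K a' b'" unfolding K_def using E by metis
      qed
    qed
  next
    fix H assume H: "H \<subseteq> X" "uncountable H" "\<And>x y. x \<in> H \<Longrightarrow> y \<in> H \<Longrightarrow> x \<noteq> y \<Longrightarrow> K x y"
    have wit: "\<exists>E. finite E \<and> card E = (LEAST i. a i \<noteq> b i) \<and> (\<forall>i\<in>E. W a b i)" if "a \<in> H" "b \<in> H" "a \<noteq> b" for a b
      using H(3)[OF that] unfolding K_def \<Delta>_def by blast
    obtain \<tau> :: "nat \<Rightarrow> bool list \<times> nat" and c Z where Z: "uncountable Z" "\<And>i. length (fst (\<tau> i)) = i"
      "\<And>z k. z \<in> Z \<Longrightarrow> \<exists>H' \<subseteq> H. uncountable H' \<and> (\<forall>a\<in>H'. \<forall>b\<in>H'. a \<noteq> b \<longrightarrow>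
      (\<exists>i. W a b i \<and> \<tau> i = (map z [0..<i], k) \<and> c i = a i))"
      by (rule generic_branches[where W=W and Q=Q and v=v and H=H, OF W_def MA H(2) Qirr Qsym wit]) (assumption+, rule that)
    \<comment> \<open>The branch with the values \<open>c\<close> belongs to the family, by means of
      \<open>t\<close>; every member of the clique is coherent with \<open>t\<close> from some
      \<open>N a\<close> on.\<close>
    obtain z k t where zk: "z \<in> Z" "t \<in> X"
      and t: "\<And>i. \<tau> i = (map z [0..<i], k) \<Longrightarrow> (\<exists>x\<in>X. x i = c i) \<Longrightarrow> t i = c i"
      using catch[OF Z(1,2), of c] by blast
    obtain H' where H': "H' \<subseteq> H" "uncountable H'"
      "\<And>a b. a \<in> H' \<Longrightarrow> b \<in> H' \<Longrightarrow> a \<noteq> b \<Longrightarrow> \<exists>i. W a b i \<and> \<tau> i = (map z [0..<i], k) \<and> c i = a i"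
      using Z(3)[OF zk(1), of k] by blast
    have "\<exists>n. \<forall>i. a i = t i \<and> D i (v a i) (v t i) > \<delta> \<longrightarrow> i < n" if "a \<in> H'" for a
    proof -
      have "a \<in> X" using that H'(1) H(1) by blast
      from coh[OF this zk(2)] show ?thesis unfolding finite_nat_set_iff_bounded by simp
    qed
    then obtain N where N: "\<And>a i. a \<in> H' \<Longrightarrow> a i = t i \<Longrightarrow> D i (v a i) (v t i) > \<delta> \<Longrightarrow> i < N a" by metis
    \<comment> \<open>Two members with the same \<open>N a\<close> and the same restriction have no
      incoherence below \<open>N a\<close>, and closeness to \<open>t\<close> excludes one on the
      branch from \<open>N a\<close> on. The clique promised one on the branch.\<close>
    define f where "f a = (N a, res (N a) a)" for a
    have "\<not> inj_on f H'"
    proof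
      assume "inj_on f H'"
      then show False using H'(2) countable_image_inj_on[of f H'] countableI_type by blast
    qed
    then obtain a b where ab: "a \<in> H'" "b \<in> H'" "a \<noteq> b" "N a = N b" "res (N a) a = res (N a) b"
      unfolding inj_on_def f_def by auto
    obtain i where i: "W a b i" "\<tau> i = (map z [0..<i], k)" "c i = a i" using H'(3)[OF ab(1-3)] by blast
    have "a \<in> X" using ab(1) H'(1) H(1) by blast
    then have ti: "t i = a i" "t i = b i" using t[OF i(2)] i by (auto simp: W_def)
    have "\<not> i < N a"
    proof
      assume "i < N a"
      then have "v a i = v b i" using ab(5) by (simp add: res)
      then show False using i(1) Qirr by (simp add: W_def)
    qed
    then have "D i (v a i) (v t i) \<le> \<delta>" "D i (v b i) (v t i) \<le> \<delta>"
      using N[of a i] N[of b i] ab ti by force+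
    then have "D i (v a i) (v b i) \<le> 2 * \<delta>" using Dtri[of i "v a i" "v b i" "v t i"] Dsym[of i "v t i" "v b i"] by linarith
    then show "\<exists>H. \<forall>a\<in>X. finite {i. D i (v a i) (H i (a i)) > 3 * \<delta>}" using i(1) by (simp add: W_def Q_def)
  next
    fix Y :: "nat \<Rightarrow> (nat \<Rightarrow> nat) set"
    assume Y: "X = (\<Union>n. Y n)" "\<And>n x y. x \<in> Y n \<Longrightarrow> y \<in> Y n \<Longrightarrow> \<not> K x y"
    \<comment> \<open>A sigma-ideal adapted to \<open>rich\<close>: a set is small if there is a
      list of tasks, namely to agree infinitely often with \<open>c j\<close> on \<open>B j\<close>,
      such that each of its members fails in one of them. Merging lists gives closure under
      countable unions, and \<open>rich\<close> says that \<open>X\<close> is not small.\<close>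
    define adm where "adm c B \<longleftrightarrow> (\<forall>j :: nat. c j \<in> X \<and> infinite (B j))" for c and B :: "nat \<Rightarrow> nat set"
    define esc where "esc c B a \<longleftrightarrow> (\<exists>j :: nat. finite {i \<in> B j. a i = c j i})" for c B and a :: "nat \<Rightarrow> nat"
    define small where "small S \<longleftrightarrow> (\<exists>c B. adm c B \<and> (\<forall>a\<in>S. esc c B a))" for S
    have mono: "small S" if "small S'" "S \<subseteq> S'" for S S' using that unfolding small_def by blast
    have UN: "small (\<Union>n :: nat. S n)" if "\<And>n. small (S n)" for S
    proof -
      have "\<forall>n. \<exists>c B. adm c B \<and> (\<forall>a\<in>S n. esc c B a)" using that unfolding small_def by blast
      then obtain c B where cB: "\<And>n. adm (c n) (B n)" "\<And>n a. a \<in> S n \<Longrightarrow> esc (c n) (B n) a" by metis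
      define c' where "c' j = (case prod_decode j of (n, m) \<Rightarrow> c n m)" for j
      define B' where "B' j = (case prod_decode j of (n, m) \<Rightarrow> B n m)" for j
      have "adm c' B'" using cB(1) by (simp add: adm_def c'_def B'_def split: prod.split)
      moreover have "esc c' B' a" if "a \<in> S n" for a n
        using cB(2)[OF that] unfolding esc_def
      proof
        fix j assume "finite {i \<in> B n j. a i = c n j i}"
        then show "\<exists>j. finite {i \<in> B' j. a i = c' j i}"
          by (intro exI[of _ "prod_encode (n, j)"]) (simp add: c'_def B'_def)
      qed
      ultimately show ?thesis unfolding small_def by blast
    qed
    have empty: "small {}" unfolding small_def adm_def using x0 by (intro exI[of _ "\<lambda>_. x0"] exI[of _ "\<lambda>_. UNIV"]) auto
    have Un: "small (S \<union> S')" if "small S" "small S'" for S S'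
    proof -
      have "small (\<Union>n :: nat. if n = 0 then S else S')" by (rule UN) (use that in auto)
      then show ?thesis by (rule mono) auto
    qed
    have "\<not> small X"
    proof
      assume "small X"
      then obtain c B where cB: "adm c B" "\<And>a. a \<in> X \<Longrightarrow> esc c B a" unfolding small_def by blast
      obtain a where "a \<in> X" "\<And>j. infinite {i \<in> B j. a i = c j i}"
        using rich[of c B] cB(1) unfolding adm_def by blast
      then show False using cB(2)[of a] unfolding esc_def by blast
    qed
    then obtain k where k: "\<not> small (Y k)" using UN[of Y] Y(1) by auto
    define cyl where "cyl a n = {b. res n b = res n a}" for a n
    \<comment> \<open>Deleting the small relatively open parts, countably many, leaves a set that is
      not small in any neighbourhood of its points.\<close>
    define Y' where "Y' = {a \<in> Y k. \<forall>n. \<not> small (Y k \<inter> cyl a n)}"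
    define S where "S j = (case from_nat j of (n, t) \<Rightarrow> if small (Y k \<inter> {b. res n b = t}) then Y k \<inter> {b. res n b = t} else {})" for j
    have "small (\<Union>j. S j)" by (rule UN) (simp add: S_def empty split: prod.split)
    moreover have "Y k - Y' \<subseteq> (\<Union>j. S j)"
    proof
      fix a assume "a \<in> Y k - Y'"
      then obtain n where n: "a \<in> Y k" "small (Y k \<inter> cyl a n)" unfolding Y'_def by blast
      then have "a \<in> S (to_nat (n, res n a))" by (simp add: S_def cyl_def)
      then show "a \<in> (\<Union>j. S j)" by blast
    qed
    ultimately have sm: "small (Y k - Y')" using mono by blast
    have pos: "\<not> small (Y' \<inter> cyl a n)" if "a \<in> Y'" for a n
    proof
      assume "small (Y' \<inter> cyl a n)"
      then have "small ((Y' \<inter> cyl a n) \<union> (Y k - Y'))" using sm Un by blast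
      then have "small (Y k \<inter> cyl a n)" by (rule mono) blast
      then show False using that unfolding Y'_def by blast
    qed
    have "Y' \<noteq> {}" using sm k by auto
    then obtain y where y: "y \<in> Y'" by blast
    have "\<exists>a0\<in>Y'. \<exists>b0\<in>Y'. \<exists>n E. finite E \<and> (\<forall>a\<in>Y' \<inter> cyl a0 n. \<forall>b\<in>Y' \<inter> cyl b0 n. \<forall>i. W a b i \<longrightarrow> i \<in> E)"
    proof (cases "Y' = {y}")
      case True
      have "\<not> W y y i" for i using Qirr by (simp add: W_def)
      then show ?thesis using True by (intro bexI[of _ y] exI[of _ 0] exI[of _ "{}"]) auto
    next
      case False
      then obtain y' where y': "y' \<in> Y'" "y \<noteq> y'" using y by blast
      define m where "m = Suc (\<Delta> y y')"
      define P where "P = (\<lambda>(a, b). a \<in> Y' \<inter> cyl y m \<and> b \<in> Y' \<inter> cyl y' m)"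
      define w where "w = (\<lambda>(a, b). {i. W a b i})"
      \<comment> \<open>Points near \<open>y\<close> and \<open>y'\<close> have the same first
        difference, and the absence of coloured pairs turns it into a bound for the number of
        incoherences.\<close>
      have fin: "finite (w p) \<and> card (w p) < \<Delta> y y'" if Pp: "P p" for p
      proof -
        obtain a b where p: "p = (a, b)" by fastforce
        have ab: "a \<in> Y'" "b \<in> Y'" "res m a = res m y" "res m b = res m y'" using Pp by (auto simp: P_def p cyl_def)
        have \<Delta>: "a \<noteq> b \<and> \<Delta> a b = \<Delta> y y'" using Dcong[OF y'(2), of m a b] ab(3,4) by (simp add: m_def res)
        have nK: "\<not> K a b" using Y(2)[of a k b] ab unfolding Y'_def by blast
        have no: "\<not> (\<exists>E \<subseteq> w p. finite E \<and> card E = \<Delta> y y')"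
        proof
          assume "\<exists>E \<subseteq> w p. finite E \<and> card E = \<Delta> y y'"
          then obtain E where "finite E" "card E = \<Delta> a b" "\<forall>i\<in>E. W a b i" using \<Delta> by (auto simp: w_def p)
          then show False using nK \<Delta> unfolding K_def by blast
        qed
        have "finite (w p)" using no infinite_arbitrarily_large[of "w p" "\<Delta> y y'"] by blast
        moreover have "card (w p) < \<Delta> y y'"
        proof (rule ccontr)
          assume "\<not> card (w p) < \<Delta> y y'"
          then have "\<Delta> y y' \<le> card (w p)" by simp
          from obtain_subset_with_card_n[OF this] show False using no calculation finite_subset by metis
        qed
        ultimately show ?thesis by blast
      qed
      have "P (y, y')" using y y' by (simp add: P_def cyl_def)
      moreover have "\<forall>p. P p \<longrightarrow> card (w p) < \<Delta> y y'" using fin by blast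
      ultimately have "\<exists>p. P p \<and> (\<forall>q. P q \<longrightarrow> card (w q) \<le> card (w p))"
        by (rule ex_has_greatest_nat)
      then obtain p where p: "P p" "\<And>q. P q \<Longrightarrow> card (w q) \<le> card (w p)" by blast
      obtain a0 b0 where ab0: "p = (a0, b0)" by fastforce
      define E where "E = w p"
      have E: "finite E" using fin[OF p(1)] by (simp add: E_def)
      obtain n0 where n0: "\<forall>i\<in>E. i < n0" using E finite_nat_set_iff_bounded by blast
      define n where "n = max n0 m"
      have "\<forall>i. W a b i \<longrightarrow> i \<in> E" if ab: "a \<in> Y' \<inter> cyl a0 n" "b \<in> Y' \<inter> cyl b0 n" for a b
      proof -
        have eq: "a i = a0 i" "v a i = v a0 i" "b i = b0 i" "v b i = v b0 i" if "i < n" for i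
          using ab that by (auto simp: cyl_def res)
        have "P (a, b)" using p(1) ab eq unfolding P_def ab0 cyl_def by (auto simp: res n_def)
        then have "finite (w (a, b))" "card (w (a, b)) \<le> card E" using fin p(2) E_def by blast+
        moreover have "E \<subseteq> w (a, b)"
        proof
          fix i assume iE: "i \<in> E"
          then have "i < n" using n0 by (auto simp: n_def less_max_iff_disj)
          then show "i \<in> w (a, b)" using iE eq[of i] by (simp add: W_def w_def E_def ab0)
        qed
        ultimately have "E = w (a, b)" using card_seteq by blast
        then show ?thesis by (auto simp: w_def)
      qed
      note all = this
      have "a0 \<in> Y'" "b0 \<in> Y'" using p(1) by (auto simp: P_def ab0)
      then show ?thesis
        using E all by (intro bexI[of _ a0] bexI[of _ b0] exI[of _ n] exI[of _ E]) simp_all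
    qed
    then obtain a0 b0 n E where ab0: "a0 \<in> Y'" "b0 \<in> Y'" "finite E"
      and E0: "\<forall>a\<in>Y' \<inter> cyl a0 n. \<forall>b\<in>Y' \<inter> cyl b0 n. \<forall>i. W a b i \<longrightarrow> i \<in> E"
      by (elim bexE exE conjE)
    have E: "i \<in> E" if "a \<in> Y' \<inter> cyl a0 n" "b \<in> Y' \<inter> cyl b0 n" "W a b i" for a b i
      using E0 that by metis
    define U where "U = Y' \<inter> cyl a0 n"
    define V where "V = Y' \<inter> cyl b0 n"
    have UX: "U \<subseteq> X" unfolding U_def Y'_def Y(1) by blast
    have ubiq: "\<exists>b\<in>S. infinite {i \<in> B. b i = a i}" if "\<not> small S" "a \<in> X" "infinite B" for S a B
    proof (rule ccontr)
      assume "\<not> ?thesis"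
      then have "\<forall>b\<in>S. esc (\<lambda>_. a) (\<lambda>_. B) b" by (simp add: esc_def)
      moreover have "adm (\<lambda>_. a) (\<lambda>_. B)" using that(2,3) by (simp add: adm_def)
      ultimately have "small S" unfolding small_def by blast
      then show False using that(1) by blast
    qed
    \<comment> \<open>Any member of \<open>V\<close> through \<open>u\<close> at \<open>i\<close>
      will do: outside \<open>E\<close> all of them are within \<open>2 * \<delta>\<close> of every
      member of \<open>U\<close> through \<open>u\<close>.\<close>
    define H where "H i u = v (SOME b. b \<in> V \<and> b i = u) i" for i u
    have "finite {i. D i (v a i) (H i (a i)) > 3 * \<delta>}" if a: "a \<in> X" for a
    proof (rule ccontr)
      assume inf: "\<not> ?thesis"
      \<comment> \<open>The point \<open>b\<close> only ensures that the choice in \<open>H\<close>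
        is made from a nonempty set; the estimate itself goes through \<open>u\<close>.\<close>
      have "\<not> small V" using pos ab0(2) V_def by blast
      from ubiq[OF this a inf] obtain b where b: "b \<in> V" "infinite {i \<in> {i. D i (v a i) (H i (a i)) > 3 * \<delta>}. b i = a i}" by blast
      have "\<not> small U" using pos ab0(1) U_def by blast
      define B where "B = {i \<in> {i. D i (v a i) (H i (a i)) > 3 * \<delta>}. b i = a i}"
      have "infinite B" using b(2) by (simp add: B_def)
      from ubiq[OF \<open>\<not> small U\<close> a this] obtain u where u: "u \<in> U" "infinite {i \<in> B. u i = a i}" by blast
      define F where "F = E \<union> {i. a i = u i \<and> D i (v a i) (v u i) > \<delta>}"
      have "finite F" unfolding F_def
        using ab0(3) coh[OF a subsetD[OF UX u(1)]] by simp
      then have "infinite ({i \<in> B. u i = a i} - F)" using u(2) by simp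
      then obtain i where "i \<in> {i \<in> B. u i = a i} - F" using infinite_imp_nonempty by blast
      then have iB: "i \<in> B" and ui: "u i = a i" and iF: "i \<notin> F" by simp_all
      have i1: "D i (v a i) (H i (a i)) > 3 * \<delta>" and i2: "b i = a i" using iB by (simp_all add: B_def)
      have i4: "i \<notin> E" and i5: "\<not> D i (v a i) (v u i) > \<delta>" using iF ui by (simp_all add: F_def)
      note i = i1 i2 ui i4 i5
      define b' where "b' = (SOME b. b \<in> V \<and> b i = a i)"
      have b': "b' \<in> V \<and> b' i = a i" unfolding b'_def by (rule someI[where x=b]) (simp add: b(1) i(2))
      have "\<not> W u b' i" using E[of u b' i] u(1) b' i(4) unfolding U_def V_def by metis
      then have "D i (v u i) (v b' i) \<le> 2 * \<delta>" using b' i(3) by (simp add: W_def Q_def)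
      moreover have "H i (a i) = v b' i" by (simp add: H_def b'_def)
      ultimately show False using i(1,5) Dtri[of i "v a i" "v b' i" "v u i"] by simp
    qed
    then show "\<exists>H. \<forall>a\<in>X. finite {i. D i (v a i) (H i (a i)) > 3 * \<delta>}" by blast
  qed
qed simp

section \<open>Category in subspaces of the Cantor space\<close>

definition agree :: "nat set \<Rightarrow> (nat \<Rightarrow> 'v) \<Rightarrow> (nat \<Rightarrow> 'v) \<Rightarrow> bool" where
  "agree S a b \<longleftrightarrow> (\<forall>i\<in>S. a i = b i)"

definition opn :: "(nat \<Rightarrow> 'v) set \<Rightarrow> bool" where
  "opn D \<longleftrightarrow> (\<forall>a\<in>D. \<exists>n. \<forall>b. agree {..<n} b a \<longrightarrow> b \<in> D)"

text \<open>Density in the subspace of all points that agree with \<open>e\<close> on \<open>U \<union> {..<n}\<close>: the coordinates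
  in \<open>U\<close> are fixed for good, those below \<open>n\<close> form a finite condition.\<close>

definition dense_at :: "nat set \<Rightarrow> (nat \<Rightarrow> 'v) \<Rightarrow> nat \<Rightarrow> (nat \<Rightarrow> 'v) set \<Rightarrow> bool" where
  "dense_at U e n D \<longleftrightarrow> (\<forall>e' m. agree (U \<union> {..<n}) e' e \<longrightarrow> (\<exists>a\<in>D. agree (U \<union> {..<m}) a e'))"

text \<open>Comeagre in the subspace of \<open>dense_at\<close>. The witnessing sets are open in the
  whole product, so they can be reused after further coordinates have been frozen.\<close>

definition residual :: "nat set \<Rightarrow> (nat \<Rightarrow> 'v) \<Rightarrow> nat \<Rightarrow> (nat \<Rightarrow> 'v) set \<Rightarrow> bool" where
  "residual U e n Q \<longleftrightarrow> (\<exists>D :: nat \<Rightarrow> (nat \<Rightarrow> 'v) set.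
    (\<forall>j. opn (D j) \<and> dense_at U e n (D j)) \<and> (\<Inter>j. D j) \<subseteq> Q)"

lemma agree_refl [simp]: "agree S a a"
  by (simp add: agree_def)

lemma agree_trans: "agree S a b \<Longrightarrow> agree S b c \<Longrightarrow> agree S a c"
  by (simp add: agree_def)

lemma agree_mono: "agree S a b \<Longrightarrow> T \<subseteq> S \<Longrightarrow> agree T a b"
  by (auto simp: agree_def)

lemma agree_Un: "agree (S \<union> T) a b \<longleftrightarrow> agree S a b \<and> agree T a b"
  by (auto simp: agree_def)

text \<open>The limit of a fusion. A coordinate \<open>i\<close> is read off at the first stage with
  \<open>i\<close> in \<open>U k\<close>, or, if there is none, at stage \<open>i + 1\<close>, where
  it lies below \<open>n\<close>.\<close>

lemma agree_limit:
  fixes e :: "nat \<Rightarrow> nat \<Rightarrow> 'v"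
  assumes step: "\<And>k. agree (U k \<union> {..<n k}) (e (Suc k)) (e k)" and n: "\<And>k. n k < n (Suc k)"
    and U: "\<And>k. U k \<subseteq> U (Suc k)"
  obtains b where "\<And>k. agree (U k \<union> {..<n k}) b (e k)"
proof -
  have sm: "strict_mono n" using n by (simp add: strict_mono_Suc_iff)
  have Um: "U k \<subseteq> U l" if "k \<le> l" for k l using lift_Suc_mono_le[of U, OF U that] .
  have eq: "agree (U k \<union> {..<n k}) (e l) (e k)" if "k \<le> l" for k l
    using that
  proof (induction l rule: dec_induct)
    case (step l)
    have "n k \<le> n l" using step.hyps(1) strict_mono_less_eq[OF sm] by simp
    then have "U k \<union> {..<n k} \<subseteq> U l \<union> {..<n l}" using Um[OF step.hyps(1)] by auto
    then have "agree (U k \<union> {..<n k}) (e (Suc l)) (e l)" using assms(1)[of l] agree_mono by blast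
    then show ?case using step.IH agree_trans by blast
  qed simp
  have idx: "i < n (Suc i)" for i using seq_suble[OF sm, of "Suc i"] by simp
  define b where "b i = (if \<exists>k. i \<in> U k then e (LEAST k. i \<in> U k) i else e (Suc i) i)" for i
  have "b i = e k i" if i: "i \<in> U k \<union> {..<n k}" for i k
  proof -
    have *: "e l i = e k i" if "i \<in> U l \<union> {..<n l}" for l
    proof (cases "l \<le> k")
      case True then show ?thesis using eq[OF True] that by (auto simp: agree_def)
    next
      case False
      then have "k \<le> l" by simp
      from eq[OF this] show ?thesis using i by (auto simp: agree_def)
    qed
    show ?thesis
    proof (cases "\<exists>k. i \<in> U k")
      case True
      then have "i \<in> U (LEAST k. i \<in> U k)" by (rule LeastI_ex)
      then show ?thesis using * True by (simp add: b_def)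
    next
      case False
      then show ?thesis using *[of "Suc i"] idx by (simp add: b_def)
    qed
  qed
  then show thesis using that[of b] by (simp add: agree_def)
qed

lemma dense_at_mono:
  assumes "dense_at U e n D" "agree (U \<union> {..<n}) e' e" "n \<le> n'"
  shows "dense_at U e' n' D"
  unfolding dense_at_def
proof (intro allI impI)
  fix e'' m assume "agree (U \<union> {..<n'}) e'' e'"
  then have "agree (U \<union> {..<n}) e'' e'" by (rule agree_mono) (use assms(3) in auto)
  then have "agree (U \<union> {..<n}) e'' e" using assms(2) agree_trans by blast
  then show "\<exists>a\<in>D. agree (U \<union> {..<m}) a e''" using assms(1) unfolding dense_at_def by blast
qed

text \<open>The Baire category theorem in the subspace; the fusion runs with a constant set
  \<open>U\<close> and enters a neighbourhood contained in \<open>D j\<close> at step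
  \<open>j\<close>.\<close>

lemma baire:
  fixes D :: "nat \<Rightarrow> (nat \<Rightarrow> 'v) set"
  assumes D: "\<And>j. opn (D j) \<and> dense_at U e n (D j)" and e': "agree (U \<union> {..<n}) e' e"
  shows "\<exists>a. (\<forall>j. a \<in> D j) \<and> agree (U \<union> {..<m}) a e'"
proof -
  define P where "P = (\<lambda>(j :: nat) (a, k). agree (U \<union> {..<n}) a e \<and> n \<le> k \<and> m \<le> k \<and> (j = 0 \<longrightarrow> a = e'))"
  define R where "R = (\<lambda>j (a, k) (a', k'). agree (U \<union> {..<k}) a' a \<and> k < k' \<and> (\<forall>b. agree {..<k'} b a' \<longrightarrow> b \<in> D j))"
  have "\<exists>f. \<forall>j. P j (f j) \<and> R j (f j) (f (Suc j))"
  proof (rule dependent_nat_choice)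
    show "\<exists>x. P 0 x" using e' by (intro exI[of _ "(e', max n m)"]) (simp add: P_def)
    fix x j assume Px: "P j x"
    obtain a k where x: "x = (a, k)" by fastforce
    have a: "agree (U \<union> {..<n}) a e" "n \<le> k" "m \<le> k" using Px by (auto simp: P_def x)
    obtain a' where a': "a' \<in> D j" "agree (U \<union> {..<k}) a' a"
      using D[of j] a(1) unfolding dense_at_def by blast
    obtain k' where k': "\<forall>b. agree {..<k'} b a' \<longrightarrow> b \<in> D j" using D[of j] a'(1) unfolding opn_def by blast
    have "\<forall>b. agree {..<max k' (Suc k)} b a' \<longrightarrow> b \<in> D j" using k' by (simp add: agree_def)
    moreover have "agree (U \<union> {..<n}) a' e"
      using a'(2) a agree_mono[of "U \<union> {..<k}" a' a "U \<union> {..<n}"] agree_trans by fastforce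
    ultimately show "\<exists>y. P (Suc j) y \<and> R j x y"
      using a a'(2) by (intro exI[of _ "(a', max k' (Suc k))"]) (auto simp: P_def R_def x)
  qed
  then obtain f where f: "\<And>j. P j (f j)" "\<And>j. R j (f j) (f (Suc j))" by blast
  define a where "a j = fst (f j)" for j
  define k where "k j = snd (f j)" for j
  have R: "agree (U \<union> {..<k j}) (a (Suc j)) (a j)" "k j < k (Suc j)" "\<And>b. agree {..<k (Suc j)} b (a (Suc j)) \<Longrightarrow> b \<in> D j" for j
    using f(2)[of j] by (auto simp: R_def a_def k_def split_beta)
  obtain b where b: "\<And>j. agree (U \<union> {..<k j}) b (a j)"
    using agree_limit[of "\<lambda>_. U" k a] R(1,2) by blast
  have "b \<in> D j" for j using R(3) b[of "Suc j"] by (simp add: agree_Un)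
  moreover have "agree (U \<union> {..<m}) b e'"
  proof -
    have "a 0 = e'" "m \<le> k 0" using f(1)[of 0] by (auto simp: P_def a_def k_def split_beta)
    then show ?thesis using b[of 0] by (auto simp: agree_def)
  qed
  ultimately show ?thesis by blast
qed

lemma residual_ex:
  assumes "residual U e n Q" "agree (U \<union> {..<n}) e' e"
  shows "\<exists>a\<in>Q. agree (U \<union> {..<m}) a e'"
proof -
  obtain D :: "nat \<Rightarrow> _" where D: "\<And>j. opn (D j) \<and> dense_at U e n (D j)" "(\<Inter>j. D j) \<subseteq> Q"
    using assms(1) unfolding residual_def by blast
  obtain a where "\<forall>j. a \<in> D j" "agree (U \<union> {..<m}) a e'" using baire[of D U e n e' m, OF D(1) assms(2)] by blast
  then show ?thesis using D(2) by blast
qed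

lemma residual_INT:
  assumes "\<And>k :: nat. residual U e n (Q k)"
  shows "residual U e n (\<Inter>k. Q k)"
proof -
  have "\<forall>k. \<exists>D :: nat \<Rightarrow> _. (\<forall>j. opn (D j) \<and> dense_at U e n (D j)) \<and> (\<Inter>j. D j) \<subseteq> Q k"
    using assms unfolding residual_def by blast
  then obtain D :: "nat \<Rightarrow> nat \<Rightarrow> _" where D: "\<And>k j. opn (D k j) \<and> dense_at U e n (D k j)" "\<And>k. (\<Inter>j. D k j) \<subseteq> Q k"
    by metis
  define D' where "D' j = (case prod_decode j of (k, l) \<Rightarrow> D k l)" for j
  have "opn (D' j) \<and> dense_at U e n (D' j)" for j using D(1) by (simp add: D'_def split: prod.split)
  moreover have "(\<Inter>j. D' j) \<subseteq> (\<Inter>k. Q k)"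
  proof
    fix x assume x: "x \<in> (\<Inter>j. D' j)"
    have "x \<in> D k l" for k l
    proof -
      have "x \<in> D' (prod_encode (k, l))" using x by blast
      then show ?thesis by (simp add: D'_def)
    qed
    then show "x \<in> (\<Inter>k. Q k)" using D(2) by blast
  qed
  ultimately show ?thesis unfolding residual_def by blast
qed

lemma residual_mono: "residual U e n Q \<Longrightarrow> Q \<subseteq> Q' \<Longrightarrow> residual U e n Q'"
  unfolding residual_def by blast

lemma residual_Int:
  assumes "residual U e n Q" "residual U e n Q'"
  shows "residual U e n (Q \<inter> Q')"
proof -
  have "residual U e n (\<Inter>k :: nat. if k = 0 then Q else Q')" by (rule residual_INT) (use assms in auto)
  then show ?thesis
  proof (rule residual_mono, intro subsetI)
    fix x assume x: "x \<in> (\<Inter>k :: nat. if k = 0 then Q else Q')"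
    then have "x \<in> (if (0 :: nat) = 0 then Q else Q')" "x \<in> (if (1 :: nat) = 0 then Q else Q')" by blast+
    then show "x \<in> Q \<inter> Q'" by simp
  qed
qed

lemma residual_open_dense: "opn D \<Longrightarrow> dense_at U e n D \<Longrightarrow> residual U e n D"
  unfolding residual_def by (intro exI[of _ "\<lambda>_. D"]) simp

text \<open>The Kuratowski-Ulam theorem. The finite conditions on the coordinates that remain free
  are described by countably many words \<open>w\<close>, and each of them can be met inside
  \<open>D\<close> for an open dense set \<open>V w\<close> of points \<open>c\<close>.\<close>

lemma residual_section:
  fixes D :: "(nat \<Rightarrow> 'v::countable) set"
  assumes D: "opn D" "dense_at U e n D"
  shows "residual U e n {c. agree (U \<union> {..<n}) c e \<longrightarrow> dense_at (U \<union> B) c n D}"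
proof -
  define adm where "adm w \<longleftrightarrow> (\<forall>i. i < n \<and> i < length w \<and> i \<notin> U \<union> B \<longrightarrow> w ! i = e i)" for w :: "'v list"
  define V where "V w = {c. adm w \<longrightarrow> (\<exists>m a. (\<forall>b. agree {..<m} b a \<longrightarrow> b \<in> D) \<and> length w \<le> m \<and>
    (\<forall>i<m. i \<in> U \<union> B \<longrightarrow> a i = c i) \<and> (\<forall>i<length w. i \<notin> U \<union> B \<longrightarrow> a i = w ! i))}" for w
  have "opn (V w)" for w
    unfolding opn_def
  proof
    fix c assume c: "c \<in> V w"
    show "\<exists>n. \<forall>c'. agree {..<n} c' c \<longrightarrow> c' \<in> V w"
    proof (cases "adm w")
      case True
      then obtain m a where ma: "\<forall>b. agree {..<m} b a \<longrightarrow> b \<in> D" "length w \<le> m"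
        "\<forall>i<m. i \<in> U \<union> B \<longrightarrow> a i = c i" "\<forall>i<length w. i \<notin> U \<union> B \<longrightarrow> a i = w ! i" using c unfolding V_def by blast
      have "c' \<in> V w" if "agree {..<m} c' c" for c'
      proof -
        have "\<forall>i<m. i \<in> U \<union> B \<longrightarrow> a i = c' i" using ma(3) that by (simp add: agree_def)
        then show ?thesis using ma unfolding V_def by blast
      qed
      then show ?thesis by blast
    qed (simp add: V_def)
  qed
  moreover have "dense_at U e n (V w)" for w
    unfolding dense_at_def
  proof (intro allI impI)
    fix e' m assume e': "agree (U \<union> {..<n}) e' e"
    show "\<exists>c\<in>V w. agree (U \<union> {..<m}) c e'"
    proof (cases "adm w")
      case True
      define e'' where "e'' i = (if i \<in> U \<union> B \<or> i \<ge> length w then e' i else w ! i)" for i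
      have "agree (U \<union> {..<n}) e'' e" using e' True by (auto simp: agree_def e''_def adm_def)
      then obtain a where a: "a \<in> D" "agree (U \<union> {..<max m (length w)}) a e''" using D(2) unfolding dense_at_def by blast
      obtain k where k: "\<forall>b. agree {..<k} b a \<longrightarrow> b \<in> D" using D(1) a(1) unfolding opn_def by blast
      define c where "c i = (if i \<in> U \<union> B then a i else e' i)" for i
      have ae: "a i = e'' i" if "i \<in> U \<or> i < m \<or> i < length w" for i
        using a(2) that by (auto simp: agree_def less_max_iff_disj)
      then have "agree (U \<union> {..<m}) c e'" by (auto simp: agree_def c_def e''_def)
      moreover have "c \<in> V w"
      proof -
        have "\<forall>b. agree {..<max k (length w)} b a \<longrightarrow> b \<in> D" using k by (simp add: agree_def)
        moreover have "\<forall>i<length w. i \<notin> U \<union> B \<longrightarrow> a i = w ! i" using ae by (simp add: e''_def)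
        ultimately show ?thesis unfolding V_def c_def
          by (intro CollectI impI exI[of _ "max k (length w)"] exI[of _ a]) simp
      qed
      ultimately show ?thesis by blast
    next
      case False
      then have "e' \<in> V w" by (simp add: V_def)
      then show ?thesis by (intro bexI[of _ e']) simp_all
    qed
  qed
  ultimately have "residual U e n (V w)" for w by (simp add: residual_open_dense)
  then have "residual U e n (\<Inter>k. V (from_nat k))" by (rule residual_INT)
  then show ?thesis
  proof (rule residual_mono, intro subsetI CollectI impI)
    fix c assume c: "c \<in> (\<Inter>k. V (from_nat k))" and ce: "agree (U \<union> {..<n}) c e"
    have cV: "c \<in> V w" for w
    proof -
      have "c \<in> V (from_nat (to_nat w))" using c by blast
      then show ?thesis by simp
    qed
    show "dense_at (U \<union> B) c n D"
      unfolding dense_at_def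
    proof (intro allI impI)
      fix e' m assume e': "agree (U \<union> B \<union> {..<n}) e' c"
      define w where "w = map e' [0..<m]"
      have wn: "w ! i = e' i" if "i < m" for i using that by (simp add: w_def)
      have "adm w" unfolding adm_def
      proof (intro allI impI)
        fix i assume i: "i < n \<and> i < length w \<and> i \<notin> U \<union> B"
        then have "w ! i = e' i" by (simp add: w_def)
        also have "\<dots> = c i" using e' i by (simp add: agree_def)
        also have "\<dots> = e i" using ce i by (simp add: agree_def)
        finally show "w ! i = e i" .
      qed
      then obtain k a where a: "\<forall>b. agree {..<k} b a \<longrightarrow> b \<in> D" "length w \<le> k"
        "\<forall>i<k. i \<in> U \<union> B \<longrightarrow> a i = c i" "\<forall>i<length w. i \<notin> U \<union> B \<longrightarrow> a i = w ! i"
        using cV[of w] unfolding V_def by blast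
      define b where "b i = (if i \<in> U \<union> B then c i else a i)" for i
      have "b \<in> D" using a(1,3) by (simp add: agree_def b_def)
      moreover have "agree (U \<union> B \<union> {..<m}) b e'"
        unfolding agree_def
      proof
        fix i assume i: "i \<in> U \<union> B \<union> {..<m}"
        show "b i = e' i"
        proof (cases "i \<in> U \<union> B")
          case True then show ?thesis using e' by (auto simp: agree_def b_def)
        next
          case False
          then have "i < m" using i by simp
          then show ?thesis using False a(4) wn[of i] by (simp add: b_def w_def)
        qed
      qed
      ultimately show "\<exists>a\<in>D. agree (U \<union> B \<union> {..<m}) a e'" by blast
    qed
  qed
qed

text \<open>Coordinatewise surjections are continuous and open, so preimages of open dense sets are
  open and dense. They will be projections, shifts and sums modulo two.\<close>

lemma residual_pullback:
  fixes e :: "nat \<Rightarrow> 'v" and e' :: "nat \<Rightarrow> 'w"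
  assumes Q: "residual U e n Q" and p: "\<And>i. surj (p i)" and pe: "\<And>i. i \<in> U \<union> {..<n} \<Longrightarrow> p i (e' i) = e i"
  shows "residual U e' n {y. (\<lambda>i. p i (y i)) \<in> Q}"
proof -
  obtain D :: "nat \<Rightarrow> _" where D: "\<And>j. opn (D j)" "\<And>j. dense_at U e n (D j)" "(\<Inter>j. D j) \<subseteq> Q"
    using Q unfolding residual_def by blast
  define D' where "D' j = {y. (\<lambda>i. p i (y i)) \<in> D j}" for j
  have "opn (D' j)" for j
    unfolding opn_def
  proof
    fix y assume "y \<in> D' j"
    then obtain m where m: "\<forall>b. agree {..<m} b (\<lambda>i. p i (y i)) \<longrightarrow> b \<in> D j"
      using D(1)[of j] unfolding opn_def D'_def by blast
    have "y' \<in> D' j" if "agree {..<m} y' y" for y'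
    proof -
      have "agree {..<m} (\<lambda>i. p i (y' i)) (\<lambda>i. p i (y i))" using that by (simp add: agree_def)
      then show ?thesis using m by (simp add: D'_def)
    qed
    then show "\<exists>n. \<forall>b. agree {..<n} b y \<longrightarrow> b \<in> D' j" by blast
  qed
  moreover have "dense_at U e' n (D' j)" for j
    unfolding dense_at_def
  proof (intro allI impI)
    fix y m assume y: "agree (U \<union> {..<n}) y e'"
    have "agree (U \<union> {..<n}) (\<lambda>i. p i (y i)) e" using y pe by (simp add: agree_def)
    then obtain a where a: "a \<in> D j" "agree (U \<union> {..<m}) a (\<lambda>i. p i (y i))"
      using D(2)[of j] unfolding dense_at_def by blast
    define z where "z i = (if a i = p i (y i) then y i else (SOME x. p i x = a i))" for i
    have "p i (z i) = a i" for i
    proof (cases "a i = p i (y i)")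
      case False
      have "\<exists>x. p i x = a i" using p[of i] by (metis surjD)
      from someI_ex[OF this] show ?thesis using False by (simp add: z_def)
    qed (simp add: z_def)
    then have "z \<in> D' j" using a(1) by (simp add: D'_def)
    moreover have "agree (U \<union> {..<m}) z y" using a(2) by (simp add: agree_def z_def)
    ultimately show "\<exists>a\<in>D' j. agree (U \<union> {..<m}) a y" by blast
  qed
  moreover have "(\<Inter>j. D' j) \<subseteq> {y. (\<lambda>i. p i (y i)) \<in> Q}" using D(3) unfolding D'_def by blast
  ultimately show ?thesis unfolding residual_def by blast
qed

text \<open>The pieces \<open>Y k\<close> are arbitrary sets, without any property of Baire. What
  category still yields is a stage \<open>k\<close> such that, once the next block is frozen and the
  sets in \<open>\<K>\<close> stay dense, \<open>Y k\<close> is non-meagre in every basic open part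
  of the remaining subspace.\<close>

lemma unkillable_stage:
  fixes Y :: "nat \<Rightarrow> (nat \<Rightarrow> 'v) set" and D :: "nat \<Rightarrow> (nat \<Rightarrow> 'v) set"
  assumes Y: "(\<Union>k. Y k) = UNIV" and U: "\<And>k. U k \<subseteq> U (Suc k)" and U0: "U 0 = {}"
    and D: "\<And>j. opn (D j)" "\<And>j e. dense_at {} e 0 (D j)"
  shows "\<exists>k e n. \<exists>\<K> :: nat \<Rightarrow> (nat \<Rightarrow> 'v) set.
    (\<forall>j. opn (\<K> j) \<and> dense_at (U k) e n (\<K> j)) \<and> range D \<subseteq> range \<K> \<and>
    (\<forall>e' n'. \<forall>K :: nat \<Rightarrow> (nat \<Rightarrow> 'v) set. agree (U k \<union> {..<n}) e' e \<and> n < n' \<and>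
      (\<forall>j. dense_at (U (Suc k)) e' n' (\<K> j)) \<and> (\<forall>N. opn (K N) \<and> dense_at (U (Suc k)) e' n' (K N)) \<longrightarrow>
      (\<exists>a\<in>Y k. agree (U (Suc k) \<union> {..<n'}) a e' \<and> (\<forall>N. a \<in> K N)))"
proof (rule ccontr)
  assume no: "\<not> ?thesis"
  \<comment> \<open>Otherwise every stage \<open>k\<close> can be avoided, and a fusion produces a point outside all \<open>Y k\<close>.\<close>
  define G where "G k e n \<K> \<longleftrightarrow> (\<forall>j. opn (\<K> j) \<and> dense_at (U k) e n (\<K> j)) \<and> range D \<subseteq> range \<K>"
    for k e n and \<K> :: "nat \<Rightarrow> (nat \<Rightarrow> 'v) set"
  define C where "C k e n \<K> e' n' K \<longleftrightarrow> agree (U k \<union> {..<n}) e' e \<and> n < n' \<and>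
      (\<forall>j. dense_at (U (Suc k)) e' n' (\<K> j)) \<and> (\<forall>N. opn (K N) \<and> dense_at (U (Suc k)) e' n' (K N))"
    for k e n and \<K> :: "nat \<Rightarrow> (nat \<Rightarrow> 'v) set" and e' n' and K :: "nat \<Rightarrow> (nat \<Rightarrow> 'v) set"
  define A where "A k e' n' K \<longleftrightarrow> (\<exists>a\<in>Y k. agree (U (Suc k) \<union> {..<n'}) a e' \<and> (\<forall>N. a \<in> K N))"
    for k e' n' and K :: "nat \<Rightarrow> (nat \<Rightarrow> 'v) set"
  have "\<not> (\<exists>k e n \<K>. G k e n \<K> \<and> (\<forall>e' n' K. C k e n \<K> e' n' K \<longrightarrow> A k e' n' K))"
    using no unfolding G_def C_def A_def by (simp only: conj_assoc not_False_eq_True)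
  then have kill: "\<exists>e' n' K. C k e n \<K> e' n' K \<and> \<not> A k e' n' K" if "G k e n \<K>" for k e n \<K>
    using that by blast
  \<comment> \<open>\<open>K k'\<close> is the countable family of dense open sets added for stage
    \<open>k'\<close>; \<open>K 0\<close> is \<open>D\<close>, and each other entry is the whole
    space until it is replaced.\<close>
  define P where "P = (\<lambda>k (e, n :: nat, K :: nat \<Rightarrow> nat \<Rightarrow> (nat \<Rightarrow> 'v) set).
    K 0 = D \<and> (\<forall>k' N. opn (K k' N) \<and> dense_at (U k) e n (K k' N)))"
  define R where "R = (\<lambda>k (e, n, K :: nat \<Rightarrow> nat \<Rightarrow> (nat \<Rightarrow> 'v) set) (e', n', K' :: nat \<Rightarrow> nat \<Rightarrow> (nat \<Rightarrow> 'v) set).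
    agree (U k \<union> {..<n}) e' e \<and> n < n' \<and> (\<forall>k'\<le>k. K' k' = K k') \<and>
    (\<forall>k'\<le>k. \<forall>N\<le>k. \<forall>b. agree {..<n'} b e' \<longrightarrow> b \<in> K k' N) \<and>
    (\<forall>a\<in>Y k. agree (U (Suc k) \<union> {..<n'}) a e' \<longrightarrow> \<not> (\<forall>N. a \<in> K' (Suc k) N)))"
  have "\<exists>f. \<forall>k. P k (f k) \<and> R k (f k) (f (Suc k))"
  proof (rule dependent_nat_choice)
    have "opn (UNIV :: (nat \<Rightarrow> 'v) set)" by (simp add: opn_def)
    moreover have "dense_at {} e 0 (UNIV :: (nat \<Rightarrow> 'v) set)" for e
      unfolding dense_at_def using agree_refl by blast
    ultimately show "\<exists>x. P 0 x"
      using D U0 by (intro exI[of _ "(undefined, 0, \<lambda>k. if k = 0 then D else (\<lambda>_. UNIV))"]) (simp add: P_def)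
  next
    fix x k assume Px: "P k x"
    obtain e n K where x: "x = (e, n, K)" using prod_cases3 by blast
    have K: "K 0 = D" "\<And>k' N. opn (K k' N)" "\<And>k' N. dense_at (U k) e n (K k' N)" using Px by (auto simp: P_def x)
    define \<K> where "\<K> j = (case prod_decode j of (k', N) \<Rightarrow> K k' N)" for j
    have \<K>p: "\<K> (prod_encode (k', N)) = K k' N" for k' N by (simp add: \<K>_def)
    have G1: "\<forall>j. opn (\<K> j) \<and> dense_at (U k) e n (\<K> j)" using K by (simp add: \<K>_def split: prod.split)
    have G2: "range D \<subseteq> range \<K>"
    proof
      fix d assume "d \<in> range D"
      then obtain N where "d = \<K> (prod_encode (0, N))" using \<K>p K(1) by auto
      then show "d \<in> range \<K>" by blast
    qed
    have "G k e n \<K>" unfolding G_def using G1 G2 by blast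
    then obtain e1 n1 and L :: "nat \<Rightarrow> (nat \<Rightarrow> 'v) set" where CA: "C k e n \<K> e1 n1 L" "\<not> A k e1 n1 L"
      using kill by blast
    have e1: "agree (U k \<union> {..<n}) e1 e" "n < n1"
      and \<K>1: "\<forall>j. dense_at (U (Suc k)) e1 n1 (\<K> j)" and L: "\<forall>N. opn (L N) \<and> dense_at (U (Suc k)) e1 n1 (L N)"
      using CA(1) unfolding C_def by blast+
    have dead: "\<forall>a\<in>Y k. agree (U (Suc k) \<union> {..<n1}) a e1 \<longrightarrow> \<not> (\<forall>N. a \<in> L N)"
      using CA(2) unfolding A_def by blast
    have K1: "dense_at (U (Suc k)) e1 n1 (K k' N)" for k' N using \<K>1 \<K>p by metis
    have "\<And>j. opn (\<K> j) \<and> dense_at (U (Suc k)) e1 n1 (\<K> j)" using \<K>1 K(2) by (simp add: \<K>_def split: prod.split)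
    then obtain a where a: "\<forall>j. a \<in> \<K> j" "agree (U (Suc k) \<union> {..<n1}) a e1"
      using baire[of \<K> "U (Suc k)" e1 n1 e1 n1] by auto
    have aK: "a \<in> K k' N" for k' N using a(1) \<K>p by metis
    \<comment> \<open>Bookkeeping: the condition is lengthened until it forces membership in all
      sets with both indices at most \<open>k\<close>, so that the limit lies in every promised
      set.\<close>
    have "\<forall>\<^sub>F m in sequentially. \<forall>p\<in>{..k} \<times> {..k}. \<forall>b. agree {..<m} b a \<longrightarrow> b \<in> K (fst p) (snd p)"
    proof (rule eventually_ball_finite)
      show "\<forall>p\<in>{..k} \<times> {..k}. \<forall>\<^sub>F m in sequentially. \<forall>b. agree {..<m} b a \<longrightarrow> b \<in> K (fst p) (snd p)"
      proof
        fix p assume "p \<in> {..k} \<times> {..k}"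
        obtain m where "\<forall>b. agree {..<m} b a \<longrightarrow> b \<in> K (fst p) (snd p)"
          using K(2)[of "fst p" "snd p"] aK unfolding opn_def by blast
        then have "\<forall>m'\<ge>m. \<forall>b. agree {..<m'} b a \<longrightarrow> b \<in> K (fst p) (snd p)" by (simp add: agree_def)
        then show "\<forall>\<^sub>F m in sequentially. \<forall>b. agree {..<m} b a \<longrightarrow> b \<in> K (fst p) (snd p)"
          unfolding eventually_sequentially by blast
      qed
    qed simp
    then obtain m where m: "\<And>m'. m' \<ge> m \<Longrightarrow> \<forall>p\<in>{..k} \<times> {..k}. \<forall>b. agree {..<m'} b a \<longrightarrow> b \<in> K (fst p) (snd p)"
      unfolding eventually_sequentially by blast
    define n2 where "n2 = max m n1"
    have n2: "n1 \<le> n2" "n < n2" "m \<le> n2" using e1(2) by (simp_all add: n2_def)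
    define K2 where "K2 = K(Suc k := L)"
    have "P (Suc k) (a, n2, K2)"
      unfolding P_def K2_def using K L K1 dense_at_mono[OF _ a(2) n2(1)] by simp
    moreover have "R k x (a, n2, K2)"
    proof -
      have "agree (U k \<union> {..<n}) a e1" by (rule agree_mono[OF a(2)]) (use U[of k] e1(2) in auto)
      then have 1: "agree (U k \<union> {..<n}) a e" using e1(1) agree_trans by blast
      have 2: "b \<in> K k' N" if "k' \<le> k" "N \<le> k" "agree {..<n2} b a" for k' N b
        using m[OF n2(3)] that by (metis SigmaI atMost_iff fst_conv snd_conv)
      have 3: "\<not> (\<forall>N. b \<in> L N)" if "b \<in> Y k" "agree (U (Suc k) \<union> {..<n2}) b a" for b
      proof -
        have "agree (U (Suc k) \<union> {..<n1}) b a" by (rule agree_mono[OF that(2)]) (use n2 in auto)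
        then have "agree (U (Suc k) \<union> {..<n1}) b e1" using a(2) agree_trans by blast
        then show ?thesis using dead that(1) by blast
      qed
      show ?thesis unfolding R_def x prod.case using 1 2 3 n2(2) by (simp add: K2_def)
    qed
    ultimately show "\<exists>y. P (Suc k) y \<and> R k x y" by blast
  qed
  then obtain f where f: "\<And>k. P k (f k)" "\<And>k. R k (f k) (f (Suc k))" by blast
  define e where "e k = fst (f k)" for k
  define n where "n k = fst (snd (f k))" for k
  define K where "K k = snd (snd (f k))" for k
  have fk: "f k = (e k, n k, K k)" for k by (simp add: e_def n_def K_def)
  have R: "agree (U k \<union> {..<n k}) (e (Suc k)) (e k)" "n k < n (Suc k)"
    "\<And>k'. k' \<le> k \<Longrightarrow> K (Suc k) k' = K k k'"
    "\<And>k' N b. k' \<le> k \<Longrightarrow> N \<le> k \<Longrightarrow> agree {..<n (Suc k)} b (e (Suc k)) \<Longrightarrow> b \<in> K k k' N"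
    "\<And>a. a \<in> Y k \<Longrightarrow> agree (U (Suc k) \<union> {..<n (Suc k)}) a (e (Suc k)) \<Longrightarrow> \<not> (\<forall>N. a \<in> K (Suc k) (Suc k) N)" for k
    using f(2)[of k] unfolding R_def fk prod.case by simp_all
  have stable: "K l k = K k k" if "k \<le> l" for k l
    using that by (induction l rule: dec_induct) (simp_all add: R(3))
  obtain b where b: "\<And>k. agree (U k \<union> {..<n k}) b (e k)"
    using agree_limit[of U n e, OF R(1,2) U] by blast
  obtain k where k: "b \<in> Y k" using Y by blast
  have "b \<in> K (Suc k) (Suc k) N" for N
  proof -
    define l where "l = max (Suc k) N"
    have "b \<in> K l (Suc k) N"
      using R(4)[of "Suc k" l N b] b[of "Suc l"] by (simp add: l_def agree_Un)
    moreover have "K l (Suc k) = K (Suc k) (Suc k)" by (rule stable) (simp add: l_def)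
    ultimately show ?thesis by simp
  qed
  then show False using R(5)[OF k b[of "Suc k"]] by blast
qed

section \<open>Automorphisms of the power set modulo finite\<close>

lemma eq_mod_fin_iff: "eq_mod_fin S T \<longleftrightarrow> (\<forall>\<^sub>F n in cofinite. n \<in> S \<longleftrightarrow> n \<in> T)"
proof -
  have "{n. \<not> (n \<in> S \<longleftrightarrow> n \<in> T)} = (S - T) \<union> (T - S)" by blast
  then show ?thesis by (simp add: eq_mod_fin_def eventually_cofinite)
qed

text \<open>\<open>al\<close> selects a representative of the image of each class; hence Boolean
  identities are available only at cofinitely many coordinates.\<close>

locale pow_fin_lift =
  fixes al :: "nat set \<Rightarrow> nat set"
  assumes al_cong: "eq_mod_fin S T \<Longrightarrow> eq_mod_fin (al S) (al T)"
    and al_inj: "eq_mod_fin (al S) (al T) \<Longrightarrow> eq_mod_fin S T"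
    and al_surj: "\<exists>S. eq_mod_fin (al S) T"
    and al_Int: "\<forall>\<^sub>F n in cofinite. n \<in> al (S \<inter> T) \<longleftrightarrow> n \<in> al S \<and> n \<in> al T"
    and al_Compl: "\<forall>\<^sub>F n in cofinite. n \<in> al (- S) \<longleftrightarrow> n \<notin> al S"
begin

lemma al_Un: "\<forall>\<^sub>F n in cofinite. n \<in> al (S \<union> T) \<longleftrightarrow> n \<in> al S \<or> n \<in> al T"
proof -
  have e: "al (S \<union> T) = al (- (- S \<inter> - T))" by (rule arg_cong[of _ _ al]) blast
  show ?thesis unfolding e
    using al_Compl[of "- S \<inter> - T"] al_Int[of "- S" "- T"] al_Compl[of S] al_Compl[of T]
    by eventually_elim blast
qed

lemma al_mono: "S \<subseteq> T \<Longrightarrow> \<forall>\<^sub>F n in cofinite. n \<in> al S \<longrightarrow> n \<in> al T"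
proof -
  assume "S \<subseteq> T"
  then have "S \<inter> T = S" by blast
  with al_Int[of S T] show ?thesis by (auto elim: eventually_mono)
qed

lemma al_Diff: "\<forall>\<^sub>F n in cofinite. n \<in> al (S - T) \<longleftrightarrow> n \<in> al S \<and> n \<notin> al T"
  using al_Int[of S "- T"] al_Compl[of T] unfolding Diff_eq by eventually_elim auto

lemma al_empty: "\<forall>\<^sub>F n in cofinite. n \<notin> al {}"
  using al_Diff[of "{}" "{}"] by eventually_elim auto

lemma finite_al_iff: "finite (al S) \<longleftrightarrow> finite S"
proof -
  have fin0: "finite (al {})" using al_empty unfolding eventually_cofinite by simp
  show ?thesis
proof
  assume "finite (al S)"
  then have "eq_mod_fin (al S) (al {})" using fin0 by (simp add: eq_mod_fin_def)
  then have "eq_mod_fin S {}" by (rule al_inj)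
  then show "finite S" by (simp add: eq_mod_fin_def)
next
  assume "finite S"
  then have "eq_mod_fin S {}" by (simp add: eq_mod_fin_def)
  then have "eq_mod_fin (al S) (al {})" by (rule al_cong)
  then show "finite (al S)" unfolding eq_mod_fin_def using fin0 by (metis finite_Diff2 finite_Un)
qed
qed

section \<open>Continuity of the lifting on one block: representation by characters modulo
  two\<close>

lemma al_symdiff:
  assumes "\<And>n. n \<in> X \<longleftrightarrow> (n \<in> S \<longleftrightarrow> n \<notin> T)"
  shows "\<forall>\<^sub>F n in cofinite. n \<in> al X \<longleftrightarrow> (n \<in> al S \<longleftrightarrow> n \<notin> al T)"
proof -
  have "X = (S - T) \<union> (T - S)" using assms by blast
  show ?thesis unfolding \<open>X = _\<close> using al_Un[of "S - T" "T - S"] al_Diff[of S T] al_Diff[of T S]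
    by eventually_elim blast
qed

text \<open>Membership of \<open>a\<close> in \<open>Op k i \<epsilon>\<close> is a vote that the
  image of \<open>a\<close> contains \<open>i\<close> or not. For points of \<open>Y k\<close> votes
  are right by \<open>A1\<close>, and generic ones receive a vote by \<open>A2\<close>. Since votes
  are open in \<open>a\<close>, they approximate the lifting continuously; additivity makes the
  approximation affine on a basic open set. Its linear part is a continuous character on sets of
  coordinates, hence the parity of the intersection with a finite set.\<close>

lemma parity_representation:
  fixes Y :: "nat \<Rightarrow> (nat \<Rightarrow> bool) set" and Op :: "nat \<Rightarrow> nat \<Rightarrow> bool \<Rightarrow> (nat \<Rightarrow> bool) set"
    and D :: "nat \<Rightarrow> nat \<Rightarrow> (nat \<Rightarrow> bool) set" and B U :: "nat \<Rightarrow> nat set" and T :: "nat set"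
  assumes Y: "(\<Union>k. Y k) = UNIV" and U0: "U 0 = {}" and US: "\<And>k. U (Suc k) = U k \<union> B k"
    and disj: "\<And>k. U k \<inter> B k = {}" and BT: "\<And>k. B k \<subseteq> T"
    and Op: "\<And>k i \<epsilon>. opn (Op k i \<epsilon>)"
    and D: "\<And>k i. opn (D k i)" "\<And>k i e. dense_at {} e 0 (D k i)"
    and A1: "\<And>k a i \<epsilon>. a \<in> Y k \<Longrightarrow> i \<in> al T \<Longrightarrow> a \<in> Op k i \<epsilon> \<Longrightarrow> \<epsilon> \<longleftrightarrow> i \<in> al {j\<in>T. a j}"
    and A2: "\<And>k a i. a \<in> Y k \<Longrightarrow> a \<in> D k i \<Longrightarrow> i \<in> al T \<Longrightarrow> a \<in> Op k i (i \<in> al {j\<in>T. a j})"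
  shows "\<exists>k F m. (\<forall>i. finite (F i)) \<and> (\<forall>d \<subseteq> B k. d \<inter> {..<m} = {} \<longrightarrow>
    (\<forall>\<^sub>F i in cofinite. i \<in> al d \<longleftrightarrow> i \<in> al (B k) \<and> odd (card (d \<inter> F i))))"
proof -
  define D' where "D' j = (case prod_decode j of (k, i) \<Rightarrow> D k i)" for j
  have D'p: "D' (prod_encode (k, i)) = D k i" for k i by (simp add: D'_def)
  have D': "opn (D' j)" "dense_at {} e 0 (D' j)" for j e using D by (simp_all add: D'_def split: prod.split)
  have USu: "U k \<subseteq> U (Suc k)" for k using US by simp
  obtain k e n and \<K> :: "nat \<Rightarrow> (nat \<Rightarrow> bool) set" where
    \<K>: "\<forall>j. opn (\<K> j) \<and> dense_at (U k) e n (\<K> j)" and D\<K>: "range D' \<subseteq> range \<K>" and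
    unk: "\<forall>e' n'. \<forall>K :: nat \<Rightarrow> (nat \<Rightarrow> bool) set. agree (U k \<union> {..<n}) e' e \<and> n < n' \<and>
      (\<forall>j. dense_at (U (Suc k)) e' n' (\<K> j)) \<and> (\<forall>N. opn (K N) \<and> dense_at (U (Suc k)) e' n' (K N)) \<longrightarrow>
      (\<exists>a\<in>Y k. agree (U (Suc k) \<union> {..<n'}) a e' \<and> (\<forall>N. a \<in> K N))"
    using unkillable_stage[where Y=Y and U=U and D=D', OF Y USu U0 D'(1) D'(2)] by (elim exE conjE)
  define U' where "U' = U k \<union> B k"
  have U': "U (Suc k) = U'" by (simp add: U'_def US)
  \<comment> \<open>For generic \<open>c\<close> the promised sets remain dense after freezing
    \<open>U'\<close> to \<open>c\<close>, so that \<open>Y k\<close> is non-meagre over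
    \<open>c\<close>.\<close>
  define Q where "Q = {c. agree (U k \<union> {..<n}) c e \<longrightarrow> (\<forall>j. dense_at U' c n (\<K> j))}"
  have resQ: "residual (U k) e n Q"
  proof -
    have "residual (U k) e n {c. agree (U k \<union> {..<n}) c e \<longrightarrow> dense_at U' c n (\<K> j)}" for j
      unfolding U'_def using \<K> by (intro residual_section) auto
    then have "residual (U k) e n (\<Inter>j. {c. agree (U k \<union> {..<n}) c e \<longrightarrow> dense_at U' c n (\<K> j)})"
      by (rule residual_INT)
    then show ?thesis by (rule residual_mono) (auto simp: Q_def)
  qed
  define I where "I = al (B k) \<inter> al T"
  define cut where "cut c = {j \<in> B k. c j}" for c :: "nat \<Rightarrow> bool"
  have fromunk: "\<exists>a\<in>Y k. agree (U' \<union> {..<n'}) a e' \<and> (\<forall>N. a \<in> K N)"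
    if "c \<in> Q" "agree (U k \<union> {..<n}) c e" "agree (U' \<union> {..<n}) e' c" "n < n'"
      "\<And>N. opn (K N)" "\<And>N. dense_at U' e' n' (K N)" for c e' n' and K :: "nat \<Rightarrow> (nat \<Rightarrow> bool) set"
  proof -
    have "agree (U k \<union> {..<n}) e' c" by (rule agree_mono[OF that(3)]) (auto simp: U'_def)
    then have 1: "agree (U k \<union> {..<n}) e' e" using that(2) agree_trans by blast
    have "dense_at U' c n (\<K> j)" for j using that(1,2) by (simp add: Q_def)
    then have "dense_at U' e' n' (\<K> j)" for j using that(3,4) by (meson dense_at_mono less_imp_le)
    then show ?thesis using unk 1 that(4-6) unfolding U' by blast
  qed
  \<comment> \<open>\<open>D k i\<close> is still dense over \<open>c\<close>, hence meets
    \<open>Y k\<close> there, and \<open>A2\<close> supplies the vote.\<close>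
  have D1: "\<exists>\<epsilon>. \<exists>a\<in>Op k i \<epsilon>. agree (U' \<union> {..<m}) a e'"
    if c: "c \<in> Q" "agree (U k \<union> {..<n}) c e" "agree (U' \<union> {..<n}) e' c" and i: "i \<in> al T" for c e' m i
  proof -
    define n' where "n' = Suc (max m n)"
    obtain j where j: "D k i = \<K> j" using D\<K> D'p by (metis imageE rangeI subsetD)
    have "dense_at U' c n (\<K> j)" using c by (simp add: Q_def)
    then have "dense_at U' e' n' (D k i)" unfolding j by (rule dense_at_mono[OF _ c(3)]) (simp add: n'_def)
    moreover have nn: "n < n'" by (simp add: n'_def)
    ultimately have "\<exists>a\<in>Y k. agree (U' \<union> {..<n'}) a e' \<and> (\<forall>N :: nat. a \<in> D k i)"
      by (intro fromunk[OF c nn, of "\<lambda>_. D k i"] D(1))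
    then obtain a where a: "a \<in> Y k" "agree (U' \<union> {..<n'}) a e'" "a \<in> D k i" by blast
    have "agree (U' \<union> {..<m}) a e'" by (rule agree_mono[OF a(2)]) (auto simp: n'_def)
    then show ?thesis using A2[OF a(1,3) i] by blast
  qed
  \<comment> \<open>If wrong votes at arbitrarily large \<open>i\<close> were dense, a point of
    \<open>Y k\<close> over \<open>c\<close> would receive infinitely many of them. This contradicts
    \<open>A1\<close>, since the point equals \<open>c\<close> on \<open>B k\<close> and
    \<open>al\<close> respects intersections modulo finite.\<close>
  have D2: "\<exists>e'' m' N. agree (U' \<union> {..<m}) e'' e' \<and> m \<le> m' \<and>
      (\<forall>a. agree (U' \<union> {..<m'}) a e'' \<longrightarrow> (\<forall>i\<in>I. N \<le> i \<longrightarrow> a \<notin> Op k i (i \<notin> al (cut c))))"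
    if c: "c \<in> Q" "agree (U k \<union> {..<n}) c e" "agree (U' \<union> {..<n}) e' c" for c e' m
  proof (rule ccontr)
    assume neg: "\<not> ?thesis"
    define K where "K N = {a. \<exists>i\<in>I. N \<le> i \<and> a \<in> Op k i (i \<notin> al (cut c))}" for N
    define n' where "n' = Suc (max m n)"
    have opK: "opn (K N)" for N
      unfolding opn_def
    proof
      fix a assume "a \<in> K N"
      then obtain i where i: "i \<in> I" "N \<le> i" "a \<in> Op k i (i \<notin> al (cut c))" by (auto simp: K_def)
      obtain p where "\<forall>b. agree {..<p} b a \<longrightarrow> b \<in> Op k i (i \<notin> al (cut c))" using Op i(3) unfolding opn_def by blast
      then show "\<exists>p. \<forall>b. agree {..<p} b a \<longrightarrow> b \<in> K N" using i(1,2) unfolding K_def by blast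
    qed
    have dK: "dense_at U' e' n' (K N)" for N
      unfolding dense_at_def
    proof (intro allI impI)
      fix e'' m0 assume e'': "agree (U' \<union> {..<n'}) e'' e'"
      have e2: "agree (U' \<union> {..<m}) e'' e'" by (rule agree_mono[OF e'']) (auto simp: n'_def)
      have m2: "m \<le> max m0 m" by simp
      have "\<not> (\<forall>a. agree (U' \<union> {..<max m0 m}) a e'' \<longrightarrow> (\<forall>i\<in>I. N \<le> i \<longrightarrow> a \<notin> Op k i (i \<notin> al (cut c))))"
        using neg e2 m2 by blast
      then obtain a where a: "agree (U' \<union> {..<max m0 m}) a e''" "a \<in> K N" unfolding K_def by blast
      have "agree (U' \<union> {..<m0}) a e''" by (rule agree_mono[OF a(1)]) auto
      then show "\<exists>a\<in>K N. agree (U' \<union> {..<m0}) a e''" using a(2) by blast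
    qed
    have nn: "n < n'" by (simp add: n'_def)
    obtain a where a: "a \<in> Y k" "agree (U' \<union> {..<n'}) a e'" "\<forall>N. a \<in> K N"
      using fromunk[of c e' n' K, OF c nn opK dK] by blast
    have "{j\<in>T. a j} \<inter> B k = cut c"
    proof -
      have "a j = c j" if "j \<in> B k" for j using a(2) c(3) that by (auto simp: agree_def U'_def)
      then show ?thesis using BT by (auto simp: cut_def)
    qed
    then have "\<forall>\<^sub>F i in cofinite. i \<in> al (cut c) \<longleftrightarrow> i \<in> al {j\<in>T. a j} \<and> i \<in> al (B k)"
      using al_Int[of "{j\<in>T. a j}" "B k"] by simp
    then have "finite {i. \<not> (i \<in> al (cut c) \<longleftrightarrow> i \<in> al {j\<in>T. a j} \<and> i \<in> al (B k))}"
      by (simp only: eventually_cofinite)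
    then obtain N where N: "\<And>i. \<not> (i \<in> al (cut c) \<longleftrightarrow> i \<in> al {j\<in>T. a j} \<and> i \<in> al (B k)) \<Longrightarrow> i < N"
      unfolding finite_nat_set_iff_bounded by auto
    obtain i where i: "i \<in> I" "N \<le> i" "a \<in> Op k i (i \<notin> al (cut c))" using a(3) unfolding K_def by blast
    have "i \<in> al T" "i \<in> al (B k)" using i(1) by (simp_all add: I_def)
    then show False using A1[OF a(1) _ i(3)] N[of i] i(2) by auto
  qed
  define mix where "mix c x j = (if j \<in> U' then c j else x j)" for c x :: "nat \<Rightarrow> bool" and j
  define ex where "ex w j = (if j < length w then w ! j else e j)" for w j
  define adm where "adm w \<longleftrightarrow> n \<le> length w \<and> agree {..<n} (ex w) e" for w
  \<comment> \<open>Quantifying out the coordinates that are not frozen turns votes into an open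
    relation of \<open>c\<close> alone; the price is that both votes may be possible above the
    condition \<open>w\<close>.\<close>
  define V where "V c w i \<epsilon> \<longleftrightarrow> (\<exists>x. agree {..<length w} x (ex w) \<and> mix c x \<in> Op k i \<epsilon>)" for c w i \<epsilon>
  have Vopen: "\<exists>p. \<forall>c'. agree {..<p} c' c \<longrightarrow> V c' w i \<epsilon>" if V: "V c w i \<epsilon>" for c w i \<epsilon>
  proof -
    obtain x where x: "agree {..<length w} x (ex w)" "mix c x \<in> Op k i \<epsilon>" using V unfolding V_def by blast
    obtain p where p: "\<forall>b. agree {..<p} b (mix c x) \<longrightarrow> b \<in> Op k i \<epsilon>" using Op x(2) unfolding opn_def by blast
    have "V c' w i \<epsilon>" if "agree {..<p} c' c" for c'
    proof -
      have "agree {..<p} (mix c' x) (mix c x)" using that by (simp add: agree_def mix_def)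
      then show ?thesis using p x(1) unfolding V_def by blast
    qed
    then show ?thesis by blast
  qed
  have Vex: "\<exists>\<epsilon>. V c w i \<epsilon>" if c: "c \<in> Q" "agree (U k \<union> {..<n}) c e" and w: "adm w" and i: "i \<in> al T" for c w i
  proof -
    have "agree (U' \<union> {..<n}) (mix c (ex w)) c"
      using c(2) w by (auto simp: agree_def mix_def adm_def)
    from D1[OF c this i] obtain \<epsilon> a where a: "a \<in> Op k i \<epsilon>" "agree (U' \<union> {..<length w}) a (mix c (ex w))" by blast
    define x where "x j = (if j \<in> U' then ex w j else a j)" for j
    have "mix c x = a" using a(2) by (auto simp: mix_def x_def agree_def fun_eq_iff)
    moreover have "agree {..<length w} x (ex w)" using a(2) by (auto simp: x_def agree_def mix_def)
    ultimately show ?thesis using a(1) unfolding V_def by blast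
  qed
  \<comment> \<open>By \<open>D2\<close> a longer condition excludes wrong votes from some point on.
    The last conjunct allows what remains to be compared with the votes above \<open>w\<close>,
    which will be \<open>w1\<close>.\<close>
  have Vval: "\<exists>w' N. adm w' \<and> (\<forall>i\<in>I. N \<le> i \<longrightarrow> (\<forall>\<epsilon>. V c w' i \<epsilon> \<longrightarrow> (\<epsilon> \<longleftrightarrow> i \<in> al (cut c)) \<and> V c w i \<epsilon>))"
    if c: "c \<in> Q" "agree (U k \<union> {..<n}) c e" and w: "adm w" for c w
  proof -
    have ag: "agree (U' \<union> {..<n}) (mix c (ex w)) c"
      using c(2) w by (auto simp: agree_def mix_def adm_def)
    obtain e'' m' N where e'': "agree (U' \<union> {..<length w}) e'' (mix c (ex w))" "length w \<le> m'"
      "\<forall>a. agree (U' \<union> {..<m'}) a e'' \<longrightarrow> (\<forall>i\<in>I. N \<le> i \<longrightarrow> a \<notin> Op k i (i \<notin> al (cut c)))"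
      using D2[OF c ag, of "length w"] by blast
    define w' where "w' = map (\<lambda>j. if j \<in> U' then ex w j else e'' j) [0..<m']"
    have ex': "ex w' j = (if j \<in> U' then ex w j else e'' j)" if "j < m'" for j using that by (simp add: ex_def w'_def)
    have len: "length w' = m'" by (simp add: w'_def)
    have ww: "ex w' j = ex w j" if "j < length w" for j
      using that e''(1,2) ex'[of j] by (auto simp: agree_def mix_def)
    have nw: "n \<le> length w" using w by (simp add: adm_def)
    have "adm w'" using w ww e''(2) nw by (auto simp: adm_def len agree_def)
    moreover have "(\<epsilon> \<longleftrightarrow> i \<in> al (cut c)) \<and> V c w i \<epsilon>" if i: "i \<in> I" "N \<le> i" and V: "V c w' i \<epsilon>" for i \<epsilon>
    proof -
      obtain x where x: "agree {..<m'} x (ex w')" "mix c x \<in> Op k i \<epsilon>" using V unfolding V_def len by blast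
      have "agree (U' \<union> {..<m'}) (mix c x) e''"
        using x(1) ex' e''(1) by (auto simp: agree_def mix_def)
      then have "mix c x \<notin> Op k i (i \<notin> al (cut c))" using e''(3) i by blast
      then have "\<epsilon> \<longleftrightarrow> i \<in> al (cut c)" using x(2) by (cases "\<epsilon> \<longleftrightarrow> i \<in> al (cut c)") auto
      moreover have "agree {..<length w} x (ex w)" using x(1) ww e''(2) by (auto simp: agree_def)
      ultimately show ?thesis using x(2) unfolding V_def by blast
    qed
    ultimately show ?thesis by blast
  qed
  \<comment> \<open>Addition modulo two with origin \<open>e\<close>: the result agrees with
    \<open>e\<close> wherever both summands do, so it stays in the subspace.\<close>
  define pl where "pl c c' j \<longleftrightarrow> ((c j \<noteq> c' j) \<noteq> e j)" for c c' :: "nat \<Rightarrow> bool" and j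
  define \<kappa> where "\<kappa> i \<longleftrightarrow> i \<in> al (cut e)" for i
  \<comment> \<open>The open set of pairs for which some possible votes contradict additivity beyond
    \<open>N\<close>. Were it dense for all conditions and all \<open>N\<close>, a generic pair
    would violate additivity although its votes are eventually correct.\<close>
  define Viol where "Viol w1 w2 w3 N = {y :: nat \<Rightarrow> bool \<times> bool. \<exists>i\<in>I. N \<le> i \<and> (\<exists>\<epsilon>1 \<epsilon>2 \<epsilon>3. V (\<lambda>j. fst (y j)) w1 i \<epsilon>1 \<and>
    V (\<lambda>j. snd (y j)) w2 i \<epsilon>2 \<and> V (pl (\<lambda>j. fst (y j)) (\<lambda>j. snd (y j))) w3 i \<epsilon>3 \<and> ((\<epsilon>1 \<noteq> \<epsilon>2) \<noteq> \<epsilon>3) \<noteq> \<kappa> i)}" for w1 w2 w3 N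
  define e2 where "e2 j = (e j, e j)" for j
  have Violopen: "opn (Viol w1 w2 w3 N)" for w1 w2 w3 N
    unfolding opn_def
  proof
    fix y assume "y \<in> Viol w1 w2 w3 N"
    then obtain i \<epsilon>1 \<epsilon>2 \<epsilon>3 where i: "i \<in> I" "N \<le> i" "V (\<lambda>j. fst (y j)) w1 i \<epsilon>1"
      "V (\<lambda>j. snd (y j)) w2 i \<epsilon>2" "V (pl (\<lambda>j. fst (y j)) (\<lambda>j. snd (y j))) w3 i \<epsilon>3" "((\<epsilon>1 \<noteq> \<epsilon>2) \<noteq> \<epsilon>3) \<noteq> \<kappa> i"
      unfolding Viol_def by blast
    obtain p1 where p1: "\<And>c'. agree {..<p1} c' (\<lambda>j. fst (y j)) \<Longrightarrow> V c' w1 i \<epsilon>1" using Vopen[OF i(3)] by blast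
    obtain p2 where p2: "\<And>c'. agree {..<p2} c' (\<lambda>j. snd (y j)) \<Longrightarrow> V c' w2 i \<epsilon>2" using Vopen[OF i(4)] by blast
    obtain p3 where p3: "\<And>c'. agree {..<p3} c' (pl (\<lambda>j. fst (y j)) (\<lambda>j. snd (y j))) \<Longrightarrow> V c' w3 i \<epsilon>3" using Vopen[OF i(5)] by blast
    have "z \<in> Viol w1 w2 w3 N" if z: "agree {..<max p1 (max p2 p3)} z y" for z
    proof -
      have zy: "z j = y j" if "j < p1 \<or> j < p2 \<or> j < p3" for j
        using z that by (auto simp: agree_def less_max_iff_disj)
      have "V (\<lambda>j. fst (z j)) w1 i \<epsilon>1" using zy by (intro p1) (simp add: agree_def)
      moreover have "V (\<lambda>j. snd (z j)) w2 i \<epsilon>2" using zy by (intro p2) (simp add: agree_def)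
      moreover have "V (pl (\<lambda>j. fst (z j)) (\<lambda>j. snd (z j))) w3 i \<epsilon>3" using zy by (intro p3) (simp add: agree_def pl_def)
      ultimately show ?thesis using i(1,2,6) unfolding Viol_def by blast
    qed
    then show "\<exists>p. \<forall>z. agree {..<p} z y \<longrightarrow> z \<in> Viol w1 w2 w3 N" by blast
  qed
  have surjpl: "surj (\<lambda>b. (a \<noteq> b) \<noteq> c)" for a c :: bool by (cases a; cases c) (simp_all add: surj_def ex_bool_eq all_bool_eq)
  have "\<exists>w1 w2 w3 N. adm w1 \<and> adm w2 \<and> adm w3 \<and> \<not> dense_at (U k) e2 n (Viol w1 w2 w3 N)"
  proof (rule ccontr)
    assume neg: "\<not> ?thesis"
    define VV where "VV = (\<lambda>(w1, w2, w3, N). if adm w1 \<and> adm w2 \<and> adm w3 then Viol w1 w2 w3 N else UNIV)"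
    have "residual (U k) e2 n (VV q)" for q
    proof -
      obtain w1 w2 w3 N where q: "q = (w1, w2, w3, N)" by (metis prod_cases4)
      have "opn (UNIV :: (nat \<Rightarrow> bool \<times> bool) set)" "dense_at (U k) e2 n (UNIV :: (nat \<Rightarrow> bool \<times> bool) set)"
        using agree_refl unfolding opn_def dense_at_def by blast+
      then show ?thesis using neg Violopen unfolding q VV_def by (auto intro!: residual_open_dense)
    qed
    then have r1: "residual (U k) e2 n (\<Inter>j. VV (from_nat j))" by (rule residual_INT)
    have r2: "residual (U k) e2 n {y. (\<lambda>j. fst (y j)) \<in> Q}"
      by (rule residual_pullback[OF resQ, of "\<lambda>_. fst"]) (auto simp: e2_def)
    have r3: "residual (U k) e2 n {y. (\<lambda>j. snd (y j)) \<in> Q}"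
      by (rule residual_pullback[OF resQ, of "\<lambda>_. snd"]) (auto simp: e2_def)
    have r4: "residual (U k) e2 n {y. (\<lambda>j. (fst (y j) \<noteq> snd (y j)) \<noteq> e j) \<in> Q}"
    proof (rule residual_pullback[OF resQ, of "\<lambda>j z. (fst z \<noteq> snd z) \<noteq> e j"])
      show "surj (\<lambda>z :: bool \<times> bool. (fst z \<noteq> snd z) \<noteq> e i)" for i
        by (cases "e i") (auto simp: surj_def ex_bool_eq all_bool_eq)
    qed (auto simp: e2_def)
    from residual_ex[OF residual_Int[OF residual_Int[OF r1 r2] residual_Int[OF r3 r4]], of e2 n]
    obtain y where y: "y \<in> (\<Inter>j. VV (from_nat j))" "(\<lambda>j. fst (y j)) \<in> Q" "(\<lambda>j. snd (y j)) \<in> Q"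
      "(\<lambda>j. (fst (y j) \<noteq> snd (y j)) \<noteq> e j) \<in> Q" "agree (U k \<union> {..<n}) y e2" by auto
    define c1 where "c1 = (\<lambda>j. fst (y j))"
    define c2 where "c2 = (\<lambda>j. snd (y j))"
    define c3 where "c3 = pl c1 c2"
    have cQ: "c1 \<in> Q" "c2 \<in> Q" "c3 \<in> Q" using y by (simp_all add: c1_def c2_def c3_def pl_def[abs_def])
    have ce: "agree (U k \<union> {..<n}) c1 e" "agree (U k \<union> {..<n}) c2 e" "agree (U k \<union> {..<n}) c3 e"
      using y(5) by (auto simp: c1_def c2_def c3_def pl_def agree_def e2_def)
    define w where "w = map e [0..<n]"
    have w: "adm w" by (simp add: adm_def w_def ex_def agree_def)
    obtain w1 N1 where w1: "adm w1" "\<And>i \<epsilon>. i \<in> I \<Longrightarrow> N1 \<le> i \<Longrightarrow> V c1 w1 i \<epsilon> \<Longrightarrow> \<epsilon> \<longleftrightarrow> i \<in> al (cut c1)" using Vval[OF cQ(1) ce(1) w] by blast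
    obtain w2 N2 where w2: "adm w2" "\<And>i \<epsilon>. i \<in> I \<Longrightarrow> N2 \<le> i \<Longrightarrow> V c2 w2 i \<epsilon> \<Longrightarrow> \<epsilon> \<longleftrightarrow> i \<in> al (cut c2)" using Vval[OF cQ(2) ce(2) w] by blast
    obtain w3 N3 where w3: "adm w3" "\<And>i \<epsilon>. i \<in> I \<Longrightarrow> N3 \<le> i \<Longrightarrow> V c3 w3 i \<epsilon> \<Longrightarrow> \<epsilon> \<longleftrightarrow> i \<in> al (cut c3)" using Vval[OF cQ(3) ce(3) w] by blast
    define s where "s = {j \<in> B k. c1 j \<noteq> c2 j}"
    have "\<forall>\<^sub>F i in cofinite. i \<in> al s \<longleftrightarrow> (i \<in> al (cut c1) \<longleftrightarrow> i \<notin> al (cut c2))"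
      by (rule al_symdiff) (auto simp: s_def cut_def)
    moreover have "\<forall>\<^sub>F i in cofinite. i \<in> al (cut c3) \<longleftrightarrow> (i \<in> al s \<longleftrightarrow> i \<notin> al (cut e))"
      by (rule al_symdiff) (auto simp: s_def cut_def c3_def pl_def)
    ultimately have "\<forall>\<^sub>F i in cofinite. (((i \<in> al (cut c1)) \<noteq> (i \<in> al (cut c2))) \<noteq> (i \<in> al (cut c3))) = \<kappa> i"
      unfolding \<kappa>_def by eventually_elim auto
    then have "finite {i. \<not> ((((i \<in> al (cut c1)) \<noteq> (i \<in> al (cut c2))) \<noteq> (i \<in> al (cut c3))) = \<kappa> i)}"
      by (simp only: eventually_cofinite)
    then obtain N4 where N4: "\<And>i. (((i \<in> al (cut c1)) \<noteq> (i \<in> al (cut c2))) \<noteq> (i \<in> al (cut c3))) \<noteq> \<kappa> i \<Longrightarrow> i < N4"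
      unfolding finite_nat_set_iff_bounded by auto
    define N where "N = max (max N1 N2) (max N3 N4)"
    have "y \<in> VV (from_nat (to_nat (w1, w2, w3, N)))" using y(1) by blast
    then have "y \<in> Viol w1 w2 w3 N" using w1 w2 w3 by (simp add: VV_def)
    then obtain i \<epsilon>1 \<epsilon>2 \<epsilon>3 where i: "i \<in> I" "N \<le> i" "V c1 w1 i \<epsilon>1" "V c2 w2 i \<epsilon>2" "V c3 w3 i \<epsilon>3" "((\<epsilon>1 \<noteq> \<epsilon>2) \<noteq> \<epsilon>3) \<noteq> \<kappa> i"
      unfolding Viol_def c1_def c2_def c3_def by blast
    have "N1 \<le> i" "N2 \<le> i" "N3 \<le> i" "N4 \<le> i" using i(2) by (simp_all add: N_def)
    then show False using w1(2)[OF i(1) _ i(3)] w2(2)[OF i(1) _ i(4)] w3(2)[OF i(1) _ i(5)] N4[of i] i(6) by auto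
  qed
  then obtain w1 w2 w3 N where w: "adm w1" "adm w2" "adm w3" and nd: "\<not> dense_at (U k) e2 n (Viol w1 w2 w3 N)" by blast
  obtain y m0 where y: "agree (U k \<union> {..<n}) y e2" "\<And>a. a \<in> Viol w1 w2 w3 N \<Longrightarrow> \<not> agree (U k \<union> {..<m0}) a y"
    using nd unfolding dense_at_def by blast
  define M where "M = max m0 n"
  define t1 where "t1 = (\<lambda>j. fst (y j))"
  define t2 where "t2 = (\<lambda>j. snd (y j))"
  have te: "agree (U k \<union> {..<n}) t1 e" "agree (U k \<union> {..<n}) t2 e" using y(1) by (auto simp: t1_def t2_def e2_def agree_def)
  \<comment> \<open>On the basic open set given by \<open>t1\<close>, \<open>t2\<close> and
    \<open>M\<close>, additivity holds exactly for \<open>i\<close> from \<open>N\<close> on, no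
    longer just modulo finite.\<close>
  have NV: "((\<epsilon>1 \<noteq> \<epsilon>2) \<noteq> \<epsilon>3) = \<kappa> i"
    if "agree (U k \<union> {..<M}) c1 t1" "agree (U k \<union> {..<M}) c2 t2" "i \<in> I" "N \<le> i"
      "V c1 w1 i \<epsilon>1" "V c2 w2 i \<epsilon>2" "V (pl c1 c2) w3 i \<epsilon>3" for c1 c2 i \<epsilon>1 \<epsilon>2 \<epsilon>3
  proof (rule ccontr)
    assume ne: "((\<epsilon>1 \<noteq> \<epsilon>2) \<noteq> \<epsilon>3) \<noteq> \<kappa> i"
    define z where "z j = (c1 j, c2 j)" for j
    have "z \<in> Viol w1 w2 w3 N" unfolding Viol_def z_def using that(3-7) ne
      by (intro CollectI bexI[of _ i] conjI exI[of _ \<epsilon>1] exI[of _ \<epsilon>2] exI[of _ \<epsilon>3]) simp_all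
    moreover have "agree (U k \<union> {..<m0}) z y"
      using that(1,2) by (auto simp: agree_def z_def t1_def t2_def M_def less_max_iff_disj prod_eq_iff)
    ultimately show False using y(2) by blast
  qed
  define good where "good c \<longleftrightarrow> c \<in> Q \<and> agree (U k \<union> {..<M}) c t1" for c
  have goode: "agree (U k \<union> {..<n}) c e" if "agree (U k \<union> {..<M}) c t" "agree (U k \<union> {..<n}) t e" for c t
    using that by (auto simp: agree_def M_def less_max_iff_disj)
  have res_pl: "residual (U k) e n {c'. pl c c' \<in> Q}" if "agree (U k \<union> {..<n}) c e" for c
    unfolding pl_def[abs_def] by (rule residual_pullback[OF resQ, where p="\<lambda>j b. (c j \<noteq> b) \<noteq> e j"])
      (use surjpl that in \<open>auto simp: agree_def\<close>)
  define sh where "sh d c j \<longleftrightarrow> c j \<noteq> (j \<in> d)" for d :: "nat set" and c j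
  have res_sh: "residual (U k) e n {c. sh d c \<in> Q}" if "d \<inter> (U k \<union> {..<n}) = {}" for d
  proof -
    have "surj (\<lambda>b. b \<noteq> (i \<in> d))" for i by (cases "i \<in> d") (simp_all add: surj_def ex_bool_eq all_bool_eq)
    then show ?thesis unfolding sh_def[abs_def]
      by (intro residual_pullback[OF resQ, where p="\<lambda>j b. b \<noteq> (j \<in> d)"]) (use that in auto)
  qed
  have IT: "i \<in> al T" if "i \<in> I" for i using that by (simp add: I_def)
  \<comment> \<open>A generic second summand and the sum have a vote each, and by additivity these
    two determine the vote of \<open>c\<close>.\<close>
  have uniq: "\<epsilon> = \<epsilon>'" if c: "good c" and i: "i \<in> I" "N \<le> i" and V: "V c w1 i \<epsilon>" "V c w1 i \<epsilon>'" for c i \<epsilon> \<epsilon>'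
  proof -
    have ce: "agree (U k \<union> {..<n}) c e" using c goode te(1) good_def by blast
    obtain c2 where c2: "c2 \<in> Q" "pl c c2 \<in> Q" "agree (U k \<union> {..<M}) c2 t2"
      using residual_ex[OF residual_Int[OF resQ res_pl[OF ce]] te(2), of M] by blast
    have c2e: "agree (U k \<union> {..<n}) c2 e" using c2(3) goode te(2) by blast
    have "agree (U k \<union> {..<n}) (pl c c2) e" using ce c2e by (auto simp: agree_def pl_def)
    then obtain \<epsilon>2 \<epsilon>3 where "V c2 w2 i \<epsilon>2" "V (pl c c2) w3 i \<epsilon>3"
      using Vex[OF c2(1) c2e w(2) IT[OF i(1)]] Vex[OF c2(2) _ w(3) IT[OF i(1)]] by blast
    then have "((\<epsilon> \<noteq> \<epsilon>2) \<noteq> \<epsilon>3) = \<kappa> i" "((\<epsilon>' \<noteq> \<epsilon>2) \<noteq> \<epsilon>3) = \<kappa> i"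
      using NV c c2(3) i V unfolding good_def by blast+
    then show ?thesis by auto
  qed
  define g where "g i c \<longleftrightarrow> V c w1 i True" for i c
  have gV: "V c w1 i \<epsilon> \<longleftrightarrow> (\<epsilon> \<longleftrightarrow> g i c)" if c: "good c" and i: "i \<in> I" "N \<le> i" for c i \<epsilon>
  proof -
    have ce: "agree (U k \<union> {..<n}) c e" using c goode te(1) good_def by blast
    obtain \<epsilon>' where "V c w1 i \<epsilon>'" using Vex[OF _ ce w(1) IT[OF i(1)]] c good_def by blast
    then show ?thesis using uniq[OF c i] unfolding g_def by (cases \<epsilon>; cases \<epsilon>') auto
  qed
  have small: "d \<inter> (U k \<union> {..<n}) = {}" if "d \<inter> (U k \<union> {..<M}) = {}" for d using that by (auto simp: M_def)
  have sh_agree: "agree (U k \<union> {..<M}) (sh d c) t" if "agree (U k \<union> {..<M}) c t" "d \<inter> (U k \<union> {..<M}) = {}" for d c t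
    using that by (auto simp: agree_def sh_def)
  \<comment> \<open>Hence the change of \<open>g i\<close> under a shift by \<open>d\<close> depends only on \<open>d\<close>.\<close>
  have indep: "(g i c \<noteq> g i (sh d c)) = (g i c' \<noteq> g i (sh d c'))"
    if c: "good c" "good (sh d c)" "good c'" "good (sh d c')" and d: "d \<inter> (U k \<union> {..<M}) = {}" and i: "i \<in> I" "N \<le> i" for c c' d i
  proof -
    have ce: "agree (U k \<union> {..<n}) c e" "agree (U k \<union> {..<n}) c' e" using c goode te(1) good_def by blast+
    obtain c2 where c2: "c2 \<in> Q" "sh d c2 \<in> Q" "pl c c2 \<in> Q" "pl c' c2 \<in> Q" "agree (U k \<union> {..<M}) c2 t2"
      using residual_ex[OF residual_Int[OF residual_Int[OF resQ res_sh[OF small[OF d]]] residual_Int[OF res_pl[OF ce(1)] res_pl[OF ce(2)]]] te(2), of M]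
      by blast
    have c2': "agree (U k \<union> {..<M}) (sh d c2) t2" using sh_agree c2(5) d by blast
    have c2e: "agree (U k \<union> {..<n}) c2 e" "agree (U k \<union> {..<n}) (sh d c2) e" using c2(5) c2' goode te(2) by blast+
    obtain \<epsilon>2 \<epsilon>2' where e2: "V c2 w2 i \<epsilon>2" "V (sh d c2) w2 i \<epsilon>2'"
      using Vex[OF c2(1) c2e(1) w(2) IT[OF i(1)]] Vex[OF c2(2) c2e(2) w(2) IT[OF i(1)]] by blast
    have main: "(g i x \<noteq> g i (sh d x)) = (\<epsilon>2 \<noteq> \<epsilon>2')" if x: "good x" "good (sh d x)" "pl x c2 \<in> Q" for x
    proof -
      have xe: "agree (U k \<union> {..<n}) x e" using x goode te(1) good_def by blast
      have "agree (U k \<union> {..<n}) (pl x c2) e" using xe c2e by (auto simp: agree_def pl_def)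
      then obtain \<epsilon>3 where e3: "V (pl x c2) w3 i \<epsilon>3" using Vex[OF x(3) _ w(3) IT[OF i(1)]] by blast
      have sp: "pl (sh d x) (sh d c2) = pl x c2" by (auto simp: pl_def sh_def fun_eq_iff)
      have "((g i x \<noteq> \<epsilon>2) \<noteq> \<epsilon>3) = \<kappa> i"
        using NV[OF _ c2(5) i _ e2(1) e3, of "g i x"] x(1) gV[OF x(1) i] good_def by blast
      moreover have "((g i (sh d x) \<noteq> \<epsilon>2') \<noteq> \<epsilon>3) = \<kappa> i"
        using NV[OF _ c2' i _ e2(2), of "sh d x" "g i (sh d x)" \<epsilon>3] x(2) gV[OF x(2) i] good_def e3 unfolding sp by blast
      ultimately show ?thesis by auto
    qed
    show ?thesis using main[OF c(1,2) c2(3)] main[OF c(3,4) c2(4)] by simp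
  qed
  \<comment> \<open>The linear part of the affine map \<open>g i\<close>.\<close>
  define L where "L i d \<longleftrightarrow> (\<exists>c. good c \<and> good (sh d c) \<and> g i c \<noteq> g i (sh d c))" for i d
  have Lg: "L i d \<longleftrightarrow> g i c \<noteq> g i (sh d c)"
    if "good c" "good (sh d c)" "d \<inter> (U k \<union> {..<M}) = {}" "i \<in> I" "N \<le> i" for c d i
    using indep[OF _ _ that(1,2) that(3-5)] that(1,2) unfolding L_def by blast
  have L_add: "L i (d \<union> d') \<longleftrightarrow> L i d \<noteq> L i d'"
    if d: "d \<inter> (U k \<union> {..<M}) = {}" "d' \<inter> (U k \<union> {..<M}) = {}" "d \<inter> d' = {}" and i: "i \<in> I" "N \<le> i" for d d' i
  proof -
    have dd: "(d \<union> d') \<inter> (U k \<union> {..<M}) = {}" using d by blast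
    obtain c where c: "c \<in> Q" "sh d c \<in> Q" "sh (d \<union> d') c \<in> Q" "agree (U k \<union> {..<M}) c t1"
      using residual_ex[OF residual_Int[OF resQ residual_Int[OF res_sh[OF small[OF d(1)]] res_sh[OF small[OF dd]]]] te(1), of M] by blast
    have s: "sh d' (sh d c) = sh (d \<union> d') c" using d(3) by (auto simp: sh_def fun_eq_iff)
    have gd: "good c" "good (sh d c)" "good (sh (d \<union> d') c)" using c sh_agree d dd by (simp_all add: good_def)
    show ?thesis
      using Lg[OF gd(1,2) d(1) i] Lg[OF gd(1,3) dd i] Lg[of "sh d c" d' i] gd d(2) i unfolding s by auto
  qed
  \<comment> \<open>Votes are open, so \<open>g i\<close> is constant near \<open>c0\<close>; a
    generic point near \<open>c0\<close> can be shifted by a late \<open>d\<close> without leaving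
    this neighbourhood.\<close>
  have L_cont: "\<exists>p. \<forall>d. d \<inter> (U k \<union> {..<M}) = {} \<and> d \<inter> {..<p} = {} \<longrightarrow> \<not> L i d" if i: "i \<in> I" "N \<le> i" for i
  proof -
    obtain c0 where c0: "c0 \<in> Q" "agree (U k \<union> {..<M}) c0 t1" using residual_ex[OF resQ te(1), of M] by blast
    then have c0g: "good c0" and c0e: "agree (U k \<union> {..<n}) c0 e" using goode te(1) by (auto simp: good_def)
    obtain p where p: "\<And>c. agree {..<p} c c0 \<Longrightarrow> V c w1 i (g i c0)"
      using Vopen[of c0 w1 i "g i c0"] gV[OF c0g i] by blast
    have "\<not> L i d" if d: "d \<inter> (U k \<union> {..<M}) = {}" "d \<inter> {..<p} = {}" for d
    proof -
      obtain c where c: "c \<in> Q" "sh d c \<in> Q" "agree (U k \<union> {..<max M p}) c c0"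
        using residual_ex[OF residual_Int[OF resQ res_sh[OF small[OF d(1)]]] c0e, of "max M p"] by blast
      have "agree (U k \<union> {..<M}) c c0" "agree {..<p} c c0" by (rule agree_mono[OF c(3)], auto)+
      then have cc: "agree (U k \<union> {..<M}) c t1" "agree {..<p} c c0" using c0(2) agree_trans by blast+
      then have gd: "good c" "good (sh d c)" using c sh_agree d(1) by (simp_all add: good_def)
      have "agree {..<p} (sh d c) c0" using cc(2) d(2) by (auto simp: agree_def sh_def)
      then have "g i c = g i c0" "g i (sh d c) = g i c0"
        using p cc(2) gV[OF gd(1) i, of "g i c0"] gV[OF gd(2) i, of "g i c0"] by simp_all
      then show ?thesis using Lg[OF gd d(1) i] by simp
    qed
    then show ?thesis by blast
  qed
  then obtain p where p: "\<And>i d. i \<in> I \<Longrightarrow> N \<le> i \<Longrightarrow> d \<inter> (U k \<union> {..<M}) = {} \<Longrightarrow> d \<inter> {..<p i} = {} \<Longrightarrow> \<not> L i d" by metis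
  define F where "F i = (if i \<in> I \<and> N \<le> i then {j. j < p i \<and> L i {j}} else {})" for i
  have finF: "finite (F i)" for i by (simp add: F_def)
  have L_fin: "L i d \<longleftrightarrow> odd (card {j \<in> d. L i {j}})"
    if "finite d" "d \<inter> (U k \<union> {..<M}) = {}" and i: "i \<in> I" "N \<le> i" for d i
    using that(1,2)
  proof (induction d rule: finite_induct)
    case empty
    have "L i ({} \<union> {}) \<longleftrightarrow> L i {} \<noteq> L i {}" by (rule L_add) (use i in auto)
    then show ?case by simp
  next
    case (insert x d)
    have "L i ({x} \<union> d) \<longleftrightarrow> L i {x} \<noteq> L i d" by (rule L_add) (use insert i in auto)
    moreover have "{j \<in> insert x d. L i {j}} = (if L i {x} then insert x {j \<in> d. L i {j}} else {j \<in> d. L i {j}})" by auto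
    ultimately show ?case using insert by simp
  qed
  have L_par: "L i d \<longleftrightarrow> odd (card (d \<inter> F i))" if d: "d \<inter> (U k \<union> {..<M}) = {}" and i: "i \<in> I" "N \<le> i" for d i
  proof -
    have "L i ((d \<inter> {..<p i}) \<union> (d - {..<p i})) \<longleftrightarrow> L i (d \<inter> {..<p i}) \<noteq> L i (d - {..<p i})"
      by (rule L_add) (use d i in auto)
    moreover have "\<not> L i (d - {..<p i})" by (rule p) (use d i in auto)
    moreover have "(d \<inter> {..<p i}) \<union> (d - {..<p i}) = d" by blast
    ultimately have "L i d \<longleftrightarrow> L i (d \<inter> {..<p i})" by simp
    also have "\<dots> \<longleftrightarrow> odd (card {j \<in> d \<inter> {..<p i}. L i {j}})" by (rule L_fin) (use d i in auto)
    also have "{j \<in> d \<inter> {..<p i}. L i {j}} = d \<inter> F i" using i by (auto simp: F_def)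
    finally show ?thesis .
  qed
  \<comment> \<open>The eventually correct votes from \<open>Vval\<close> are possible above
    \<open>w1\<close> as well, and there the vote of a good point is unique.\<close>
  have evg: "\<forall>\<^sub>F i in cofinite. i \<in> I \<longrightarrow> (i \<in> al (cut c) \<longleftrightarrow> g i c)" if c: "good c" for c
  proof -
    have ce: "agree (U k \<union> {..<n}) c e" using c goode te(1) good_def by blast
    have cQ: "c \<in> Q" using c good_def by blast
    obtain w' N' where w': "adm w'" "\<And>i \<epsilon>. i \<in> I \<Longrightarrow> N' \<le> i \<Longrightarrow> V c w' i \<epsilon> \<Longrightarrow> (\<epsilon> \<longleftrightarrow> i \<in> al (cut c)) \<and> V c w1 i \<epsilon>"
      using Vval[OF cQ ce w(1)] by blast
    have "i \<in> al (cut c) \<longleftrightarrow> g i c" if i: "i \<in> I" "max N N' \<le> i" for i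
    proof -
      obtain \<epsilon> where "V c w' i \<epsilon>" using Vex[OF cQ ce w'(1) IT[OF i(1)]] by blast
      then have "(\<epsilon> \<longleftrightarrow> i \<in> al (cut c)) \<and> V c w1 i \<epsilon>" using w'(2) i by simp
      then show ?thesis using gV[OF c i(1), of \<epsilon>] i(2) by auto
    qed
    then have "{i. \<not> (i \<in> I \<longrightarrow> (i \<in> al (cut c) \<longleftrightarrow> g i c))} \<subseteq> {..<max N N'}" using not_le by blast
    then show ?thesis unfolding eventually_cofinite using finite_subset finite_lessThan by blast
  qed
  have "\<forall>\<^sub>F i in cofinite. i \<in> al d \<longleftrightarrow> i \<in> al (B k) \<and> odd (card (d \<inter> F i))" if d: "d \<subseteq> B k" "d \<inter> {..<M} = {}" for d
  proof -
    have dU: "d \<inter> (U k \<union> {..<M}) = {}" using d disj[of k] by blast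
    obtain c where c: "c \<in> Q" "sh d c \<in> Q" "agree (U k \<union> {..<M}) c t1"
      using residual_ex[OF residual_Int[OF resQ res_sh[OF small[OF dU]]] te(1), of M] by blast
    have gd: "good c" "good (sh d c)" using c sh_agree dU by (simp_all add: good_def)
    \<comment> \<open>A shift by \<open>d\<close> changes the trace on the block by exactly
      \<open>d\<close>, so the image of \<open>d\<close> is the difference of two values of
      \<open>g\<close>.\<close>
    have 1: "\<forall>\<^sub>F i in cofinite. i \<in> al d \<longleftrightarrow> (i \<in> al (cut c) \<longleftrightarrow> i \<notin> al (cut (sh d c)))"
      by (rule al_symdiff) (use d(1) in \<open>auto simp: cut_def sh_def\<close>)
    have 2: "\<forall>\<^sub>F i in cofinite. N \<le> i"
      unfolding eventually_cofinite by (rule finite_subset[of _ "{..<N}"]) auto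
    have "B k \<inter> T = B k" using BT by blast
    then have 3: "\<forall>\<^sub>F i in cofinite. i \<in> al (B k) \<longrightarrow> i \<in> I" using al_mono[OF BT[of k]]
      by eventually_elim (simp add: I_def)
    show ?thesis using 1 2 3 evg[OF gd(1)] evg[OF gd(2)] al_mono[OF d(1)]
    proof eventually_elim
      case (elim i)
      show ?case
      proof (cases "i \<in> al (B k)")
        case True
        then have i: "i \<in> I" "N \<le> i" using elim by blast+
        show ?thesis using elim True i Lg[OF gd dU i] L_par[OF dU i] by auto
      qed (use elim in blast)
    qed
  qed
  then show ?thesis using finF by blast
qed



section \<open>Sets on which the lifting is induced pointwise\<close>

definition triv :: "nat set \<Rightarrow> bool" where
  "triv A \<longleftrightarrow> (\<exists>h :: nat \<Rightarrow> nat. \<forall>c \<subseteq> A. eq_mod_fin (al c) (h ` c))"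

text \<open>If infinitely many supports had two points each, an infinite disjoint subfamily would
  allow one point per support to be selected in two disjoint ways: two disjoint sets whose images
  share infinitely many coordinates. So almost all supports are singletons, given by a map
  \<open>f\<close>, and a section \<open>h\<close> of \<open>f\<close> induces
  \<open>al\<close>.\<close>

lemma parity_imp_triv:
  assumes fin: "\<And>i. finite (F i)"
    and par: "\<And>d. d \<subseteq> B \<Longrightarrow> d \<inter> {..<m} = {} \<Longrightarrow>
      \<forall>\<^sub>F i in cofinite. i \<in> al d \<longleftrightarrow> i \<in> al B \<and> odd (card (d \<inter> F i))"
  shows "triv B"
proof -
  define I where "I = al B"
  define Q where "Q = B - {..<m}"
  define G where "G i = F i \<inter> Q" for i
  have P: "\<forall>\<^sub>F i in cofinite. i \<in> al d \<longleftrightarrow> i \<in> I \<and> odd (card (d \<inter> G i))" if "d \<subseteq> Q" for d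
  proof -
    have "d \<inter> F i = d \<inter> G i" for i using that by (auto simp: G_def)
    moreover have "d \<subseteq> B" "d \<inter> {..<m} = {}" using that by (auto simp: Q_def)
    ultimately show ?thesis using par[of d] by (simp add: I_def)
  qed
  have finG: "finite (G i)" for i using fin by (simp add: G_def)
  \<comment> \<open>\<open>al {n}\<close> is finite, so a point lies in only finitely many
    supports.\<close>
  have s1: "finite {i \<in> I. n \<in> G i}" if "n \<in> Q" for n
  proof -
    have "finite (al {n})" by (simp add: finite_al_iff)
    then have "\<forall>\<^sub>F i in cofinite. i \<notin> al {n}" by (simp add: eventually_cofinite)
    moreover have "\<forall>\<^sub>F i in cofinite. i \<in> al {n} \<longleftrightarrow> i \<in> I \<and> odd (card ({n} \<inter> G i))" using P[of "{n}"] that by simp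
    ultimately have "\<forall>\<^sub>F i in cofinite. \<not> (i \<in> I \<and> n \<in> G i)"
    proof eventually_elim
      case (elim i)
      show ?case
      proof
        assume "i \<in> I \<and> n \<in> G i"
        moreover from this have "{n} \<inter> G i = {n}" by blast
        ultimately show False using elim by simp
      qed
    qed
    then show ?thesis unfolding eventually_cofinite by simp
  qed
  have "eq_mod_fin Q B" unfolding eq_mod_fin_def Q_def by (rule finite_subset[of _ "{..<m}"]) auto
  then have alQ: "\<forall>\<^sub>F i in cofinite. i \<in> al Q \<longleftrightarrow> i \<in> I" using al_cong unfolding eq_mod_fin_iff I_def by blast
  \<comment> \<open>\<open>Q\<close> as a whole is sent to almost all of \<open>I\<close>, so almost
    all supports are odd and in particular nonempty.\<close>
  have s2a: "\<forall>\<^sub>F i in cofinite. i \<in> I \<longrightarrow> odd (card (G i))"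
  proof -
    have "Q \<inter> G i = G i" for i by (auto simp: G_def)
    then have "\<forall>\<^sub>F i in cofinite. i \<in> al Q \<longleftrightarrow> i \<in> I \<and> odd (card (G i))" using P[of Q] by simp
    then show ?thesis using alQ by eventually_elim blast
  qed
  have s2b: "finite {i \<in> I. card (G i) \<ge> 2}"
  proof (rule ccontr)
    assume inf: "infinite {i \<in> I. card (G i) \<ge> 2}"
    define L where "L = {i \<in> I. card (G i) \<ge> 2}"
    have infL: "infinite L" using inf by (simp add: L_def)
    have finL: "finite {y \<in> L. G x \<inter> G y \<noteq> {} \<or> G y \<inter> G x \<noteq> {}}" if "x \<in> L" for x
    proof (rule finite_subset)
      show "{y \<in> L. G x \<inter> G y \<noteq> {} \<or> G y \<inter> G x \<noteq> {}} \<subseteq> (\<Union>n\<in>G x. {i \<in> I. n \<in> G i})" by (auto simp: L_def)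
      show "finite (\<Union>n\<in>G x. {i \<in> I. n \<in> G i})" using finG s1 by (intro finite_UN_I) (auto simp: G_def)
    qed
    obtain L' where L': "L' \<subseteq> L" "infinite L'" "\<And>x y. x \<in> L' \<Longrightarrow> y \<in> L' \<Longrightarrow> x \<noteq> y \<Longrightarrow> \<not> G x \<inter> G y \<noteq> {}"
      using infinite_independent_subset[where R="\<lambda>x y. G x \<inter> G y \<noteq> {}", OF infL finL] by blast
    have "\<exists>p q. p \<in> G i \<and> q \<in> G i \<and> p \<noteq> q" if "i \<in> L'" for i
    proof -
      have "2 \<le> card (G i)" using that L'(1) by (auto simp: L_def)
      then show ?thesis by (metis card_le_Suc0_iff_eq finG not_less_eq_eq numeral_2_eq_2)
    qed
    then obtain p q where pq: "\<And>i. i \<in> L' \<Longrightarrow> p i \<in> G i \<and> q i \<in> G i \<and> p i \<noteq> q i" by metis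
    have dis: "i = j" if "i \<in> L'" "j \<in> L'" "x \<in> G i" "x \<in> G j" for i j x using L'(3)[OF that(1,2)] that(3,4) by blast
    have sub: "p ` L' \<subseteq> Q" "q ` L' \<subseteq> Q" using pq by (auto simp: G_def)
    have "p ` L' \<inter> G i = {p i} \<and> q ` L' \<inter> G i = {q i}" if i: "i \<in> L'" for i
      using pq dis i by blast
    then have card: "odd (card (p ` L' \<inter> G i)) \<and> odd (card (q ` L' \<inter> G i))" if "i \<in> L'" for i using that by simp
    have LI: "i \<in> I" if "i \<in> L'" for i using that L'(1) by (auto simp: L_def)
    have "p i \<noteq> q j" if ij: "i \<in> L'" "j \<in> L'" for i j
    proof
      assume e: "p i = q j"
      then have "i = j" using dis[OF ij, of "p i"] pq[OF ij(1)] pq[OF ij(2)] by simp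
      then show False using pq[OF ij(1)] e by simp
    qed
    then have "p ` L' \<inter> q ` L' = {}" by blast
    then have "\<forall>\<^sub>F i in cofinite. i \<in> al {} \<longleftrightarrow> i \<in> al (p ` L') \<and> i \<in> al (q ` L')"
      using al_Int[of "p ` L'" "q ` L'"] by simp
    then have "\<forall>\<^sub>F i in cofinite. \<not> (i \<in> al (p ` L') \<and> i \<in> al (q ` L'))"
      using al_empty by eventually_elim blast
    then have "\<forall>\<^sub>F i in cofinite. i \<notin> L'"
      using P[OF sub(1)] P[OF sub(2)] by eventually_elim (use card LI in blast)
    then show False using L'(2) by (simp add: eventually_cofinite)
  qed
  define I1 where "I1 = {i \<in> I. card (G i) = 1}"
  have II1: "\<forall>\<^sub>F i in cofinite. i \<in> I \<longleftrightarrow> i \<in> I1"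
  proof -
    have "\<forall>\<^sub>F i in cofinite. \<not> (i \<in> I \<and> card (G i) \<ge> 2)" using s2b unfolding eventually_cofinite by simp
    then show ?thesis using s2a
    proof eventually_elim
      case (elim i)
      have "card (G i) = 1" if "odd (card (G i))" "\<not> card (G i) \<ge> 2" using that by presburger
      then show ?case using elim by (auto simp: I1_def)
    qed
  qed
  define f where "f i = (THE n. G i = {n})" for i
  have f: "G i = {f i}" if i1: "i \<in> I1" for i
  proof -
    have "card (G i) = 1" using i1 by (simp add: I1_def)
    then obtain n where "G i = {n}" by (rule card_1_singletonE)
    then show ?thesis by (simp add: f_def)
  qed
  have fQ: "f i \<in> Q" if "i \<in> I1" for i using f[OF that] by (auto simp: G_def)
  have al_d: "\<forall>\<^sub>F i in cofinite. i \<in> al d \<longleftrightarrow> i \<in> I1 \<and> f i \<in> d" if "d \<subseteq> Q" for d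
    using P[OF that] II1
  proof eventually_elim
    case (elim i)
    have "odd (card (d \<inter> G i)) \<longleftrightarrow> f i \<in> d" if "i \<in> I1" using f[OF that] by (cases "f i \<in> d") auto
    then show ?case using elim by blast
  qed
  define h where "h n = (SOME i. i \<in> I1 \<and> f i = n)" for n
  have h: "h n \<in> I1 \<and> f (h n) = n" if "\<exists>i\<in>I1. f i = n" for n
  proof -
    have "\<exists>i. i \<in> I1 \<and> f i = n" using that by blast
    then show ?thesis unfolding h_def by (rule someI_ex)
  qed
  define N0 where "N0 = {n \<in> Q. \<not> (\<exists>i\<in>I1. f i = n)}"
  have "finite N0"
  proof -
    have "\<forall>\<^sub>F i in cofinite. i \<in> al N0 \<longleftrightarrow> i \<in> I1 \<and> f i \<in> N0" by (rule al_d) (auto simp: N0_def)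
    then have "\<forall>\<^sub>F i in cofinite. i \<notin> al N0" by eventually_elim (auto simp: N0_def)
    then have "finite (al N0)" by (simp add: eventually_cofinite)
    then show ?thesis by (simp add: finite_al_iff)
  qed
  \<comment> \<open>By surjectivity of \<open>al\<close>, \<open>D\<close> is a preimage under
    \<open>f\<close> up to a finite set \<open>X\<close>. As \<open>h\<close> picks a point outside
    \<open>D\<close> from each fibre, every fibre meeting \<open>D\<close> meets \<open>X\<close>;
    and fibres are finite.\<close>
  define D where "D = {i \<in> I1. h (f i) \<noteq> i}"
  have "finite D"
  proof -
    obtain S0 where S0: "eq_mod_fin (al S0) D" using al_surj by blast
    define d where "d = S0 \<inter> Q"
    have "\<forall>\<^sub>F i in cofinite. i \<in> D \<longleftrightarrow> i \<in> I1 \<and> f i \<in> d"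
    proof -
      have "\<forall>\<^sub>F i in cofinite. i \<in> al d \<longleftrightarrow> i \<in> I1 \<and> f i \<in> d" by (rule al_d) (auto simp: d_def)
      then show ?thesis using S0[unfolded eq_mod_fin_iff] al_Int[of S0 Q, folded d_def] alQ II1
        by eventually_elim (auto simp: D_def)
    qed
    then have finX: "finite {i. \<not> (i \<in> D \<longleftrightarrow> i \<in> I1 \<and> f i \<in> d)}" by (simp only: eventually_cofinite)
    define X where "X = {i. \<not> (i \<in> D \<longleftrightarrow> i \<in> I1 \<and> f i \<in> d)}"
    have "D \<subseteq> X \<union> (\<Union>n\<in>f ` X \<inter> Q. {i \<in> I. n \<in> G i})"
    proof
      fix i assume i: "i \<in> D"
      show "i \<in> X \<union> (\<Union>n\<in>f ` X \<inter> Q. {i \<in> I. n \<in> G i})"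
      proof (cases "i \<in> X")
        case False
        then have i1: "i \<in> I1" "f i \<in> d" using i by (auto simp: X_def)
        define j where "j = h (f i)"
        have j: "j \<in> I1" "f j = f i" using h[of "f i"] i1(1) by (auto simp: j_def)
        then have "h (f j) = j" by (simp add: j_def)
        then have "j \<notin> D" by (simp add: D_def)
        then have "j \<in> X" using j i1(2) by (simp add: X_def)
        then have "f i \<in> f ` X \<inter> Q" using j(2) fQ[OF i1(1)] by (metis IntI imageI)
        moreover have "i \<in> I" "f i \<in> G i" using i1(1) f[OF i1(1)] by (auto simp: I1_def)
        ultimately show ?thesis by blast
      qed simp
    qed
    moreover have "finite (X \<union> (\<Union>n\<in>f ` X \<inter> Q. {i \<in> I. n \<in> G i}))"
      using finX s1 unfolding X_def[symmetric] by (intro finite_UnI finite_UN_I) auto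
    ultimately show ?thesis using finite_subset by blast
  qed
  have "eq_mod_fin (al c) (h ` c)" if c: "c \<subseteq> B" for c
  proof -
    define d where "d = c \<inter> Q"
    have "eq_mod_fin c d" unfolding eq_mod_fin_def d_def Q_def
      by (rule finite_subset[of _ "{..<m}"]) (use c in auto)
    then have 1: "\<forall>\<^sub>F i in cofinite. i \<in> al c \<longleftrightarrow> i \<in> al d" using al_cong unfolding eq_mod_fin_iff by blast
    have 2: "\<forall>\<^sub>F i in cofinite. i \<in> al d \<longleftrightarrow> i \<in> I1 \<and> f i \<in> d" by (rule al_d) (auto simp: d_def)
    define E where "E = D \<union> h ` N0 \<union> h ` (c \<inter> {..<m})"
    have "finite E" using \<open>finite D\<close> \<open>finite N0\<close> by (simp add: E_def)
    then have 3: "\<forall>\<^sub>F i in cofinite. i \<notin> E" by (simp add: eventually_cofinite)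
    have "\<forall>\<^sub>F i in cofinite. i \<in> al c \<longleftrightarrow> i \<in> h ` c" using 1 2 3
    proof eventually_elim
      case (elim i)
      show ?case
      proof
        assume "i \<in> al c"
        then have i: "i \<in> I1" "f i \<in> d" using elim by blast+
        then have "h (f i) = i" using elim by (auto simp: E_def D_def)
        then show "i \<in> h ` c" using i(2) by (metis IntE d_def imageI)
      next
        assume "i \<in> h ` c"
        then obtain n where n: "n \<in> c" "i = h n" by blast
        then have "n \<notin> {..<m}" using elim by (auto simp: E_def)
        then have nd: "n \<in> d" using n c by (auto simp: d_def Q_def)
        have "n \<notin> N0" using n elim by (auto simp: E_def)
        then have "\<exists>i\<in>I1. f i = n" using nd by (auto simp: N0_def d_def)
        then show "i \<in> al c" using h[of n] n nd elim by simp
      qed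
    qed
    then show ?thesis by (simp add: eq_mod_fin_iff)
  qed
  then show ?thesis unfolding triv_def by blast
qed

text \<open>The points are pairs of a branch \<open>z\<close> and a subset \<open>a\<close> of it.
  The colour asks for two subsets that are compatible on the finite common part of their branches
  but have images disagreeing inside the images of both branches. For a clique, the image of the
  union \<open>C\<close> would uniformize all these images. For a cover, points of the same piece on
  other branches approximate those over \<open>z\<close> and supply the votes for
  \<open>parity_representation\<close>.\<close>

lemma branch_triv:
  fixes \<tau> :: "nat \<Rightarrow> bool list \<times> nat" and Z :: "(nat \<Rightarrow> bool) set"
  assumes "OCA" and Z: "uncountable Z" and lev: "\<And>m. finite {i. length (fst (\<tau> i)) \<le> m}"
  shows "\<exists>z\<in>Z. \<exists>k. triv {i. \<tau> i = (map z [0..<length (fst (\<tau> i))], k)}"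
proof -
  define len where "len i = length (fst (\<tau> i))" for i
  define T where "T z = {i. fst (\<tau> i) = map z [0..<len i]}" for z
  have Tcong: "i \<in> T z' \<longleftrightarrow> i \<in> T z" if "\<And>j. j < len i \<Longrightarrow> z' j = z j" for i z z'
  proof -
    have "map z' [0..<len i] = map z [0..<len i]" using that by simp
    then show ?thesis unfolding T_def mem_Collect_eq by (simp only:)
  qed
  have TT: "len i \<le> j" if "i \<in> T z" "i \<in> T w" "z j \<noteq> w j" for i j z w
  proof (rule ccontr)
    assume "\<not> len i \<le> j"
    moreover have "map z [0..<len i] = map w [0..<len i]" using that by (simp add: T_def)
    ultimately show False using that(3) unfolding map_upt_eq_iff by auto
  qed
  have lev': "\<exists>p. \<forall>i. len i \<le> m \<longrightarrow> i < p" for m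
    using lev[of m] unfolding finite_nat_set_iff_bounded len_def by auto
  have finTT: "\<exists>p. \<forall>i. i \<in> T z \<and> i \<in> T w \<longrightarrow> i < p" if zw: "z \<noteq> w" for z w
  proof -
    obtain j where "z j \<noteq> w j" using zw by blast
    then show ?thesis using lev'[of j] TT by blast
  qed
  define S where "S = {(z, a). z \<in> Z \<and> a \<subseteq> T z}"
  \<comment> \<open>Coding the images of \<open>T z\<close> and of \<open>a\<close> makes the
    disagreement in \<open>K\<close> an open condition.\<close>
  define e where "e = (\<lambda>(z, a) i. to_nat (z i, i \<in> a, i \<in> al (T z), i \<in> al a))"
  have e: "e (z, a) i = e (w, b) i \<longleftrightarrow> z i = w i \<and> (i \<in> a \<longleftrightarrow> i \<in> b) \<and> (i \<in> al (T z) \<longleftrightarrow> i \<in> al (T w)) \<and> (i \<in> al a \<longleftrightarrow> i \<in> al b)" for z a w b i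
    by (simp add: e_def)
  define K where "K = (\<lambda>(z, a) (w, b). z \<noteq> w \<and> a \<inter> T w = b \<inter> T z \<and>
    (\<exists>i. i \<in> al (T z) \<and> i \<in> al (T w) \<and> (i \<in> al a \<longleftrightarrow> i \<notin> al b)))"
  show ?thesis
  proof (rule OCA_dichotomy[OF \<open>OCA\<close>, of e S K])
    show "inj_on e S"
    proof (rule inj_onI)
      fix x y assume "e x = e y"
      obtain z a w b where xy: "x = (z, a)" "y = (w, b)" by fastforce
      have "e (z, a) i = e (w, b) i" for i using \<open>e x = e y\<close> xy by simp
      then have "z i = w i" "i \<in> a \<longleftrightarrow> i \<in> b" for i unfolding e by blast+
      then show "x = y" unfolding xy by auto
    qed
    show "K y x" if "K x y" for x y using that unfolding K_def by (auto split: prod.splits)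
    show "\<not> K x x" for x by (simp add: K_def split: prod.splits)
    show "\<exists>n. \<forall>x'\<in>S. \<forall>y'\<in>S. (\<forall>i<n. e x' i = e x i) \<and> (\<forall>i<n. e y' i = e y i) \<longrightarrow> K x' y'" if k: "K x y" for x y
    proof -
      obtain z a w b where xy: "x = (z, a)" "y = (w, b)" by fastforce
      obtain i where i: "z \<noteq> w" "a \<inter> T w = b \<inter> T z" "i \<in> al (T z)" "i \<in> al (T w)" "i \<in> al a \<longleftrightarrow> i \<notin> al b"
        using k unfolding K_def xy by auto
      obtain j where j: "z j \<noteq> w j" using i(1) by blast
      \<comment> \<open>All coordinates of level at most \<open>j\<close>, and with them the common
        part of any two branches that differ at \<open>j\<close>, lie below
        \<open>p\<close>.\<close>
      obtain p where p: "\<And>i. len i \<le> j \<Longrightarrow> i < p" using lev'[of j] by blast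
      define n where "n = max (Suc j) (max p (Suc i))"
      show ?thesis
      proof (intro exI[of _ n] ballI impI)
        fix x' y' assume S': "x' \<in> S" "y' \<in> S" and eq: "(\<forall>i<n. e x' i = e x i) \<and> (\<forall>i<n. e y' i = e y i)"
        obtain z' a' w' b' where xy': "x' = (z', a')" "y' = (w', b')" by fastforce
        have E: "z' l = z l \<and> (l \<in> a' \<longleftrightarrow> l \<in> a) \<and> (l \<in> al (T z') \<longleftrightarrow> l \<in> al (T z)) \<and> (l \<in> al a' \<longleftrightarrow> l \<in> al a)"
          "w' l = w l \<and> (l \<in> b' \<longleftrightarrow> l \<in> b) \<and> (l \<in> al (T w') \<longleftrightarrow> l \<in> al (T w)) \<and> (l \<in> al b' \<longleftrightarrow> l \<in> al b)" if "l < n" for l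
          using eq that unfolding xy xy' e by blast+
        have jn: "j < n" "i < n" "p \<le> n" by (auto simp: n_def)
        have j': "z' j \<noteq> w' j" using E[OF jn(1)] j by simp
        have sub: "a' \<subseteq> T z'" "b' \<subseteq> T w'" using S' xy' by (auto simp: S_def)
        have small: "l < n \<and> (l \<in> T z) \<and> l \<in> T w" if "l \<in> T z'" "l \<in> T w'" for l
        proof -
          have l: "len l \<le> j" using TT[OF that j'] .
          then have "l < n" using p[of l] jn(3) by simp
          moreover have "l \<in> T z' \<longleftrightarrow> l \<in> T z" "l \<in> T w' \<longleftrightarrow> l \<in> T w"
            using l jn(1) E by (intro Tcong; simp)+
          ultimately show ?thesis using that by blast
        qed
        have "a' \<inter> T w' = b' \<inter> T z'"
        proof (rule set_eqI)
          fix l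
          show "l \<in> a' \<inter> T w' \<longleftrightarrow> l \<in> b' \<inter> T z'"
          proof (cases "l \<in> T z' \<and> l \<in> T w'")
            case True
            then have "l < n" "l \<in> T z" "l \<in> T w" using small by blast+
            then show ?thesis using True E[of l] i(2) by blast
          qed (use sub in blast)
        qed
        then show "K x' y'" unfolding K_def xy' using j' E[OF jn(2)] i(3-5) by auto
      qed
    qed
  next
    fix H assume H: "H \<subseteq> S" "uncountable H" "\<And>x y. x \<in> H \<Longrightarrow> y \<in> H \<Longrightarrow> x \<noteq> y \<Longrightarrow> K x y"
    define C where "C = \<Union> (snd ` H)"
    have C: "C \<inter> T z = a" if za: "(z, a) \<in> H" for z a
    proof
      show "a \<subseteq> C \<inter> T z" using za H(1) unfolding C_def S_def by force
      show "C \<inter> T z \<subseteq> a"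
      proof
        fix x assume x: "x \<in> C \<inter> T z"
        then obtain w b where wb: "(w, b) \<in> H" "x \<in> b" unfolding C_def by auto
        show "x \<in> a"
        proof (cases "(w, b) = (z, a)")
          case False
          then have "K (z, a) (w, b)" using H(3) za wb(1) by blast
          then have "a \<inter> T w = b \<inter> T z" by (simp add: K_def)
          then show ?thesis using x wb(2) by blast
        qed (use wb in simp)
      qed
    qed
    have "\<exists>n. \<forall>i\<ge>n. i \<in> al (snd x) \<longleftrightarrow> i \<in> al C \<and> i \<in> al (T (fst x))" if "x \<in> H" for x
    proof -
      have "C \<inter> T (fst x) = snd x" using C[of "fst x" "snd x"] that by simp
      then have "finite {i. \<not> (i \<in> al (snd x) \<longleftrightarrow> i \<in> al C \<and> i \<in> al (T (fst x)))}"
        using al_Int[of C "T (fst x)"] unfolding eventually_cofinite by simp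
      then obtain n where "\<And>i. \<not> (i \<in> al (snd x) \<longleftrightarrow> i \<in> al C \<and> i \<in> al (T (fst x))) \<Longrightarrow> i < n"
        unfolding finite_nat_set_iff_bounded by auto
      then show ?thesis by (intro exI[of _ n]) (meson not_less)
    qed
    then obtain N where N: "\<And>x i. x \<in> H \<Longrightarrow> N x \<le> i \<Longrightarrow> i \<in> al (snd x) \<longleftrightarrow> i \<in> al C \<and> i \<in> al (T (fst x))" by metis
    \<comment> \<open>Pigeonhole on the bound and on the image below it; above the bound both images
      are read off from \<open>al C\<close>.\<close>
    define f where "f x = (N x, map (\<lambda>i. i \<in> al (snd x)) [0..<N x])" for x
    have "\<not> inj_on f H"
    proof
      assume "inj_on f H"
      then show False using H(2) countable_image_inj_on[of f H] countableI_type by blast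
    qed
    then obtain x y where xy: "x \<in> H" "y \<in> H" "x \<noteq> y" "f x = f y" unfolding inj_on_def by blast
    have Nxy: "N x = N y" "\<And>i. i < N x \<Longrightarrow> i \<in> al (snd x) \<longleftrightarrow> i \<in> al (snd y)"
      using xy(4) by (auto simp: f_def)
    obtain i where i: "i \<in> al (T (fst x))" "i \<in> al (T (fst y))" "i \<in> al (snd x) \<longleftrightarrow> i \<notin> al (snd y)"
      using H(3)[OF xy(1-3)] unfolding K_def by (auto simp: split_beta)
    then have False using N[OF xy(1), of i] N[OF xy(2), of i] Nxy by (cases "i < N x") auto
    then show ?thesis ..
  next
    fix Y :: "nat \<Rightarrow> ((nat \<Rightarrow> bool) \<times> nat set) set"
    assume Y: "S = (\<Union>n. Y n)" "\<And>n x y. x \<in> Y n \<Longrightarrow> y \<in> Y n \<Longrightarrow> \<not> K x y"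
    define inf where "inf l z a = map (\<lambda>i. (i \<in> al (T z), i \<in> al a)) [0..<l]" for l z a
    have inf: "inf l z a = inf l w b \<longleftrightarrow> (\<forall>i<l. (i \<in> al (T z) \<longleftrightarrow> i \<in> al (T w)) \<and> (i \<in> al a \<longleftrightarrow> i \<in> al b))" for l z a w b
      unfolding inf_def map_upt_eq_iff by simp
    \<comment> \<open>The points of \<open>Y k\<close> over \<open>z\<close> that no other branch approximates; they are harmless, since they
      are nowhere dense for all but countably many \<open>z\<close>.\<close>
    define E where "E z k l = {a. (z, a) \<in> Y k \<and>
      \<not> (\<exists>w b. (w, b) \<in> Y k \<and> w \<noteq> z \<and> inf l w b = inf l z a \<and> a \<inter> T w = b \<inter> T z)}" for z k l
    define tr where "tr z a = {j \<in> T z. a j}" for z and a :: "nat \<Rightarrow> bool"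
    \<comment> \<open>An interior, hence dense exactly if the points without approximation are
      nowhere dense. With \<open>Suc i\<close> the information compared includes coordinate
      \<open>i\<close>.\<close>
    define D where "D z k i = {a. \<exists>p. \<forall>b. agree {..<p} b a \<longrightarrow> tr z b \<notin> E z k (Suc i)}" for z k i
    have Dopen: "opn (D z k i)" for z k i
      unfolding opn_def
    proof
      fix a assume "a \<in> D z k i"
      then obtain p where p: "\<And>b. agree {..<p} b a \<Longrightarrow> tr z b \<notin> E z k (Suc i)" unfolding D_def by blast
      have "b \<in> D z k i" if "agree {..<p} b a" for b
        unfolding D_def using p that agree_trans by blast
      then show "\<exists>n. \<forall>b. agree {..<n} b a \<longrightarrow> b \<in> D z k i" by blast
    qed
    \<comment> \<open>\<open>q\<close> describes an eventually false point together with the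
      information \<open>t\<close> of unapproximated points accumulating there. Two branches sharing
      \<open>q\<close> would have such points that coincide on the finite common part, hence
      approximate each other. So \<open>q\<close> determines the branch, and there are countably
      many bad branches.\<close>
    define bad where "bad z = (\<lambda>(k, l, m, s, t). \<forall>p. \<exists>b. agree {..<p} b (\<lambda>j. j < m \<and> s ! j) \<and> tr z b \<in> E z k l \<and> inf l z (tr z b) = t)"
      for z and q :: "nat \<times> nat \<times> nat \<times> bool list \<times> (bool \<times> bool) list"
    have badD: "\<exists>q. bad z q" if nd: "\<not> dense_at {} e0 0 (D z k i)" for z k i e0
    proof (rule ccontr)
      assume nb: "\<not> ?thesis"
      obtain e1 m where em: "\<And>a. a \<in> D z k i \<Longrightarrow> \<not> agree {..<m} a e1" using nd unfolding dense_at_def by auto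
      define s where "s = map e1 [0..<m]"
      define a0 where "a0 = (\<lambda>j. j < m \<and> s ! j)"
      have "agree {..<m} a0 e1" by (simp add: agree_def a0_def s_def)
      then have a0: "a0 \<notin> D z k i" using em by blast
      \<comment> \<open>Finitely many informations have this length, so if none of them accumulates
        at \<open>a0\<close>, one neighbourhood avoids them all.\<close>
      define ts where "ts = {t :: (bool \<times> bool) list. set t \<subseteq> UNIV \<and> length t = Suc i}"
      have fts: "finite ts" unfolding ts_def by (rule finite_lists_length_eq) simp
      have "\<exists>p. \<forall>b. agree {..<p} b a0 \<longrightarrow> \<not> (tr z b \<in> E z k (Suc i) \<and> inf (Suc i) z (tr z b) = t)" for t
      proof -
        have "\<not> bad z (k, Suc i, m, s, t)" using nb by blast
        then show ?thesis unfolding bad_def a0_def prod.case by blast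
      qed
      then obtain P where P: "\<And>t b. agree {..<P t} b a0 \<Longrightarrow> \<not> (tr z b \<in> E z k (Suc i) \<and> inf (Suc i) z (tr z b) = t)" by metis
      define p where "p = Max (P ` ts)"
      have "tr z b \<notin> E z k (Suc i)" if b: "agree {..<p} b a0" for b
      proof -
        define t where "t = inf (Suc i) z (tr z b)"
        have "t \<in> ts" by (simp add: ts_def t_def inf_def)
        then have "P t \<le> p" using fts by (simp add: p_def)
        then have "agree {..<P t} b a0" using b by (auto simp: agree_def)
        then show ?thesis using P t_def by blast
      qed
      then show False using a0 unfolding D_def by blast
    qed
    have badinj: "z = w" if q: "bad z q" "bad w q" for z w q
    proof (rule ccontr)
      assume zw: "z \<noteq> w"
      obtain k l m s t where qe: "q = (k, l, m, s, t)" by (metis prod_cases5)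
      obtain p where p: "\<And>i. i \<in> T z \<and> i \<in> T w \<Longrightarrow> i < p" using finTT[OF zw] by blast
      obtain a b where a: "agree {..<p} a (\<lambda>j. j < m \<and> s ! j)" "tr z a \<in> E z k l" "inf l z (tr z a) = t"
        and b: "agree {..<p} b (\<lambda>j. j < m \<and> s ! j)" "tr w b \<in> E w k l" "inf l w (tr w b) = t"
        using q unfolding bad_def qe prod.case by blast
      have "tr z a \<inter> T w = tr w b \<inter> T z"
        using p a(1) b(1) by (auto simp: tr_def agree_def)
      moreover have "(w, tr w b) \<in> Y k" using b(2) by (simp add: E_def)
      ultimately show False using a(2,3) b(3) zw unfolding E_def by blast
    qed
    have "countable {z \<in> Z. \<exists>q. bad z q}"
    proof -
      define g where "g z = (SOME q. bad z q)" for z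
      have "bad z (g z)" if "\<exists>q. bad z q" for z unfolding g_def using that by (rule someI_ex)
      note bg = this
      have "inj_on g {z \<in> Z. \<exists>q. bad z q}"
      proof (rule inj_onI)
        fix z w assume zw: "z \<in> {z \<in> Z. \<exists>q. bad z q}" "w \<in> {z \<in> Z. \<exists>q. bad z q}" "g z = g w"
        have "bad z (g z)" "bad w (g w)" using zw(1,2) by (auto intro!: bg)
        then show "z = w" using badinj[of z "g z" w] zw(3) by simp
      qed
      then show ?thesis using countable_image_inj_on countableI_type by blast
    qed
    then have "\<not> Z \<subseteq> {z \<in> Z. \<exists>q. bad z q}" using Z countable_subset by blast
    then obtain z where z: "z \<in> Z" "\<And>q. \<not> bad z q" by blast
    \<comment> \<open>A vote by a point of the same piece on another branch. It is open since the
      common part of two branches is finite, and right because the piece contains no coloured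
      pair.\<close>
    define Op where "Op k i \<epsilon> = {a. \<exists>w b. (w, b) \<in> Y k \<and> w \<noteq> z \<and> tr z a \<inter> T w = b \<inter> T z \<and> i \<in> al (T w) \<and> (\<epsilon> \<longleftrightarrow> i \<in> al b)}" for k i \<epsilon>
    define B where "B k = {i. \<tau> i = (map z [0..<len i], k)}" for k
    define U where "U k = (\<Union>j<k. B j)" for k
    have "\<exists>k F m. (\<forall>i. finite (F i)) \<and> (\<forall>d \<subseteq> B k. d \<inter> {..<m} = {} \<longrightarrow>
      (\<forall>\<^sub>F i in cofinite. i \<in> al d \<longleftrightarrow> i \<in> al (B k) \<and> odd (card (d \<inter> F i))))"
    proof (rule parity_representation[where Y="\<lambda>k. {a. (z, tr z a) \<in> Y k}" and Op=Op and D="D z" and U=U and T="T z"])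
      show "(\<Union>k. {a. (z, tr z a) \<in> Y k}) = UNIV"
      proof -
        have "(z, tr z a) \<in> (\<Union>k. Y k)" for a unfolding Y(1)[symmetric] S_def using z(1) by (auto simp: tr_def)
        then show ?thesis by blast
      qed
      show "U 0 = {}" by (simp add: U_def)
      show "U (Suc k) = U k \<union> B k" for k by (auto simp: U_def less_Suc_eq)
      show "U k \<inter> B k = {}" for k by (auto simp: U_def B_def)
      show "B k \<subseteq> T z" for k by (auto simp: B_def T_def)
      show "opn (Op k i \<epsilon>)" for k i \<epsilon>
        unfolding opn_def
      proof
        fix a assume "a \<in> Op k i \<epsilon>"
        then obtain w b where wb: "(w, b) \<in> Y k" "w \<noteq> z" "tr z a \<inter> T w = b \<inter> T z" "i \<in> al (T w)" "\<epsilon> \<longleftrightarrow> i \<in> al b" unfolding Op_def by blast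
        obtain p where p: "\<And>i. i \<in> T w \<and> i \<in> T z \<Longrightarrow> i < p" using finTT[OF wb(2)] by blast
        have "a' \<in> Op k i \<epsilon>" if "agree {..<p} a' a" for a'
        proof -
          have "tr z a' \<inter> T w = tr z a \<inter> T w" using p that by (auto simp: tr_def agree_def)
          then show ?thesis unfolding Op_def using wb by auto
        qed
        then show "\<exists>n. \<forall>b. agree {..<n} b a \<longrightarrow> b \<in> Op k i \<epsilon>" by blast
      qed
      show "opn (D z k i)" for k i by (rule Dopen)
      show "dense_at {} e 0 (D z k i)" for k i e using badD z(2) by blast
      show "\<epsilon> \<longleftrightarrow> i \<in> al {j \<in> T z. a j}"
        if a: "a \<in> {a. (z, tr z a) \<in> Y k}" and i: "i \<in> al (T z)" and "a \<in> Op k i \<epsilon>" for k a i \<epsilon>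
      proof -
        obtain w b where wb: "(w, b) \<in> Y k" "w \<noteq> z" "tr z a \<inter> T w = b \<inter> T z" "i \<in> al (T w)" "\<epsilon> \<longleftrightarrow> i \<in> al b"
          using \<open>a \<in> Op k i \<epsilon>\<close> unfolding Op_def by blast
        have "\<not> K (z, tr z a) (w, b)" using Y(2)[of "(z, tr z a)" k "(w, b)"] a wb(1) by simp
        then have "i \<in> al (tr z a) \<longleftrightarrow> i \<in> al b" using wb(2-4) i unfolding K_def prod.case by blast
        then show ?thesis using wb(5) by (simp add: tr_def)
      qed
      show "a \<in> Op k i (i \<in> al {j \<in> T z. a j})"
        if a: "a \<in> {a. (z, tr z a) \<in> Y k}" and aD: "a \<in> D z k i" and i: "i \<in> al (T z)" for k a i
      proof -
        have "tr z a \<notin> E z k (Suc i)" using aD unfolding D_def by auto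
        then obtain w b where wb: "(w, b) \<in> Y k" "w \<noteq> z" "inf (Suc i) w b = inf (Suc i) z (tr z a)" "tr z a \<inter> T w = b \<inter> T z"
          using a unfolding E_def by blast
        then have ib: "i \<in> al (T w)" "i \<in> al b \<longleftrightarrow> i \<in> al (tr z a)" using i unfolding inf by auto
        have eq: "{j \<in> T z. a j} = tr z a" by (simp add: tr_def)
        show ?thesis unfolding eq Op_def mem_Collect_eq
          using wb ib by (intro exI[of _ w] exI[of _ b] conjI) simp_all
      qed
    qed
    then obtain k F m where F1: "\<forall>i. finite (F i)" and F2: "\<forall>d \<subseteq> B k. d \<inter> {..<m} = {} \<longrightarrow>
      (\<forall>\<^sub>F i in cofinite. i \<in> al d \<longleftrightarrow> i \<in> al (B k) \<and> odd (card (d \<inter> F i)))" by (elim exE conjE)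
    have "triv (B k)" by (rule parity_imp_triv[of F "B k" m]) (use F1 F2 in blast)+
    then show ?thesis using z(1) unfolding B_def len_def by (intro bexI[of _ z] exI[of _ k])
  qed
qed



section \<open>Gluing the pointwise liftings to an almost permutation\<close>

lemma triv_subset: "triv A \<Longrightarrow> B \<subseteq> A \<Longrightarrow> triv B"
  unfolding triv_def by (meson order_trans)

lemma finite_to_one:
  assumes h: "\<And>c. c \<subseteq> A \<Longrightarrow> eq_mod_fin (al c) (h ` c)"
  shows "finite {n \<in> A. h n = y}"
proof -
  define c where "c = {n \<in> A. h n = y}"
  have "eq_mod_fin (al c) (h ` c)" by (rule h) (simp add: c_def)
  moreover have "finite (h ` c)" by (rule finite_subset[of _ "{y}"]) (auto simp: c_def)
  ultimately have "finite (al c)" unfolding eq_mod_fin_def by (metis finite_Diff2 finite_Un)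
  then show ?thesis by (simp add: finite_al_iff c_def)
qed

text \<open>An infinite set of disagreement has an infinite subset with disjoint images under the
  two maps. Both images almost equal its value under \<open>al\<close>, which would therefore be
  finite.\<close>

lemma triv_coherent:
  assumes h: "\<And>c. c \<subseteq> A \<Longrightarrow> eq_mod_fin (al c) (h ` c)" and g: "\<And>c. c \<subseteq> B \<Longrightarrow> eq_mod_fin (al c) (g ` c)"
  shows "finite {n \<in> A \<inter> B. h n \<noteq> g n}"
proof (rule ccontr)
  define D where "D = {n \<in> A \<inter> B. h n \<noteq> g n}"
  assume "infinite {n \<in> A \<inter> B. h n \<noteq> g n}"
  then have inf: "infinite D" by (simp add: D_def)
  have fin: "finite {y \<in> D. h x = g y \<or> h y = g x}" for x
  proof (rule finite_subset)
    show "{y \<in> D. h x = g y \<or> h y = g x} \<subseteq> {n \<in> B. g n = h x} \<union> {n \<in> A. h n = g x}" by (auto simp: D_def)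
    show "finite ({n \<in> B. g n = h x} \<union> {n \<in> A. h n = g x})" using finite_to_one[OF h] finite_to_one[OF g] by simp
  qed
  obtain D' where D': "D' \<subseteq> D" "infinite D'" "\<And>x y. x \<in> D' \<Longrightarrow> y \<in> D' \<Longrightarrow> x \<noteq> y \<Longrightarrow> h x \<noteq> g y"
    using infinite_independent_subset[where R="\<lambda>x y. h x = g y", OF inf fin] by blast
  have dis: "h ` D' \<inter> g ` D' = {}"
  proof -
    have "h x \<noteq> g y" if "x \<in> D'" "y \<in> D'" for x y
      using D'(1,3) that by (cases "x = y") (auto simp: D_def)
    then show ?thesis by blast
  qed
  have "eq_mod_fin (al D') (h ` D')" by (rule h) (use D'(1) in \<open>auto simp: D_def\<close>)
  moreover have "eq_mod_fin (al D') (g ` D')" by (rule g) (use D'(1) in \<open>auto simp: D_def\<close>)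
  ultimately have "\<forall>\<^sub>F n in cofinite. n \<notin> al D'"
    unfolding eq_mod_fin_iff by eventually_elim (use dis in blast)
  then have "finite (al D')" by (simp add: eventually_cofinite)
  then show False using D'(2) by (simp add: finite_al_iff)
qed

text \<open>The nodes are distributed injectively over the sets \<open>B j\<close> in such a way
  that every block of every branch meets each of them infinitely often; then
  \<open>branch_triv\<close> applies.\<close>

lemma triv_hits:
  assumes "OCA" and B: "\<And>j :: nat. infinite (B j)"
  shows "\<exists>A. triv A \<and> (\<forall>j. infinite (A \<inter> B j))"
proof -
  obtain f :: "nat \<Rightarrow> nat" where f: "inj f"
    "\<And>q. f q \<in> (\<lambda>q. B (snd (snd (from_nat q :: bool list \<times> nat \<times> nat)))) q"
    using injective_choice[of "\<lambda>q. B (snd (snd (from_nat q :: bool list \<times> nat \<times> nat)))"] B by blast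
  define g where "g x = f (to_nat x)" for x :: "bool list \<times> nat \<times> nat"
  have g: "inj g"
  proof (rule injI)
    fix x y assume "g x = g y"
    then have "to_nat x = to_nat y" using inj_eq[OF f(1)] by (simp add: g_def)
    then show "x = y" by simp
  qed
  have gB: "g (s, k, j) \<in> B j" for s k j using f(2)[of "to_nat (s, k, j)"] by (simp add: g_def)
  define ok where "ok = (\<lambda>(s :: bool list, k, j). k \<le> length s \<and> j \<le> length s)"
  define \<tau> where "\<tau> i = (if i \<in> g ` Collect ok then (case inv g i of (s, k, j) \<Rightarrow> (s, k)) else (replicate i False, 0))" for i
  have \<tau>g: "\<tau> (g (s, k, j)) = (s, k)" if "k \<le> length s" "j \<le> length s" for s k j
  proof -
    have "g (s, k, j) \<in> g ` Collect ok" using that by (auto simp: ok_def)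
    then show ?thesis using g by (simp add: \<tau>_def)
  qed
  have lev: "finite {i. length (fst (\<tau> i)) \<le> m}" for m
  proof (rule finite_subset)
    show "{i. length (fst (\<tau> i)) \<le> m} \<subseteq> {..m} \<union> g ` ({s. set s \<subseteq> UNIV \<and> length s \<le> m} \<times> {..m} \<times> {..m})"
    proof
      fix i assume i: "i \<in> {i. length (fst (\<tau> i)) \<le> m}"
      show "i \<in> {..m} \<union> g ` ({s. set s \<subseteq> UNIV \<and> length s \<le> m} \<times> {..m} \<times> {..m})"
      proof (cases "i \<in> g ` Collect ok")
        case True
        then obtain s k j where sk: "i = g (s, k, j)" "k \<le> length s" "j \<le> length s" by (auto simp: ok_def)
        then have "length s \<le> m" using i \<tau>g by simp
        then show ?thesis using sk by auto
      next
        case False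
        then show ?thesis using i by (simp add: \<tau>_def)
      qed
    qed
    show "finite ({..m} \<union> g ` ({s :: bool list. set s \<subseteq> UNIV \<and> length s \<le> m} \<times> {..m} \<times> {..m}))"
      by (intro finite_UnI finite_imageI finite_cartesian_product finite_lists_length_le) simp_all
  qed
  obtain z k where zk: "triv {i. \<tau> i = (map z [0..<length (fst (\<tau> i))], k)}"
    using branch_triv[OF \<open>OCA\<close> uncountable_UNIV_nat_bool lev] by blast
  have "infinite ({i. \<tau> i = (map z [0..<length (fst (\<tau> i))], k)} \<inter> B j)" for j
  proof -
    define F where "F l = g (map z [0..<l], k, j)" for l
    have "inj F"
    proof (rule injI)
      fix l l' assume "F l = F l'"
      then have "map z [0..<l] = map z [0..<l']" using g by (auto simp: F_def dest: injD)
      then have "length (map z [0..<l]) = length (map z [0..<l'])" by (rule arg_cong)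
      then show "l = l'" by simp
    qed
    then have "infinite (F ` {max k j..})" by (metis finite_imageD infinite_Ici inj_on_subset subset_UNIV)
    moreover have "F ` {max k j..} \<subseteq> {i. \<tau> i = (map z [0..<length (fst (\<tau> i))], k)} \<inter> B j"
      using gB \<tau>g by (auto simp: F_def)
    ultimately show ?thesis using infinite_super by blast
  qed
  then show ?thesis using zk by blast
qed

text \<open>Uniformization for characteristic functions and the discrete distance; \<delta> is 1/4
  because \<open>3 * \<delta>\<close> has to stay below 1. Outside its set a function has the dummy
  value 0 attached, so common zeros create no incoherence.\<close>

lemma uniform_on_triv:
  assumes OCA and MA: MA_sigma_linked
  shows "\<exists>h :: nat \<Rightarrow> nat. \<forall>A. triv A \<longrightarrow> eq_mod_fin (al A) (h ` A)"
proof -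
  define hh where "hh A = (SOME h :: nat \<Rightarrow> nat. \<forall>c \<subseteq> A. eq_mod_fin (al c) (h ` c))" for A
  have hh: "eq_mod_fin (al c) (hh A ` c)" if "triv A" "c \<subseteq> A" for A c
  proof -
    have "\<exists>h :: nat \<Rightarrow> nat. \<forall>c \<subseteq> A. eq_mod_fin (al c) (h ` c)" using that(1) by (simp add: triv_def)
    from someI_ex[OF this] show ?thesis using that(2) unfolding hh_def by blast
  qed
  define ind where "ind A i = (if i \<in> A then 1 else 0 :: nat)" for A and i :: nat
  define S where "S a = {i. a i = 1}" for a :: "nat \<Rightarrow> nat"
  have Sind: "S (ind A) = A" for A by (simp add: S_def ind_def)
  define X where "X = {ind A |A. triv A}"
  define v where "v a i = (if i \<in> S a then hh (S a) i else 0)" for a i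
  have "\<exists>H. \<forall>a\<in>X. finite {i. (if v a i = H i (a i) then 0 else 1) > 3 * (1 / 4 :: real)}"
  proof (rule uniformization[OF \<open>OCA\<close> MA, where D="\<lambda>i x y. if x = y then 0 else 1"])
    show "finite {i. a i = b i \<and> (if v a i = v b i then 0 else 1) > (1 / 4 :: real)}" if ab: "a \<in> X" "b \<in> X" for a b
    proof -
      obtain A B where AB: "a = ind A" "triv A" "b = ind B" "triv B" using ab unfolding X_def by blast
      have "finite {n \<in> A \<inter> B. hh A n \<noteq> hh B n}" by (rule triv_coherent[OF hh[OF AB(2)] hh[OF AB(4)]])
      moreover have "{i. a i = b i \<and> (if v a i = v b i then 0 else 1) > (1 / 4 :: real)} \<subseteq> {n \<in> A \<inter> B. hh A n \<noteq> hh B n}"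
      proof
        fix i assume "i \<in> {i. a i = b i \<and> (if v a i = v b i then 0 else 1) > (1 / 4 :: real)}"
        then have i: "a i = b i" "v a i \<noteq> v b i" by (auto split: if_splits)
        have "i \<in> A \<longleftrightarrow> i \<in> B" using i(1) by (auto simp: AB ind_def split: if_splits)
        then show "i \<in> {n \<in> A \<inter> B. hh A n \<noteq> hh B n}" using i(2) by (auto simp: v_def AB Sind split: if_splits)
      qed
      ultimately show ?thesis using finite_subset by blast
    qed
    show "\<exists>a\<in>X. \<forall>j. infinite {i \<in> B j. a i = c j i}"
      if c: "\<And>j. c j \<in> X" and B: "\<And>j :: nat. infinite (B j)" for c :: "nat \<Rightarrow> nat \<Rightarrow> nat" and B
    proof -
      have "\<forall>j. \<exists>A. c j = ind A" using c unfolding X_def by blast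
      then obtain A where A: "\<And>j. c j = ind (A j)" by metis
      \<comment> \<open>Each \<open>B j\<close> is thinned out to a set on which \<open>c j\<close>
        is constant, and these are made disjoint. A set in \<open>triv\<close> hitting all of them
        then has a part that imitates every \<open>c j\<close>.\<close>
      define pos where "pos j \<longleftrightarrow> infinite (B j \<inter> A j)" for j
      define B1 where "B1 j = (if pos j then B j \<inter> A j else B j - A j)" for j
      have B1: "infinite (B1 j)" for j
      proof -
        have "B j = (B j \<inter> A j) \<union> (B j - A j)" by blast
        then show ?thesis using B[of j] unfolding B1_def pos_def by (metis finite_Un)
      qed
      obtain f :: "nat \<Rightarrow> nat" where f: "inj f" "\<And>q. f q \<in> B1 (fst (prod_decode q))"
        using injective_choice[of "\<lambda>q. B1 (fst (prod_decode q))"] B1 by blast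
      define B2 where "B2 j = (\<lambda>l. f (prod_encode (j, l))) ` UNIV" for j
      have B2inf: "infinite (B2 j)" for j
      proof -
        have "inj (\<lambda>l. f (prod_encode (j, l)))" by (rule injI) (simp add: inj_eq[OF f(1)])
        then show ?thesis unfolding B2_def using range_inj_infinite by blast
      qed
      have B2sub: "B2 j \<subseteq> B1 j" for j
      proof -
        have "f (prod_encode (j, l)) \<in> B1 j" for l using f(2)[of "prod_encode (j, l)"] by simp
        then show ?thesis by (auto simp: B2_def)
      qed
      have B2dis: "j = j'" if "x \<in> B2 j" "x \<in> B2 j'" for x j j'
        using that by (auto simp: B2_def inj_eq[OF f(1)])
      obtain T where T: "triv T" "\<And>j. infinite (T \<inter> B2 j)" using triv_hits[OF \<open>OCA\<close>, of B2] B2inf by blast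
      define t where "t = T \<inter> (\<Union>j\<in>Collect pos. B2 j)"
      have "triv t" by (rule triv_subset[OF T(1)]) (simp add: t_def)
      then have "ind t \<in> X" by (auto simp: X_def)
      moreover have "infinite {i \<in> B j. ind t i = c j i}" for j
      proof -
        have "T \<inter> B2 j \<subseteq> {i \<in> B j. ind t i = c j i}"
        proof
          fix i assume i: "i \<in> T \<inter> B2 j"
          then have i1: "i \<in> B1 j" using B2sub by blast
          show "i \<in> {i \<in> B j. ind t i = c j i}"
          proof (cases "pos j")
            case True
            then have "i \<in> t" using i by (auto simp: t_def)
            then show ?thesis using i1 True by (simp add: B1_def A ind_def)
          next
            case False
            have "i \<notin> t"
            proof
              assume "i \<in> t"
              then obtain j' where "pos j'" "i \<in> B2 j'" by (auto simp: t_def)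
              then show False using B2dis[of i j j'] i False by auto
            qed
            then show ?thesis using i1 False by (simp add: B1_def A ind_def)
          qed
        qed
        then show ?thesis using T(2)[of j] infinite_super by blast
      qed
      ultimately show ?thesis by blast
    qed
    show "\<exists>z\<in>Z. \<exists>k. \<exists>t\<in>X. \<forall>i. \<tau> i = (map z [0..<i], k) \<and> (\<exists>x\<in>X. x i = c i) \<longrightarrow> t i = c i"
      if Z: "uncountable Z" and len: "\<And>i. length (fst (\<tau> i)) = i"
      for Z :: "(nat \<Rightarrow> bool) set" and \<tau> :: "nat \<Rightarrow> bool list \<times> nat" and c :: "nat \<Rightarrow> nat"
    proof -
      have lev: "finite {i. length (fst (\<tau> i)) \<le> m}" for m by (simp add: len)
      obtain z k where zk: "z \<in> Z" "triv {i. \<tau> i = (map z [0..<length (fst (\<tau> i))], k)}"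
        using branch_triv[OF \<open>OCA\<close> Z lev] by blast
      \<comment> \<open>Subsets of the branch are in \<open>triv\<close> too, which allows the
        prescribed values \<open>c\<close> to be followed.\<close>
      define A where "A = {i. \<tau> i = (map z [0..<i], k)} \<inter> {i. c i = 1}"
      have "triv A" by (rule triv_subset[OF zk(2)]) (auto simp: A_def)
      then have "ind A \<in> X" by (auto simp: X_def)
      moreover have "ind A i = c i" if "\<tau> i = (map z [0..<i], k)" "\<exists>x\<in>X. x i = c i" for i
        using that by (auto simp: X_def ind_def A_def split: if_splits)
      ultimately show ?thesis using zk(1) by blast
    qed
  qed auto
  then obtain H where H: "\<And>a. a \<in> X \<Longrightarrow> finite {i. (if v a i = H i (a i) then 0 else 1) > 3 * (1 / 4 :: real)}" by blast
  define h where "h i = H i 1" for i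
  have "eq_mod_fin (al A) (h ` A)" if A: "triv A" for A
  proof -
    have "ind A \<in> X" using A by (auto simp: X_def)
    moreover have "{i. (if v (ind A) i = H i (ind A i) then 0 else 1) > 3 * (1 / 4 :: real)} = {i. v (ind A) i \<noteq> H i (ind A i)}"
      by auto
    ultimately have fin: "finite {i. v (ind A) i \<noteq> H i (ind A i)}" using H[of "ind A"] by (simp only:)
    define E where "E = {i \<in> A. hh A i \<noteq> h i}"
    have "E \<subseteq> {i. v (ind A) i \<noteq> H i (ind A i)}" by (auto simp: E_def v_def Sind ind_def h_def)
    then have "finite E" using fin finite_subset by blast
    have "(hh A ` A - h ` A) \<union> (h ` A - hh A ` A) \<subseteq> hh A ` E \<union> h ` E" unfolding E_def by force
    then have "eq_mod_fin (hh A ` A) (h ` A)" unfolding eq_mod_fin_def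
      using \<open>finite E\<close> by (meson finite_UnI finite_imageI finite_subset)
    then show ?thesis using hh[OF A order_refl] equivp_transp[OF equivp_eq_mod_fin] by blast
  qed
  then show ?thesis by blast
qed

text \<open>Every infinite set has an infinite subset in \<open>triv\<close>. An infinite error of
  \<open>h\<close> at \<open>a\<close> would come from an infinite set of points of
  \<open>a\<close>, and on a subset in \<open>triv\<close> there is no infinite error.\<close>

lemma induced_by_function:
  assumes OCA and MA: MA_sigma_linked
  shows "\<exists>h :: nat \<Rightarrow> nat. \<forall>a. eq_mod_fin (al a) (h ` a)"
proof -
  obtain h :: "nat \<Rightarrow> nat" where h: "\<And>A. triv A \<Longrightarrow> eq_mod_fin (al A) (h ` A)" using uniform_on_triv[OF assms] by blast
  have tall: "\<exists>c \<subseteq> b. infinite c \<and> triv c" if inf: "infinite b" for b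
  proof -
    obtain A where "triv A" "infinite (A \<inter> b)" using triv_hits[OF \<open>OCA\<close>, of "\<lambda>_. b"] inf by blast
    then show ?thesis using triv_subset[of A "A \<inter> b"] by blast
  qed
  have "finite (al a - h ` a)" for a
  proof (rule ccontr)
    assume inf: "infinite (al a - h ` a)"
    \<comment> \<open>Surjectivity pulls the error back to a set, which may be taken inside
      \<open>a\<close>.\<close>
    obtain b0 where b0: "eq_mod_fin (al b0) (al a - h ` a)" using al_surj by blast
    define b where "b = b0 \<inter> a"
    have b: "\<forall>\<^sub>F n in cofinite. n \<in> al b \<longleftrightarrow> n \<in> al a - h ` a"
      using b0[unfolded eq_mod_fin_iff] al_Int[of b0 a, folded b_def] by eventually_elim blast
    have "infinite b"
    proof
      assume "finite b"
      then have "finite (al b)" by (simp add: finite_al_iff)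
      then have "\<forall>\<^sub>F n in cofinite. n \<notin> al b" by (simp add: eventually_cofinite)
      then have "\<forall>\<^sub>F n in cofinite. n \<notin> al a - h ` a" using b by eventually_elim blast
      then show False using inf by (simp only: eventually_cofinite not_not Collect_mem_eq)
    qed
    then obtain c where c: "c \<subseteq> b" "infinite c" "triv c" using tall by blast
    have sub: "h ` c \<subseteq> h ` a" using c(1) by (auto simp: b_def)
    have "\<forall>\<^sub>F n in cofinite. n \<notin> al c"
      using h[OF c(3), unfolded eq_mod_fin_iff] al_mono[OF c(1)] b by eventually_elim (use sub in blast)
    then have "finite (al c)" by (simp add: eventually_cofinite)
    then show False using c(2) by (simp add: finite_al_iff)
  qed
  moreover have "finite (h ` a - al a)" for a
  proof (rule ccontr)
    assume inf: "infinite (h ` a - al a)"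
    define E where "E = {n \<in> a. h n \<notin> al a}"
    have "h ` E = h ` a - al a" by (auto simp: E_def)
    then have "infinite E" using inf finite_imageI by metis
    then obtain c where c: "c \<subseteq> E" "infinite c" "triv c" using tall by blast
    have ca: "c \<subseteq> a" and cE: "h ` c \<inter> al a = {}" using c(1) by (auto simp: E_def)
    have "\<forall>\<^sub>F n in cofinite. n \<notin> al c"
      using h[OF c(3), unfolded eq_mod_fin_iff] al_mono[OF ca] by eventually_elim (use cE in blast)
    then have "finite (al c)" by (simp add: eventually_cofinite)
    then show False using c(2) by (simp add: finite_al_iff)
  qed
  ultimately show ?thesis unfolding eq_mod_fin_def by blast
qed

text \<open>Deleting the points that repeat an earlier value does not change the range of
  \<open>h\<close>. So the image of the deleted set is almost contained in that of its complement,
  from which it is almost disjoint.\<close>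

lemma almost_injective:
  assumes h: "\<And>a. eq_mod_fin (al a) (h ` a)"
  obtains A where "finite (- A)" "inj_on h A" "finite (- (h ` A))"
proof -
  define D where "D = {n. \<exists>m<n. h m = h n}"
  have least: "\<exists>m. m \<notin> D \<and> h m = h n" for n
  proof -
    have "h (LEAST m. h m = h n) = h n" by (rule LeastI[of "\<lambda>m. h m = h n" n]) simp
    moreover have "(LEAST m. h m = h n) \<notin> D"
    proof
      assume "(LEAST m. h m = h n) \<in> D"
      then obtain m where "m < (LEAST m. h m = h n)" "h m = h (LEAST m. h m = h n)" unfolding D_def by blast
      then show False using not_less_Least[of m "\<lambda>m. h m = h n"] calculation by simp
    qed
    ultimately show ?thesis by blast
  qed
  then have img: "h n \<in> h ` (- D)" for n by (metis ComplI image_eqI)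
  have "\<forall>\<^sub>F n in cofinite. n \<notin> al D"
    using h[of D, unfolded eq_mod_fin_iff] h[of "- D", unfolded eq_mod_fin_iff] al_Compl[of D]
    by eventually_elim (use img in blast)
  then have "finite (al D)" by (simp add: eventually_cofinite)
  then have "finite D" by (simp add: finite_al_iff)
  moreover have "inj_on h (- D)" by (rule linorder_inj_onI') (auto simp: D_def)
  moreover have "finite (- (h ` (- D)))"
  proof -
    have "\<forall>\<^sub>F n in cofinite. n \<in> al UNIV \<longleftrightarrow> n \<notin> al {}" using al_Compl[of "{}"] by simp
    then have "\<forall>\<^sub>F n in cofinite. n \<in> al UNIV" using al_empty by eventually_elim blast
    then have "\<forall>\<^sub>F n in cofinite. n \<in> h ` UNIV" using h[of UNIV, unfolded eq_mod_fin_iff] by eventually_elim blast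
    then have "\<forall>\<^sub>F n in cofinite. n \<in> h ` (- D)" by eventually_elim (use img in blast)
    then show ?thesis by (simp add: eventually_cofinite Compl_eq)
  qed
  ultimately show thesis using that[of "- D"] by simp
qed

end

section \<open>Maps between metric reduced products\<close>

lemma pow_fin_lift_automorphism:
  assumes "pow_fin_automorphism \<alpha>"
  shows "pow_fin_lift (\<lambda>S. rep_pow_fin (\<alpha> (abs_pow_fin S)))"
proof -
  have bij: "bij \<alpha>" and inf: "\<And>x y. \<alpha> (inf x y) = inf (\<alpha> x) (\<alpha> y)" and um: "\<And>x. \<alpha> (- x) = - \<alpha> x"
    using assms by (auto simp: pow_fin_automorphism_def)
  define al where "al S = rep_pow_fin (\<alpha> (abs_pow_fin S))" for S
  have abs_al: "abs_pow_fin (al S) = \<alpha> (abs_pow_fin S)" for S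
    unfolding al_def by (rule Quotient_abs_rep[OF Quotient_pow_fin])
  have eq: "eq_mod_fin A B \<longleftrightarrow> abs_pow_fin A = abs_pow_fin B" for A B
    by (simp add: pow_fin.abs_eq_iff)
  have "pow_fin_lift al"
  proof
    show "eq_mod_fin (al S) (al T)" if "eq_mod_fin S T" for S T using that by (simp add: eq abs_al)
    show "eq_mod_fin S T" if "eq_mod_fin (al S) (al T)" for S T
      using that bij by (simp add: eq abs_al bij_def inj_eq)
    show "\<exists>S. eq_mod_fin (al S) T" for T
    proof -
      obtain x where x: "abs_pow_fin T = \<alpha> x" using bij by (metis bij_pointE)
      have "x = abs_pow_fin (rep_pow_fin x)" by (rule Quotient_abs_rep[OF Quotient_pow_fin, symmetric])
      then show ?thesis using x by (metis eq abs_al)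
    qed
    show "\<forall>\<^sub>F n in cofinite. n \<in> al (S \<inter> T) \<longleftrightarrow> n \<in> al S \<and> n \<in> al T" for S T
    proof -
      have "eq_mod_fin (al (S \<inter> T)) (al S \<inter> al T)"
        unfolding eq inf_pow_fin.abs_eq[symmetric] abs_al inf ..
      then show ?thesis by (simp add: eq_mod_fin_iff)
    qed
    show "\<forall>\<^sub>F n in cofinite. n \<in> al (- S) \<longleftrightarrow> n \<notin> al S" for S
    proof -
      have "eq_mod_fin (al (- S)) (- al S)"
        unfolding eq uminus_pow_fin.abs_eq[symmetric] abs_al um ..
      then show ?thesis by (simp add: eq_mod_fin_iff)
    qed
  qed
  then show ?thesis by (simp add: al_def[abs_def])
qed

lemma seq_space_nth: "a \<in> seq_space M \<Longrightarrow> a n \<in> mspace (M n)"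
  by (auto simp: seq_space_def)

lemma limsup_dist_on_eq_0:
  assumes "a \<in> seq_space M" "\<And>n. n \<in> S \<Longrightarrow> a n = b n"
  shows "limsup_dist_on M S a b = 0"
proof (cases "finite S")
  case False
  let ?F = "inf sequentially (principal S)"
  have nb: "?F \<noteq> bot"
  proof
    assume "?F = bot"
    then have "\<forall>\<^sub>F n in sequentially. n \<notin> S" by (simp add: trivial_limit_def eventually_inf_principal)
    then obtain k where "\<And>n. n \<ge> k \<Longrightarrow> n \<notin> S" unfolding eventually_sequentially by blast
    then have "S \<subseteq> {..<k}" by (meson lessThan_iff not_le subsetI)
    then show False using False finite_subset by blast
  qed
  have "mdist (M n) (a n) (b n) = 0" if "n \<in> S" for n
    using assms(2)[OF that] seq_space_nth[OF assms(1), of n] by simp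
  then have "\<forall>\<^sub>F n in ?F. ereal (mdist (M n) (a n) (b n)) = 0"
    unfolding eventually_inf_principal by (intro always_eventually) simp
  then have "Limsup ?F (\<lambda>n. ereal (mdist (M n) (a n) (b n))) = Limsup ?F (\<lambda>_. 0)" by (rule Limsup_eq)
  also have "\<dots> = 0" by (rule Limsup_const[OF nb])
  finally show ?thesis using False by (simp add: limsup_dist_on_def)
qed (simp add: limsup_dist_on_def)

lemma limsup_dist_on_eq_0D:
  assumes "limsup_dist_on M S a b = 0" "\<epsilon> > 0"
  shows "finite {n \<in> S. mdist (M n) (a n) (b n) > \<epsilon>}"
proof (cases "finite S")
  case False
  then have "Limsup (inf sequentially (principal S)) (\<lambda>n. ereal (mdist (M n) (a n) (b n))) < ereal \<epsilon>"
    using assms by (simp add: limsup_dist_on_def)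
  then have "\<forall>\<^sub>F n in inf sequentially (principal S). ereal (mdist (M n) (a n) (b n)) < ereal \<epsilon>"
    by (rule Limsup_lessD)
  then have "\<forall>\<^sub>F n in sequentially. n \<in> S \<longrightarrow> mdist (M n) (a n) (b n) < \<epsilon>"
    by (simp add: eventually_inf_principal)
  then obtain k where k: "\<And>n. n \<ge> k \<Longrightarrow> n \<in> S \<Longrightarrow> mdist (M n) (a n) (b n) < \<epsilon>"
    unfolding eventually_sequentially by blast
  have "{n \<in> S. mdist (M n) (a n) (b n) > \<epsilon>} \<subseteq> {..<k}"
  proof
    fix n assume "n \<in> {n \<in> S. mdist (M n) (a n) (b n) > \<epsilon>}"
    then show "n \<in> {..<k}" using k[of n] by (cases "n < k") auto
  qed
  then show ?thesis using finite_subset by blast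
qed simp

lemma separable_metric_dense_sequence:
  assumes sep: "separable_space (mtopology_of m)" and ne: "mspace m \<noteq> {}"
  obtains d :: "nat \<Rightarrow> 'a" where "\<And>k. d k \<in> mspace m" "\<And>x r. x \<in> mspace m \<Longrightarrow> r > 0 \<Longrightarrow> \<exists>k. mdist m x (d k) < r"
proof -
  interpret Metric_space "mspace m" "mdist m" by (rule Metric_space_mspace_mdist)
  obtain C where C: "countable C" "C \<subseteq> mspace m" "mtopology closure_of C = mspace m"
    using sep unfolding separable_space_def mtopology_of_def by auto
  have "C \<noteq> {}" using C(3) ne by auto
  define d where "d = from_nat_into C"
  have "d k \<in> mspace m" for k using from_nat_into[OF \<open>C \<noteq> {}\<close>, of k] C(2) by (auto simp: d_def)
  moreover have "\<exists>k. mdist m x (d k) < r" if x: "x \<in> mspace m" and r: "r > 0" for x r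
  proof -
    have "x \<in> mtopology closure_of C" using C(3) x by simp
    then have "\<forall>r>0. \<exists>y\<in>C. y \<in> mball x r" unfolding metric_closure_of by blast
    then obtain y where y: "y \<in> C" "mdist m x y < r" using r by auto
    obtain k where "d k = y" using y(1) C(1) by (metis d_def from_nat_into_surj)
    then show ?thesis using y(2) by blast
  qed
  ultimately show thesis using that by blast
qed

text \<open>Points of \<open>N n\<close> are replaced by indices in a dense sequence, with error
  \<open>e\<close>. Coherence of the indices costs \<open>3 * e\<close>, uniformization triples
  this, and the return to \<open>\<Psi>\<close> costs one more \<open>e\<close>; hence
  \<open>e\<close> is a tenth of \<epsilon>.\<close>

lemma approximate_coordinate_maps:
  fixes M :: "nat \<Rightarrow> 'a metric" and N :: "nat \<Rightarrow> 'b metric" and \<Psi> :: "(nat \<Rightarrow> 'a) \<Rightarrow> nat \<Rightarrow> 'b"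
  assumes OCA and MA: MA_sigma_linked and Mfin: "\<And>n. finite (mspace (M n))" and Mne: "\<And>n. mspace (M n) \<noteq> {}"
    and Nne: "\<And>n. mspace (N n) \<noteq> {}" and Nsep: "\<And>n. separable_space (mtopology_of (N n))"
    and \<Psi>: "\<And>a. a \<in> seq_space M \<Longrightarrow> \<Psi> a \<in> seq_space N"
    and coh: "\<And>a b \<epsilon>. a \<in> seq_space M \<Longrightarrow> b \<in> seq_space M \<Longrightarrow> \<epsilon> > 0 \<Longrightarrow>
      finite {n. a n = b n \<and> mdist (N n) (\<Psi> a n) (\<Psi> b n) > \<epsilon>}"
    and \<epsilon>: "\<epsilon> > 0"
  shows "\<exists>g. (\<forall>n x. g n x \<in> mspace (N n)) \<and>
    (\<forall>a\<in>seq_space M. finite {n. mdist (N n) (\<Psi> a n) (g n (a n)) > \<epsilon>})"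
proof -
  define e where "e = \<epsilon> / 10"
  have e: "e > 0" using \<epsilon> by (simp add: e_def)
  have "\<forall>n. \<exists>d :: nat \<Rightarrow> 'b. (\<forall>k. d k \<in> mspace (N n)) \<and> (\<forall>x\<in>mspace (N n). \<exists>k. mdist (N n) x (d k) < e)"
  proof
    fix n
    obtain d :: "nat \<Rightarrow> 'b" where "\<And>k. d k \<in> mspace (N n)"
      "\<And>x r. x \<in> mspace (N n) \<Longrightarrow> r > 0 \<Longrightarrow> \<exists>k. mdist (N n) x (d k) < r"
      using separable_metric_dense_sequence[OF Nsep Nne] by blast
    then show "\<exists>d :: nat \<Rightarrow> 'b. (\<forall>k. d k \<in> mspace (N n)) \<and> (\<forall>x\<in>mspace (N n). \<exists>k. mdist (N n) x (d k) < e)"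
      using e by blast
  qed
  then obtain d :: "nat \<Rightarrow> nat \<Rightarrow> 'b" where d: "\<And>n k. d n k \<in> mspace (N n)"
    "\<And>n x. x \<in> mspace (N n) \<Longrightarrow> \<exists>k. mdist (N n) x (d n k) < e" by metis
  define enc where "enc n = to_nat_on (mspace (M n))" for n
  define dec where "dec u n = from_nat_into (mspace (M n)) (u n)" for u n
  define X where "X = {u. \<forall>n. \<exists>x\<in>mspace (M n). u n = enc n x}"
  have encX: "(\<lambda>n. enc n (a n)) \<in> X" if "a \<in> seq_space M" for a
    using seq_space_nth[OF that] by (auto simp: X_def)
  have de: "dec (\<lambda>n. enc n (a n)) = a" if "a \<in> seq_space M" for a
    using seq_space_nth[OF that] Mfin by (auto simp: dec_def enc_def countable_finite)
  have decM: "dec u \<in> seq_space M" for u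
    using from_nat_into[OF Mne] by (auto simp: dec_def seq_space_def)
  have ed: "u n = enc n (dec u n)" if "u \<in> X" for u n
  proof -
    obtain x where "x \<in> mspace (M n)" "u n = enc n x" using \<open>u \<in> X\<close> by (auto simp: X_def)
    then show ?thesis using Mfin by (simp add: dec_def enc_def countable_finite)
  qed
  define v where "v u i = (SOME k. mdist (N i) (\<Psi> (dec u) i) (d i k) < e)" for u i
  have \<Psi>i: "\<Psi> (dec u) i \<in> mspace (N i)" for u i using \<Psi>[OF decM] by (rule seq_space_nth)
  have v: "mdist (N i) (\<Psi> (dec u) i) (d i (v u i)) < e" for u i
    unfolding v_def using d(2)[OF \<Psi>i] by (rule someI_ex)
  define D where "D i x y = mdist (N i) (d i x) (d i y)" for i x y
  define a0 where "a0 n = enc n (SOME x. x \<in> mspace (M n))" for n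
  have a0: "\<exists>x\<in>mspace (M n). a0 n = enc n x" for n
  proof -
    have "(SOME x. x \<in> mspace (M n)) \<in> mspace (M n)" using Mne[of n] by (simp add: some_in_eq)
    then show ?thesis by (auto simp: a0_def)
  qed
  have "\<exists>H. \<forall>u\<in>X. finite {i. D i (v u i) (H i (u i)) > 3 * (3 * e)}"
  proof (rule uniformization[OF \<open>OCA\<close> MA])
    show "D i x x = 0" for i x using d(1) by (simp add: D_def)
    show "D i x y = D i y x" for i x y by (simp add: D_def mdist_commute)
    show "D i x z \<le> D i x y + D i y z" for i x y z unfolding D_def using d(1) by (intro mdist_triangle)
    show "3 * e > 0" using e by simp
    show "finite {i. a i = b i \<and> D i (v a i) (v b i) > 3 * e}" if "a \<in> X" "b \<in> X" for a b
    proof (rule finite_subset)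
      show "finite {i. dec a i = dec b i \<and> mdist (N i) (\<Psi> (dec a) i) (\<Psi> (dec b) i) > e}"
        by (rule coh[OF decM decM e])
      show "{i. a i = b i \<and> D i (v a i) (v b i) > 3 * e} \<subseteq> {i. dec a i = dec b i \<and> mdist (N i) (\<Psi> (dec a) i) (\<Psi> (dec b) i) > e}"
      proof
        fix i assume "i \<in> {i. a i = b i \<and> D i (v a i) (v b i) > 3 * e}"
        then have i: "a i = b i" "D i (v a i) (v b i) > 3 * e" by auto
        have "D i (v a i) (v b i) \<le> mdist (N i) (d i (v a i)) (\<Psi> (dec a) i) + mdist (N i) (\<Psi> (dec a) i) (d i (v b i))"
          unfolding D_def by (intro mdist_triangle d(1) \<Psi>i)
        also have "mdist (N i) (\<Psi> (dec a) i) (d i (v b i)) \<le> mdist (N i) (\<Psi> (dec a) i) (\<Psi> (dec b) i) + mdist (N i) (\<Psi> (dec b) i) (d i (v b i))"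
          by (intro mdist_triangle d(1) \<Psi>i)
        finally have "D i (v a i) (v b i) \<le> mdist (N i) (d i (v a i)) (\<Psi> (dec a) i) + (mdist (N i) (\<Psi> (dec a) i) (\<Psi> (dec b) i) + mdist (N i) (\<Psi> (dec b) i) (d i (v b i)))" by simp
        then have "mdist (N i) (\<Psi> (dec a) i) (\<Psi> (dec b) i) > e"
          using v[of i a] v[of i b] i(2) by (simp add: mdist_commute)
        then show "i \<in> {i. dec a i = dec b i \<and> mdist (N i) (\<Psi> (dec a) i) (\<Psi> (dec b) i) > e}"
          using i(1) by (simp add: dec_def)
      qed
    qed
    show "\<exists>a\<in>X. \<forall>j. infinite {i \<in> B j. a i = c j i}"
      if c: "\<And>j. c j \<in> X" and B: "\<And>j :: nat. infinite (B j)" for c :: "nat \<Rightarrow> nat \<Rightarrow> nat" and B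
    proof -
      obtain f :: "nat \<Rightarrow> nat" where f: "inj f" "\<And>q. f q \<in> B (fst (prod_decode q))"
        using injective_choice[of "\<lambda>q. B (fst (prod_decode q))"] B by blast
      define t where "t i = (if i \<in> range f then c (fst (prod_decode (inv f i))) i else a0 i)" for i
      have "t \<in> X" using c a0 by (auto simp: X_def t_def)
      moreover have "infinite {i \<in> B j. t i = c j i}" for j
      proof -
        have "inj (\<lambda>l. f (prod_encode (j, l)))" by (rule injI) (simp add: inj_eq[OF f(1)])
        then have "infinite (range (\<lambda>l. f (prod_encode (j, l))))" by (rule range_inj_infinite)
        moreover have "range (\<lambda>l. f (prod_encode (j, l))) \<subseteq> {i \<in> B j. t i = c j i}"
        proof
          fix i assume "i \<in> range (\<lambda>l. f (prod_encode (j, l)))"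
          then obtain l where l: "i = f (prod_encode (j, l))" by blast
          have "i \<in> B j" using f(2)[of "prod_encode (j, l)"] l by simp
          moreover have "t i = c j i" using f(1) by (simp add: t_def l)
          ultimately show "i \<in> {i \<in> B j. t i = c j i}" by simp
        qed
        ultimately show ?thesis using infinite_super by blast
      qed
      ultimately show ?thesis by blast
    qed
    show "\<exists>z\<in>Z. \<exists>k. \<exists>t\<in>X. \<forall>i. \<tau> i = (map z [0..<i], k) \<and> (\<exists>x\<in>X. x i = c i) \<longrightarrow> t i = c i"
      if Z: "uncountable Z" for Z :: "(nat \<Rightarrow> bool) set" and \<tau> :: "nat \<Rightarrow> bool list \<times> nat" and c :: "nat \<Rightarrow> nat"
    proof -
      \<comment> \<open>Any branch will do: a sequence is in the product as soon as its coordinates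
        are admissible one by one, and \<open>a0\<close> fills the gaps.\<close>
      obtain z where "z \<in> Z" using Z by (metis countable_empty ex_in_conv)
      moreover define t where "t i = (if \<exists>x\<in>X. x i = c i then c i else a0 i)" for i
      have "\<exists>x\<in>mspace (M i). t i = enc i x" for i
      proof (cases "\<exists>x\<in>X. x i = c i")
        case True
        then obtain x where "x \<in> X" "x i = c i" by blast
        then show ?thesis by (force simp: X_def t_def)
      next
        case False
        have "t i = a0 i" unfolding t_def using False by (rule if_not_P)
        then show ?thesis using a0 by simp
      qed
      then have "t \<in> X" by (simp add: X_def)
      moreover have "t i = c i" if "\<exists>x\<in>X. x i = c i" for i unfolding t_def using that by (rule if_P)
      ultimately show ?thesis by blast
    qed
  qed
  then obtain H where H: "\<And>u. u \<in> X \<Longrightarrow> finite {i. D i (v u i) (H i (u i)) > 3 * (3 * e)}" by blast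
  define g where "g i x = d i (H i (enc i x))" for i x
  have "finite {n. mdist (N n) (\<Psi> a n) (g n (a n)) > \<epsilon>}" if a: "a \<in> seq_space M" for a
  proof (rule finite_subset)
    define u where "u n = enc n (a n)" for n
    have du: "dec u = a" using de[OF a] by (simp add: u_def[abs_def])
    show "finite {i. D i (v u i) (H i (u i)) > 3 * (3 * e)}" using H encX[OF a] by (simp add: u_def[abs_def])
    show "{n. mdist (N n) (\<Psi> a n) (g n (a n)) > \<epsilon>} \<subseteq> {i. D i (v u i) (H i (u i)) > 3 * (3 * e)}"
    proof
      fix i assume "i \<in> {n. mdist (N n) (\<Psi> a n) (g n (a n)) > \<epsilon>}"
      then have i: "mdist (N i) (\<Psi> a i) (g i (a i)) > 10 * e" by (simp add: e_def)
      have gi: "g i (a i) = d i (H i (u i))" by (simp add: g_def u_def)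
      have "mdist (N i) (\<Psi> a i) (g i (a i)) \<le> mdist (N i) (\<Psi> a i) (d i (v u i)) + D i (v u i) (H i (u i))"
        unfolding D_def gi using \<Psi>i[of u i] d(1) du by (intro mdist_triangle) auto
      then show "i \<in> {i. D i (v u i) (H i (u i)) > 3 * (3 * e)}" using i v[of i u] du by simp
    qed
  qed
  moreover have "g n x \<in> mspace (N n)" for n x by (simp add: g_def d(1))
  ultimately show ?thesis by blast
qed

text \<open>Diagonalization over the precisions \<open>\<delta> k\<close>. At almost all coordinates
  two approximations are within the sum of their precisions for all points at once: the points where
  this fails can be collected into one sequence, and only finitely many coordinates of it can be
  wrong.\<close>

lemma coordinate_maps:
  fixes M :: "nat \<Rightarrow> 'a metric" and N :: "nat \<Rightarrow> 'b metric" and \<Psi> :: "(nat \<Rightarrow> 'a) \<Rightarrow> nat \<Rightarrow> 'b"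
  assumes OCA and MA: MA_sigma_linked and Mfin: "\<And>n. finite (mspace (M n))" and Mne: "\<And>n. mspace (M n) \<noteq> {}"
    and Nne: "\<And>n. mspace (N n) \<noteq> {}" and Nsep: "\<And>n. separable_space (mtopology_of (N n))"
    and \<Psi>: "\<And>a. a \<in> seq_space M \<Longrightarrow> \<Psi> a \<in> seq_space N"
    and coh: "\<And>a b \<epsilon>. a \<in> seq_space M \<Longrightarrow> b \<in> seq_space M \<Longrightarrow> \<epsilon> > 0 \<Longrightarrow>
      finite {n. a n = b n \<and> mdist (N n) (\<Psi> a n) (\<Psi> b n) > \<epsilon>}"
  shows "\<exists>g. (\<forall>n x. g n x \<in> mspace (N n)) \<and>
    (\<forall>a\<in>seq_space M. \<forall>\<epsilon>>0. finite {n. mdist (N n) (\<Psi> a n) (g n (a n)) > \<epsilon>})"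
proof -
  define \<delta> where "\<delta> k = 1 / real (Suc k)" for k
  have \<delta>: "\<delta> k > 0" for k by (simp add: \<delta>_def)
  have \<delta>mono: "\<delta> l \<le> \<delta> k" if "k \<le> l" for k l using that by (simp add: \<delta>_def frac_le)
  have "\<forall>k. \<exists>g. (\<forall>n x. g n x \<in> mspace (N n)) \<and>
    (\<forall>a\<in>seq_space M. finite {n. mdist (N n) (\<Psi> a n) (g n (a n)) > \<delta> k})"
  proof
    fix k
    show "\<exists>g. (\<forall>n x. g n x \<in> mspace (N n)) \<and>
      (\<forall>a\<in>seq_space M. finite {n. mdist (N n) (\<Psi> a n) (g n (a n)) > \<delta> k})"
      by (rule approximate_coordinate_maps[OF assms(1-6)])
        ((rule \<Psi>, assumption) | (rule coh, assumption+) | rule \<delta>)+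
  qed
  then obtain g where gN: "\<And>k n x. g k n x \<in> mspace (N n)"
    and g: "\<And>k a. a \<in> seq_space M \<Longrightarrow> finite {n. mdist (N n) (\<Psi> a n) (g k n (a n)) > \<delta> k}" by metis
  define bad where "bad k l = {n. \<exists>x\<in>mspace (M n). mdist (N n) (g l n x) (g k n x) > \<delta> l + \<delta> k}" for k l
  have finbad: "finite (bad k l)" for k l
  proof -
    define a where "a n = (if n \<in> bad k l then SOME x. x \<in> mspace (M n) \<and> mdist (N n) (g l n x) (g k n x) > \<delta> l + \<delta> k
      else SOME x. x \<in> mspace (M n))" for n
    have ab: "a n \<in> mspace (M n) \<and> mdist (N n) (g l n (a n)) (g k n (a n)) > \<delta> l + \<delta> k" if nb: "n \<in> bad k l" for n
    proof -
      have "\<exists>x. x \<in> mspace (M n) \<and> mdist (N n) (g l n x) (g k n x) > \<delta> l + \<delta> k" using nb by (auto simp: bad_def)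
      from someI_ex[OF this] show ?thesis using nb by (simp add: a_def)
    qed
    have "a n \<in> mspace (M n)" for n
    proof (cases "n \<in> bad k l")
      case False
      then show ?thesis using Mne[of n] by (simp add: a_def some_in_eq)
    qed (use ab in blast)
    then have aM: "a \<in> seq_space M" by (simp add: seq_space_def)
    have "bad k l \<subseteq> {n. mdist (N n) (\<Psi> a n) (g l n (a n)) > \<delta> l} \<union> {n. mdist (N n) (\<Psi> a n) (g k n (a n)) > \<delta> k}"
    proof
      fix n assume n: "n \<in> bad k l"
      have "mdist (N n) (g l n (a n)) (g k n (a n)) \<le> mdist (N n) (g l n (a n)) (\<Psi> a n) + mdist (N n) (\<Psi> a n) (g k n (a n))"
        using gN seq_space_nth[OF \<Psi>[OF aM]] by (intro mdist_triangle)
      moreover have "mdist (N n) (g l n (a n)) (\<Psi> a n) = mdist (N n) (\<Psi> a n) (g l n (a n))" by (rule mdist_commute)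
      ultimately show "n \<in> {n. mdist (N n) (\<Psi> a n) (g l n (a n)) > \<delta> l} \<union> {n. mdist (N n) (\<Psi> a n) (g k n (a n)) > \<delta> k}"
        using ab[OF n] by auto
    qed
    then show ?thesis using g[OF aM] by (meson finite_UnI finite_subset)
  qed
  have "\<exists>b. \<forall>n\<in>\<Union>l\<le>k. bad k l. n < b" for k
  proof -
    have "finite (\<Union>l\<le>k. bad k l)" using finbad by simp
    then show ?thesis unfolding finite_nat_set_iff_bounded by blast
  qed
  then obtain b where b: "\<And>k l n. l \<le> k \<Longrightarrow> n \<in> bad k l \<Longrightarrow> n < b k" by (metis UN_I atMost_iff)
  \<comment> \<open>Summation makes \<open>c\<close> monotone and at least \<open>k\<close>, while
    it still dominates \<open>b\<close>.\<close>
  define c where "c k = (\<Sum>j\<le>k. Suc (b j))" for k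
  have cb: "b k \<le> c k" and ck: "k \<le> c k" for k
  proof -
    have "Suc (b k) \<le> c k" unfolding c_def by (rule member_le_sum) auto
    then show "b k \<le> c k" by simp
    show "k \<le> c k" by (induction k) (simp_all add: c_def)
  qed
  have cmono: "c k \<le> c l" if "k \<le> l" for k l using that unfolding c_def by (intro sum_mono2) auto
  \<comment> \<open>At the coordinate \<open>n\<close> we use the approximation number \<open>K n\<close>, which tends to infinity slowly
    enough for the approximations up to \<open>K n\<close> to be close to each other there.\<close>
  define K where "K n = Max (insert 0 {k. c k \<le> n})" for n
  have fK: "finite (insert 0 {k. c k \<le> n})" for n
  proof -
    have "{k. c k \<le> n} \<subseteq> {..n}" using ck le_trans by blast
    then show ?thesis using finite_subset by blast
  qed
  have Kge: "k \<le> K n" if "c k \<le> n" for k n unfolding K_def using fK that by (intro Max_ge) auto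
  have Kc: "c (K n) \<le> n" if "c 0 \<le> n" for n
  proof -
    have "K n \<in> insert 0 {k. c k \<le> n}" unfolding K_def using fK by (intro Max_in) auto
    then show ?thesis using that by auto
  qed
  define g' where "g' n x = g (K n) n x" for n x
  have "finite {n. mdist (N n) (\<Psi> a n) (g' n (a n)) > \<epsilon>}" if a: "a \<in> seq_space M" and \<epsilon>: "\<epsilon> > 0" for a \<epsilon>
  proof -
    \<comment> \<open>A third of \<epsilon>: one precision for \<open>g l\<close>, and at most two
      for the passage to \<open>g (K n)\<close>.\<close>
    obtain l where l: "\<delta> l < \<epsilon> / 3" using nat_approx_posE[of "\<epsilon> / 3"] \<epsilon> unfolding \<delta>_def by (metis divide_pos_pos zero_less_numeral)
    have "{n. mdist (N n) (\<Psi> a n) (g' n (a n)) > \<epsilon>} \<subseteq> {n. mdist (N n) (\<Psi> a n) (g l n (a n)) > \<delta> l} \<union> {..<c l}"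
    proof (rule subsetI, rule ccontr)
      fix n assume n: "n \<in> {n. mdist (N n) (\<Psi> a n) (g' n (a n)) > \<epsilon>}"
        "n \<notin> {n. mdist (N n) (\<Psi> a n) (g l n (a n)) > \<delta> l} \<union> {..<c l}"
      then have n1: "mdist (N n) (\<Psi> a n) (g l n (a n)) \<le> \<delta> l" and n2: "c l \<le> n" by auto
      have lK: "l \<le> K n" using Kge[OF n2] .
      have "c 0 \<le> n" using cmono[of 0 l] n2 by simp
      then have "b (K n) \<le> n" using Kc[of n] cb[of "K n"] by simp
      then have "n \<notin> bad (K n) l" using b[OF lK, of n] by auto
      then have "mdist (N n) (g l n (a n)) (g (K n) n (a n)) \<le> \<delta> l + \<delta> (K n)"
        using seq_space_nth[OF a, of n] unfolding bad_def by auto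
      moreover have "\<delta> (K n) \<le> \<delta> l" by (rule \<delta>mono[OF lK])
      moreover have "mdist (N n) (\<Psi> a n) (g' n (a n)) \<le> mdist (N n) (\<Psi> a n) (g l n (a n)) + mdist (N n) (g l n (a n)) (g (K n) n (a n))"
        unfolding g'_def using gN seq_space_nth[OF \<Psi>[OF a]] by (intro mdist_triangle)
      ultimately have "mdist (N n) (\<Psi> a n) (g' n (a n)) \<le> 3 * \<delta> l" using n1 by simp
      then show False using n(1) l by simp
    qed
    moreover have "finite ({n. mdist (N n) (\<Psi> a n) (g l n (a n)) > \<delta> l} \<union> {..<c l})" using g[OF a] by simp
    ultimately show ?thesis using finite_subset by blast
  qed
  moreover have "g' n x \<in> mspace (N n)" for n x by (simp add: g'_def gN)
  ultimately show ?thesis by blast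
qed

text \<open>Renumbering the spaces \<open>N n\<close> by the map \<open>h\<close> that induces the
  automorphism turns the hypothesis on \<open>\<phi>\<close> into coherence at single coordinates,
  to which \<open>coordinate_maps\<close> applies. The almost permutation sought is the inverse of
  \<open>h\<close>.\<close>

theorem theorem2p5:
  fixes M :: "nat \<Rightarrow> 'a metric" and N :: "nat \<Rightarrow> 'b metric"
    and \<phi> :: "(nat \<Rightarrow> 'a) set \<Rightarrow> (nat \<Rightarrow> 'b) set"
  assumes "OCA" and "MA_sigma_linked"
    and "\<And>n. finite (mspace (M n))" and "uniformly_bounded_diameter M"
    and "\<And>n. mspace (N n) \<noteq> {}"
    and "\<And>n. separable_space (mtopology_of (N n))" and "uniformly_bounded_diameter N"
    and "\<phi> \<in> reduced_product M \<rightarrow> reduced_product N"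
    and "coordinate_respecting M N \<phi>"
  shows "trivial_map M N \<phi>"
proof (cases "seq_space M = {}")
  case True
  \<comment> \<open>There are no sequences in this case, so only maps of the right form have to be
    supplied.\<close>
  have "almost_permutation id" unfolding almost_permutation_def
    by (intro exI[of _ UNIV]) simp
  moreover have "(\<lambda>_. SOME y. y \<in> mspace (N n)) \<in> mspace (M (id n)) \<rightarrow> mspace (N n)" for n
    using assms(5)[of n] by (simp add: some_in_eq)
  ultimately show ?thesis unfolding trivial_map_def
    using True by (intro exI[of _ id] exI[of _ "\<lambda>n _. SOME y. y \<in> mspace (N n)"]) auto
next
  case False
  then obtain s where s: "s \<in> seq_space M" by blast
  have Mne: "mspace (M n) \<noteq> {}" for n using seq_space_nth[OF s, of n] by blast
  obtain \<alpha> where \<alpha>: "pow_fin_automorphism \<alpha>"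
    and resp: "\<And>S T x y. abs_pow_fin T = \<alpha> (abs_pow_fin S) \<Longrightarrow> x \<in> reduced_product M \<Longrightarrow>
      y \<in> reduced_product M \<Longrightarrow> red_eq_on M S x y \<Longrightarrow> red_eq_on N T (\<phi> x) (\<phi> y)"
    using assms(9) unfolding coordinate_respecting_def by blast
  interpret pow_fin_lift "\<lambda>S. rep_pow_fin (\<alpha> (abs_pow_fin S))" by (rule pow_fin_lift_automorphism[OF \<alpha>])
  obtain h :: "nat \<Rightarrow> nat" where h: "\<And>S. eq_mod_fin (rep_pow_fin (\<alpha> (abs_pow_fin S))) (h ` S)"
    using induced_by_function[OF assms(1,2)] by blast
  obtain A where A: "finite (- A)" "inj_on h A" "finite (- (h ` A))" using almost_injective[OF h] by blast
  have habs: "abs_pow_fin (h ` S) = \<alpha> (abs_pow_fin S)" for S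
    using h[of S] Quotient_abs_rep[OF Quotient_pow_fin, of "\<alpha> (abs_pow_fin S)"] by (simp add: pow_fin.abs_eq_iff[symmetric])
  have cls: "red_class M a \<in> reduced_product M" if "a \<in> seq_space M" for a
    using that unfolding red_class_def reduced_product_def by (rule quotientI)
  have "\<exists>b\<in>seq_space N. \<phi> (red_class M a) = red_class N b" if "a \<in> seq_space M" for a
  proof -
    have "\<phi> (red_class M a) \<in> reduced_product N" using assms(8) cls[OF that] by blast
    then show ?thesis unfolding reduced_product_def
    proof (rule quotientE)
      fix x assume "\<phi> (red_class M a) = asymp_eq_rel N `` {x}" "x \<in> seq_space N"
      then show ?thesis by (intro bexI[of _ x]) (simp_all add: red_class_def[of N])
    qed
  qed
  then obtain \<Phi> where \<Phi>: "\<And>a. a \<in> seq_space M \<Longrightarrow> \<Phi> a \<in> seq_space N"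
    "\<And>a. a \<in> seq_space M \<Longrightarrow> \<phi> (red_class M a) = red_class N (\<Phi> a)" by metis
  \<comment> \<open>The hypothesis is applied to the set where \<open>a\<close> and \<open>b\<close>
    agree; its image under \<open>h\<close> represents its value under
    \<open>\<alpha>\<close>.\<close>
  have lim0: "limsup_dist_on N (h ` {n. a n = b n}) (\<Phi> a) (\<Phi> b) = 0" if ab: "a \<in> seq_space M" "b \<in> seq_space M" for a b
  proof -
    have "limsup_dist_on M {n. a n = b n} a b = 0" by (rule limsup_dist_on_eq_0[OF ab(1)]) simp
    then have "red_eq_on M {n. a n = b n} (red_class M a) (red_class M b)"
      unfolding red_eq_on_def red_dist_red_class[OF ab] .
    then have "red_eq_on N (h ` {n. a n = b n}) (\<phi> (red_class M a)) (\<phi> (red_class M b))"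
      by (rule resp[OF habs cls[OF ab(1)] cls[OF ab(2)]])
    then show ?thesis unfolding \<Phi>(2)[OF ab(1)] \<Phi>(2)[OF ab(2)] red_eq_on_def red_dist_red_class[OF \<Phi>(1)[OF ab(1)] \<Phi>(1)[OF ab(2)]] .
  qed
  define N' where "N' i = N (h i)" for i
  define \<Psi> where "\<Psi> a i = \<Phi> a (h i)" for a i
  have "\<exists>g. (\<forall>n x. g n x \<in> mspace (N' n)) \<and>
    (\<forall>a\<in>seq_space M. \<forall>\<epsilon>>0. finite {n. mdist (N' n) (\<Psi> a n) (g n (a n)) > \<epsilon>})"
  proof (rule coordinate_maps[OF assms(1,2,3) Mne])
    show "mspace (N' n) \<noteq> {}" "separable_space (mtopology_of (N' n))" for n using assms(5,6) by (simp_all add: N'_def)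
    show "\<Psi> a \<in> seq_space N'" if "a \<in> seq_space M" for a
      using seq_space_nth[OF \<Phi>(1)[OF that]] by (simp add: seq_space_def \<Psi>_def N'_def)
    show "finite {n. a n = b n \<and> mdist (N' n) (\<Psi> a n) (\<Psi> b n) > \<epsilon>}" if ab: "a \<in> seq_space M" "b \<in> seq_space M" and \<epsilon>: "\<epsilon> > 0" for a b \<epsilon>
    proof -
      define F where "F = {n. a n = b n \<and> mdist (N' n) (\<Psi> a n) (\<Psi> b n) > \<epsilon>}"
      have "h ` (F \<inter> A) \<subseteq> {n \<in> h ` {n. a n = b n}. mdist (N n) (\<Phi> a n) (\<Phi> b n) > \<epsilon>}"
        by (auto simp: F_def N'_def \<Psi>_def)
      then have "finite (h ` (F \<inter> A))"
        using limsup_dist_on_eq_0D[OF lim0[OF ab] \<epsilon>] finite_subset by blast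
      moreover have "inj_on h (F \<inter> A)" using A(2) by (rule inj_on_subset) blast
      ultimately have "finite (F \<inter> A)" by (rule finite_imageD)
      then have "finite ((F \<inter> A) \<union> - A)" using A(1) by simp
      then have "finite F" by (rule rev_finite_subset) blast
      then show ?thesis by (simp add: F_def)
    qed
  qed
  then obtain g where gN: "\<And>n x. g n x \<in> mspace (N (h n))"
    and g: "\<And>a \<epsilon>. a \<in> seq_space M \<Longrightarrow> \<epsilon> > 0 \<Longrightarrow> finite {n. mdist (N (h n)) (\<Phi> a (h n)) (g n (a n)) > \<epsilon>}"
    unfolding N'_def \<Psi>_def by blast
  define f where "f = the_inv_into A h"
  have hf: "h (f n) = n" if "n \<in> h ` A" for n using f_the_inv_into_f[OF A(2) that] by (simp add: f_def)
  have "bij_betw f (h ` A) A" unfolding f_def using A(2) by (intro bij_betw_the_inv_into) (simp add: bij_betw_def)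
  then have "almost_permutation f" unfolding almost_permutation_def using A(1,3) by blast
  \<comment> \<open>Off the cofinite range of \<open>h\<close> on \<open>A\<close> an arbitrary
    point is used, which does not affect the class.\<close>
  moreover define k where "k n x = (if n \<in> h ` A then g (f n) x else SOME y. y \<in> mspace (N n))" for n x
  have kN: "k n x \<in> mspace (N n)" for n x
  proof (cases "n \<in> h ` A")
    case True
    then show ?thesis using gN[of "f n" x] hf[OF True] by (simp add: k_def)
  next
    case False
    then show ?thesis using assms(5)[of n] by (simp add: k_def some_in_eq)
  qed
  moreover have "\<phi> (red_class M a) = red_class N (\<lambda>n. k n (a (f n)))" if a: "a \<in> seq_space M" for a
  proof -
    have "(\<lambda>n. mdist (N n) (\<Phi> a n) (k n (a (f n)))) \<longlonglongrightarrow> 0"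
    proof (rule LIMSEQ_I)
      fix r :: real assume r: "r > 0"
      define F where "F = {n. mdist (N (h n)) (\<Phi> a (h n)) (g n (a n)) > r / 2}"
      have "finite (h ` F \<union> - (h ` A))" using g[OF a, of "r / 2"] r A(3) by (simp add: F_def)
      then obtain n0 where n0: "\<And>n. n \<in> h ` F \<union> - (h ` A) \<Longrightarrow> n < n0" unfolding finite_nat_set_iff_bounded by blast
      have "norm (mdist (N n) (\<Phi> a n) (k n (a (f n))) - 0) < r" if "n \<ge> n0" for n
      proof -
        have n: "n \<notin> h ` F" "n \<in> h ` A" using n0[of n] that by auto
        then have "f n \<notin> F" using hf[OF n(2)] by (metis imageI)
        then have "mdist (N n) (\<Phi> a n) (k n (a (f n))) \<le> r / 2" using hf[OF n(2)] n(2) by (simp add: F_def k_def)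
        then show ?thesis using r by simp
      qed
      then show "\<exists>no. \<forall>n\<ge>no. norm (mdist (N n) (\<Phi> a n) (k n (a (f n))) - 0) < r" by blast
    qed
    then have "(\<Phi> a, \<lambda>n. k n (a (f n))) \<in> asymp_eq_rel N"
      using \<Phi>(1)[OF a] kN by (simp add: asymp_eq_rel_def seq_space_def)
    then have "red_class N (\<Phi> a) = red_class N (\<lambda>n. k n (a (f n)))"
      unfolding red_class_def by (rule equiv_class_eq[OF equiv_asymp_eq_rel])
    then show ?thesis using \<Phi>(2)[OF a] by simp
  qed
  ultimately show ?thesis unfolding trivial_map_def by blast
qed

end
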